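(* The smallest accumulation point of the set $\{L(P)\in\mathbb{R} : P\in\mathscr{Q}\}$ is $2$, where for $P\in\mathscr{Q}$, $L(P)=\limsup \hat\delta(P;(a,b))^{-1}$ with the limit superior taken over Pythagorean pairs $(a,b)$ as $\sqrt{a^2+b^2}\to\infty$.
   Context: $\mathscr{Q}=\{(x,y)\in\mathbb{R}^2: x^2+y^2=1,\ x,y\ge0\}$ and $O$ is the origin. A Pythagorean pair is a pair $(a,b)$ of nonnegative coprime integers such that $a^2+b^2$ is a perfect square. For $P\in\mathscr{Q}$, $\hat\delta(P;(a,b))$ is the Euclidean distance from $(a,b)$ to the half-line $\overrightarrow{OP}$. Only those $P$ with $L(P)$ finite contribute to the set. *)

theory Defs
  imports "HOL-Analysis.Analysis" "HOL-Computational_Algebra.Nth_Powers"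
begin

definition quarter_circle :: "(real \<times> real) set" where
  "quarter_circle = {(x, y). x\<^sup>2 + y\<^sup>2 = 1 \<and> x \<ge> 0 \<and> y \<ge> 0}"

definition half_line :: "real \<times> real \<Rightarrow> (real \<times> real) set" where
  "half_line P = {t *\<^sub>R P | t. t \<ge> 0}"

definition pyth_pairs :: "(nat \<times> nat) set" where
  "pyth_pairs = {(a, b). coprime a b \<and> is_square (a\<^sup>2 + b\<^sup>2)}"

text \<open>The metric on \<^typ>\<open>real \<times> real\<close> is the Euclidean one.\<close>

definition ray_dist :: "real \<times> real \<Rightarrow> nat \<times> nat \<Rightarrow> real" where
  "ray_dist P = (\<lambda>(a, b). infdist (real a, real b) (half_line P))"

definition pyth_at_infinity :: "(nat \<times> nat) filter" where
  "pyth_at_infinity =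
     inf (filtercomap (\<lambda>(a, b). sqrt ((real a)\<^sup>2 + (real b)\<^sup>2)) at_top) (principal pyth_pairs)"

text \<open>
  In \<^typ>\<open>ereal\<close> we have \<open>inverse 0 = \<infinity>\<close>. A distance of \<open>0\<close> occurs for at most one
  Pythagorean pair (the entries are coprime), so this does not affect the limit superior.
\<close>

definition lagrange_number :: "real \<times> real \<Rightarrow> ereal" where
  "lagrange_number P = Limsup pyth_at_infinity (\<lambda>p. inverse (ereal (ray_dist P p)))"

definition lagrange_spectrum :: "real set" where
  "lagrange_spectrum = {l. \<exists>P\<in>quarter_circle. lagrange_number P = ereal l}"

end

theory Submission
  imports Defs
begin

text \<open>
  The substitution \<open>a : b = Y (2 X + Y) : 2 X (X + Y)\<close> turns the distance from a Pythagorean pair to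
  a ray into the value of an indefinite binary quadratic form of discriminant \<open>1\<close> at a coprime pair
  \<open>(X, Y)\<close>, doubled when \<open>Y\<close> is odd. These weighted values are invariant under the symmetries of the
  tessellation of the hyperbolic plane by ideal squares with base square \<open>\<infinity>, 0, 1/2, 1\<close>. A geodesic
  running through the squares is recorded by digits \<open>L, S, R\<close> (Romik's expansion), and the Lagrange
  number is the limit superior of the Euclidean widths of the geodesic, seen from the corners it passes.

  If the widths stay below \<open>2 - e\<close>, then \<open>LL\<close>, \<open>RR\<close>, \<open>SLS\<close> and \<open>SRS\<close> do not occur, and descent
  arguments show that, up to reflection, the digits eventually form a word in the two blocks \<open>S\<close> and
  \<open>LR\<close> satisfying Markov's condition with a bounded mismatch length. In such a word one letter is
  eventually isolated; grouping it with the other letter yields a word of the same kind with a smaller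
  bound. Hence only finitely many tails occur. Conversely the periodic words \<open>S (LR)\<^sup>n\<close> have
  Lagrange numbers below \<open>2\<close> which tend to \<open>2\<close>.
\<close>

section \<open>Parametrisation of Pythagorean pairs\<close>

text \<open>The number 2 enters through one identity: when \<open>L\<close> stands between
  \<open>S\<close> and \<open>R\<close>, the width seen from \<infinity> is 2 - (1 - 2 z w) / d with
  d >= 2, where z is the future behind the three digits and w the past before them. A width below 2
  thus says z < 1 / (2 w), a comparison of the future with the reflected past, and a margin e
  sharpens it to z < (1 - 2 e) / (2 w). Digits are increasing maps, so such inequalities compare
  digit words lexicographically; the descents rest on this. \<open>S\<close> and \<open>LR\<close>
  are the right blocks because reversing and reflecting either one gives it back: future and
  reflected past then obey one recursion. Its maps contract [1/2, 3/2], so the margin limits how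
  long both sides can agree. An obstacle is that the distance to a ray fixes the second root of the
  form, whereas shifting digits alters it. Replacing that root costs an arbitrarily small amount, so
  finiteness passes from a threshold \<open>\<tau>\<close> to every \<open>\<tau>' < \<tau>\<close>.
  For the lower bounds, a period of digits is an automorphism of the form; it would permute a finite
  set of small values, yet a corner in that set has no preimage.\<close>

definition coprime_pairs :: "(nat \<times> nat) set" where
  "coprime_pairs = {(X, Y). coprime X Y}"

text \<open>With m = X + Y and n = X this is Euclid's (m^2 - n^2, 2 m n). For a coprime pair with Y
  even, m and n are both odd and the common factor 2 is divided out; this branch yields the pairs
  whose first leg is even.\<close>

definition pyth_param :: "nat \<times> nat \<Rightarrow> nat \<times> nat" where
  "pyth_param = (\<lambda>(X, Y). if even Y then (Y div 2 * (2 * X + Y), X * (X + Y))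
                             else (Y * (2 * X + Y), 2 * X * (X + Y)))"

lemma coprime_add_nat_simps:
  fixes a b :: nat
  shows "coprime (a + b) b \<longleftrightarrow> coprime a b" "coprime (b + a) b \<longleftrightarrow> coprime a b"
    "coprime b (a + b) \<longleftrightarrow> coprime b a" "coprime b (b + a) \<longleftrightarrow> coprime b a"
proof -
  show *: "coprime (a + b) b \<longleftrightarrow> coprime a b" by (simp add: coprime_iff_gcd_eq_1)
  show "coprime (b + a) b \<longleftrightarrow> coprime a b" using * by (simp add: add.commute)
  show "coprime b (a + b) \<longleftrightarrow> coprime b a" "coprime b (b + a) \<longleftrightarrow> coprime b a"
    using * by (simp_all add: coprime_commute add.commute)
qed

text \<open>The halves p of c + a and q of c - a are coprime with product (b / 2)^2, so both are
  squares. The case b = 0 is included, with n = 0.\<close>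

lemma pyth_triple_odd_leg:
  fixes a b c :: nat
  assumes co: "coprime a b" and "odd a" and eq: "a\<^sup>2 + b\<^sup>2 = c\<^sup>2"
  obtains m n where "n \<le> m" "coprime m n" "odd (m + n)" "a = m\<^sup>2 - n\<^sup>2" "b = 2 * m * n"
proof -
  have "even b"
  proof (rule ccontr)
    assume "odd b"
    have sq: "n\<^sup>2 mod 4 = (if even n then 0 else 1)" for n :: nat
    proof (cases "even n")
      case False
      then obtain k where "n = 2 * k + 1" by (rule oddE)
      then have "n\<^sup>2 = 1 + 4 * (k\<^sup>2 + k)" by (simp add: power2_eq_square algebra_simps)
      then show ?thesis using False by (simp only: mod_mult_self2) simp
    qed (auto elim!: evenE simp: power_mult_distrib)
    have "(a\<^sup>2 + b\<^sup>2) mod 4 = (a\<^sup>2 mod 4 + b\<^sup>2 mod 4) mod 4" by (simp add: mod_add_eq)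
    then have "(a\<^sup>2 + b\<^sup>2) mod 4 = 2" using \<open>odd a\<close> \<open>odd b\<close> by (simp add: sq)
    moreover have "c\<^sup>2 mod 4 \<noteq> 2" by (simp add: sq)
    ultimately show False using eq by simp
  qed
  then obtain b' where b': "b = 2 * b'" by blast
  have "odd (c\<^sup>2)" using eq \<open>odd a\<close> \<open>even b\<close> by (metis even_add even_power zero_less_numeral)
  then have "odd c" by simp
  have "a \<le> c" using eq by (metis le_add1 power2_nat_le_eq_le)
  have "even (c - a)" using \<open>odd c\<close> \<open>odd a\<close> \<open>a \<le> c\<close> by simp
  then obtain q where q: "c - a = 2 * q" by blast
  define p where "p = a + q"
  have pq: "c = p + q" "a = p - q" "q \<le> p"
    using q \<open>a \<le> c\<close> unfolding p_def by simp_all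
  have "(p + q)\<^sup>2 = (p - q)\<^sup>2 + 4 * (p * q)"
    using \<open>q \<le> p\<close> by (auto simp: le_iff_add power2_eq_square algebra_simps)
  then have "4 * (p * q) = b\<^sup>2" using eq pq by simp
  then have pqb: "p * q = b' ^ 2" by (simp add: b' power2_eq_square)
  have "coprime p q"
  proof (rule coprimeI)
    fix d assume "d dvd p" "d dvd q"
    then have "d dvd a" using pq by (simp add: dvd_diff_nat)
    have "d * d dvd b' * b'" using pqb mult_dvd_mono[OF \<open>d dvd p\<close> \<open>d dvd q\<close>]
      by (simp add: power2_eq_square)
    then have "d dvd b'" by (metis power2_eq_square pow_divides_pow_iff zero_less_numeral)
    then have "d dvd b" by (simp add: b')
    with \<open>d dvd a\<close> co show "is_unit d" by (meson coprime_common_divisor)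
  qed
  have "is_square (p * q)" using pqb by (auto simp: is_nth_power_def)
  then have "is_square p" "is_square q"
    using is_nth_power_mult_coprime_nat_iff[OF \<open>coprime p q\<close>] by auto
  then obtain m n where mn: "p = m\<^sup>2" "q = n\<^sup>2" by (auto simp: is_nth_power_def)
  have "n \<le> m" using \<open>q \<le> p\<close> mn by (simp add: power2_nat_le_eq_le)
  moreover have "coprime m n" using \<open>coprime p q\<close> mn by simp
  moreover have "odd (m + n)" using \<open>odd c\<close> pq mn by simp
  moreover have "b' = m * n" using pqb mn by (metis power_mult_distrib power2_eq_iff_nonneg zero_le)
  ultimately show thesis using that pq mn b' by simp
qed

lemma pyth_pairs_subset_param: "pyth_pairs \<subseteq> pyth_param ` coprime_pairs"
proof
  fix p assume "p \<in> pyth_pairs"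
  then obtain a b c where p: "p = (a, b)" and co: "coprime a b" and eq: "a\<^sup>2 + b\<^sup>2 = c\<^sup>2"
    by (auto simp: pyth_pairs_def is_nth_power_def)
  show "p \<in> pyth_param ` coprime_pairs"
  proof (cases "odd a")
    case True
    from pyth_triple_odd_leg[OF co True eq] obtain m n
      where mn: "n \<le> m" "coprime m n" "odd (m + n)" "a = m\<^sup>2 - n\<^sup>2" "b = 2 * m * n" .
    from \<open>n \<le> m\<close> obtain k where k: "m = n + k" using le_Suc_ex by blast
    have "coprime n k" using mn(2) k by (simp add: coprime_add_nat_simps coprime_commute)
    moreover have "odd k" using mn(3) k by (simp add: even_add) argo
    moreover have "a = k * (2 * n + k)" using mn(4) k by (simp add: power2_eq_square algebra_simps)
    moreover have "b = 2 * n * (n + k)" using mn(5) k by (simp add: algebra_simps)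
    ultimately show ?thesis
      by (intro image_eqI[of _ _ "(n, k)"]) (auto simp: p pyth_param_def coprime_pairs_def)
  next
    case False
    then have "odd b" using co by (metis coprime_common_divisor odd_one)
    from co eq have "coprime b a" "b\<^sup>2 + a\<^sup>2 = c\<^sup>2" by (simp_all add: coprime_commute add.commute)
    from pyth_triple_odd_leg[OF this(1) \<open>odd b\<close> this(2)] obtain m n
      where mn: "n \<le> m" "coprime m n" "odd (m + n)" "b = m\<^sup>2 - n\<^sup>2" "a = 2 * m * n" .
    from \<open>n \<le> m\<close> obtain k where k: "m = n + k" using le_Suc_ex by blast
    have "coprime n k" using mn(2) k by (simp add: coprime_add_nat_simps coprime_commute)
    moreover have "odd k" using mn(3) k by (simp add: even_add) argo
    \<comment> \<open>The legs are swapped, so X = m - n and Y = 2 n: here Y is even and the other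
      branch of \<open>pyth_param\<close> applies.\<close>
    ultimately have "coprime k (2 * n)" by (simp add: coprime_commute)
    moreover have "a = n * (2 * k + 2 * n)" using mn(5) k by (simp add: algebra_simps)
    moreover have "b = k * (k + 2 * n)" using mn(4) k by (simp add: power2_eq_square algebra_simps)
    ultimately show ?thesis
      by (intro image_eqI[of _ _ "(k, 2 * n)"]) (auto simp: p pyth_param_def coprime_pairs_def)
  qed
qed

lemma pyth_param_in_pyth_pairs:
  assumes "v \<in> coprime_pairs"
  shows "pyth_param v \<in> pyth_pairs"
proof -
  obtain X Y where v: "v = (X, Y)" and co: "coprime X Y" using assms by (auto simp: coprime_pairs_def)
  have c1: "coprime X (X + Y)" "coprime Y (X + Y)" using co by (simp_all add: coprime_add_nat_simps coprime_commute)
  show ?thesis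
  proof (cases "even Y")
    case True
    then obtain Z where Z: "Y = 2 * Z" by blast
    have "odd X" using co True by (metis coprime_common_divisor odd_one)
    have cXZ: "coprime X Z" using co Z by simp
    have "coprime Z (X + Y)" "coprime (X + Z) X" "coprime (X + Z) (X + Y)"
    proof -
      show "coprime Z (X + Y)" using c1(2) Z by simp
      show "coprime (X + Z) X" using cXZ by (simp add: coprime_add_nat_simps coprime_commute)
      have "coprime (X + Z) Z" using cXZ by (simp add: coprime_add_nat_simps coprime_commute)
      then have "coprime (X + Z) ((X + Z) + Z)" by (simp add: coprime_add_nat_simps)
      then show "coprime (X + Z) (X + Y)" by (simp add: Z add.assoc mult_2)
    qed
    moreover have "coprime 2 X" "coprime 2 (X + Y)" using \<open>odd X\<close> True by auto
    ultimately have "coprime (Z * (2 * (X + Z))) (X * (X + Y))"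
      using cXZ by (auto simp: coprime_commute simp del: distrib_left_numeral)
    moreover have "(Z * (2 * (X + Z)))\<^sup>2 + (X * (X + Y))\<^sup>2 = (X\<^sup>2 + 2 * X * Z + 2 * Z\<^sup>2)\<^sup>2"
      by (simp add: Z power2_eq_square algebra_simps)
    moreover have "pyth_param v = (Z * (2 * (X + Z)), X * (X + Y))"
      by (simp add: v pyth_param_def Z algebra_simps)
    ultimately show ?thesis by (auto simp: pyth_pairs_def is_nth_power_def)
  next
    case False
    have "coprime Y (2 * X)" "coprime Y (X + Y)"
      using c1 co False by (auto simp: coprime_commute)
    moreover have "coprime (2 * X + Y) X" "coprime (2 * X + Y) 2" "coprime (2 * X + Y) (X + Y)"
    proof -
      show "coprime (2 * X + Y) 2" using False by simp
      have "coprime (X + (X + Y)) X" using co by (simp add: coprime_add_nat_simps coprime_commute)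
      then show "coprime (2 * X + Y) X" by (simp add: mult_2 add.assoc)
      have "coprime (X + (X + Y)) (X + Y)" using c1(1) by (simp add: coprime_add_nat_simps)
      then show "coprime (2 * X + Y) (X + Y)" by (simp add: mult_2 add.assoc)
    qed
    ultimately have "coprime (Y * (2 * X + Y)) (2 * X * (X + Y))" by auto
    moreover have "(Y * (2 * X + Y))\<^sup>2 + (2 * X * (X + Y))\<^sup>2 = (2 * X\<^sup>2 + 2 * X * Y + Y\<^sup>2)\<^sup>2"
      by (simp add: power2_eq_square algebra_simps)
    ultimately show ?thesis using False by (auto simp: v pyth_param_def pyth_pairs_def is_nth_power_def)
  qed
qed

text \<open>Properness of the parametrisation: only finitely many coprime pairs lie over a finite
  set, so finiteness pulls back without any injectivity.\<close>

lemma pyth_param_sum_ge: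
  assumes "(X, Y) \<in> coprime_pairs" "pyth_param (X, Y) = (a, b)"
  shows "X + Y \<le> a + b"
proof (cases "even Y")
  case True
  then have "odd X" using assms by (auto simp: coprime_pairs_def dest: coprime_common_divisor)
  then have "X \<ge> 1" by (cases X) auto
  then have "X + Y \<le> X * (X + Y)" by simp
  then show ?thesis using True assms by (auto simp: pyth_param_def intro: trans_le_add2)
next
  case False
  then have "Y \<ge> 1" by (cases Y) auto
  then have "2 * X + Y \<le> Y * (2 * X + Y)" by simp
  then have "X + Y \<le> Y * (2 * X + Y)" by linarith
  then show ?thesis using False assms by (auto simp: pyth_param_def intro: trans_le_add1)
qed

lemma finite_sum_le: "finite {(X, Y). X + Y \<le> (B :: nat)}"
  by (rule finite_subset[of _ "{..B} \<times> {..B}"]) auto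

lemma finite_pyth_param_vimage:
  assumes "finite W"
  shows "finite {v \<in> coprime_pairs. pyth_param v \<in> W}"
proof -
  obtain B where B: "\<And>a b. (a, b) \<in> W \<Longrightarrow> a + b \<le> (B :: nat)"
  proof -
    have "finite ((\<lambda>(a, b). a + b) ` W)" using assms by simp
    then obtain B where "\<forall>n\<in>(\<lambda>(a, b). a + b) ` W. n \<le> B" using finite_nat_set_iff_bounded_le by blast
    then show thesis using that by force
  qed
  have "{v \<in> coprime_pairs. pyth_param v \<in> W} \<subseteq> {(X, Y). X + Y \<le> B}"
  proof clarify
    fix X Y assume v: "(X, Y) \<in> coprime_pairs" "pyth_param (X, Y) \<in> W"
    obtain a b where ab: "pyth_param (X, Y) = (a, b)" by (cases "pyth_param (X, Y)")
    then have "X + Y \<le> a + b" using v pyth_param_sum_ge by blast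
    also have "a + b \<le> B" using B v ab by simp
    finally show "X + Y \<le> B" .
  qed
  then show ?thesis using finite_sum_le finite_subset by blast
qed

lemma infinite_pyth_pairs: "infinite pyth_pairs"
proof
  assume "finite pyth_pairs"
  from finite_pyth_param_vimage[OF this]
  have "finite {v \<in> coprime_pairs. pyth_param v \<in> pyth_pairs}" .
  moreover have "range (\<lambda>n. (n, 1)) \<subseteq> {v \<in> coprime_pairs. pyth_param v \<in> pyth_pairs}"
    using pyth_param_in_pyth_pairs by (auto simp: coprime_pairs_def)
  ultimately have "finite (range (\<lambda>n :: nat. (n, 1 :: nat)))" using finite_subset by blast
  then show False by (auto dest!: finite_imageD simp: inj_on_def)
qed

section \<open>Distances to the ray and the limit superior\<close>

text \<open>The determinant gives the distance to the whole line. The foot of the perpendicular has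
  parameter \<open>t0 \<ge> 0\<close>, as all coordinates are nonnegative, so it lies on the
  ray.\<close>

lemma ray_dist_eq:
  assumes "(u, v) \<in> quarter_circle"
  shows "ray_dist (u, v) (a, b) = \<bar>real a * v - real b * u\<bar>"
proof -
  from assms have uv: "u\<^sup>2 + v\<^sup>2 = 1" "u \<ge> 0" "v \<ge> 0" by (auto simp: quarter_circle_def)
  define d where "d = real a * v - real b * u"
  define t0 where "t0 = real a * u + real b * v"
  have dist_eq: "dist (real a, real b) (t *\<^sub>R (u, v)) = sqrt (d\<^sup>2 + (t - t0)\<^sup>2)" for t
  proof -
    have "(real a - t * u)\<^sup>2 + (real b - t * v)\<^sup>2 =
        (real a)\<^sup>2 + (real b)\<^sup>2 - 2 * t * t0 + t\<^sup>2 * (u\<^sup>2 + v\<^sup>2)"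
      by (simp add: t0_def power2_eq_square algebra_simps)
    also have "\<dots> = ((real a)\<^sup>2 + (real b)\<^sup>2) * (u\<^sup>2 + v\<^sup>2) - 2 * t * t0 + t\<^sup>2"
      by (simp add: uv)
    also have "\<dots> = d\<^sup>2 + (t - t0)\<^sup>2"
      by (simp add: t0_def d_def power2_eq_square algebra_simps)
    finally show ?thesis by (simp add: dist_Pair_Pair dist_real_def)
  qed
  have ne: "half_line (u, v) \<noteq> {}" by (auto simp: half_line_def)
  have "t0 \<ge> 0" using uv by (simp add: t0_def)
  then have mem: "t0 *\<^sub>R (u, v) \<in> half_line (u, v)" unfolding half_line_def by blast
  have "infdist (real a, real b) (half_line (u, v)) \<le> dist (real a, real b) (t0 *\<^sub>R (u, v))"
    using mem by (rule infdist_le)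
  also have "\<dots> = \<bar>d\<bar>" by (simp only: dist_eq) simp
  finally have "infdist (real a, real b) (half_line (u, v)) \<le> \<bar>d\<bar>" .
  moreover have "\<bar>d\<bar> \<le> infdist (real a, real b) (half_line (u, v))"
    unfolding infdist_notempty[OF ne]
  proof (rule cINF_greatest[OF ne])
    fix p assume "p \<in> half_line (u, v)"
    then obtain t where "p = t *\<^sub>R (u, v)" unfolding half_line_def by blast
    then have "dist (real a, real b) p = sqrt (d\<^sup>2 + (t - t0)\<^sup>2)" using dist_eq by simp
    then show "\<bar>d\<bar> \<le> dist (real a, real b) p" by (simp add: real_le_rsqrt)
  qed
  ultimately show ?thesis by (simp add: ray_dist_def d_def)
qed

text \<open>A disc contains finitely many integer points, so the filter is the cofinite one on
  \<open>pyth_pairs\<close>; limits superior become finiteness statements.\<close>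

lemma eventually_pyth_at_infinity:
  "eventually Q pyth_at_infinity \<longleftrightarrow> finite {p \<in> pyth_pairs. \<not> Q p}"
proof
  assume "eventually Q pyth_at_infinity"
  then obtain r where r: "\<And>a b. r \<le> sqrt ((real a)\<^sup>2 + (real b)\<^sup>2) \<Longrightarrow> (a, b) \<in> pyth_pairs \<Longrightarrow> Q (a, b)"
    unfolding pyth_at_infinity_def eventually_inf_principal eventually_filtercomap_at_top_linorder
    by auto
  have "{p \<in> pyth_pairs. \<not> Q p} \<subseteq> {..nat \<lceil>r\<rceil>} \<times> {..nat \<lceil>r\<rceil>}"
  proof
    fix p assume "p \<in> {p \<in> pyth_pairs. \<not> Q p}"
    then obtain a b where p: "p = (a, b)" and ab: "(a, b) \<in> pyth_pairs" "\<not> Q (a, b)"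
      by (cases p) auto
    then have "sqrt ((real a)\<^sup>2 + (real b)\<^sup>2) < r" using r by force
    moreover have "real a \<le> sqrt ((real a)\<^sup>2 + (real b)\<^sup>2)" "real b \<le> sqrt ((real a)\<^sup>2 + (real b)\<^sup>2)"
      by (simp_all add: real_le_rsqrt)
    ultimately have "real a \<le> r" "real b \<le> r" by linarith+
    then show "p \<in> {..nat \<lceil>r\<rceil>} \<times> {..nat \<lceil>r\<rceil>}" by (auto simp: p le_nat_iff) linarith+
  qed
  then show "finite {p \<in> pyth_pairs. \<not> Q p}" by (rule finite_subset) simp
next
  let ?f = "\<lambda>(a :: nat, b :: nat). sqrt ((real a)\<^sup>2 + (real b)\<^sup>2)"
  assume fin: "finite {p \<in> pyth_pairs. \<not> Q p}"
  then have "finite (?f ` {p \<in> pyth_pairs. \<not> Q p})" by simp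
  then obtain B where "\<forall>p\<in>{p \<in> pyth_pairs. \<not> Q p}. ?f p \<le> B"
    using bdd_above_finite by (metis (no_types, lifting) bdd_above.E imageI)
  then have "\<forall>p. B < ?f p \<longrightarrow> p \<in> pyth_pairs \<longrightarrow> Q p" by force
  then show "eventually Q pyth_at_infinity"
    unfolding pyth_at_infinity_def eventually_inf_principal eventually_filtercomap_at_top_dense
    by blast
qed

lemma ray_dist_nonneg: "ray_dist P p \<ge> 0"
  by (simp add: ray_dist_def split_beta infdist_nonneg)

lemma inverse_ereal_less_iff:
  assumes "d \<ge> 0" "l > 0"
  shows "inverse (ereal d) < ereal l \<longleftrightarrow> 1 / l < d"
proof (cases "d = 0")
  case False
  then have "inverse (ereal d) = ereal (1 / d)" by (simp add: inverse_eq_divide)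
  then show ?thesis using assms False by (simp add: field_simps)
qed (use assms in \<open>auto simp: not_less\<close>)

lemma lagrange_number_less_imp_finite:
  assumes "lagrange_number P < ereal l" "l > 0"
  shows "finite {p \<in> pyth_pairs. ray_dist P p \<le> 1 / l}"
proof -
  have "eventually (\<lambda>p. inverse (ereal (ray_dist P p)) < ereal l) pyth_at_infinity"
    using assms(1) unfolding lagrange_number_def by (rule Limsup_lessD)
  then show ?thesis
    using assms(2) by (simp add: eventually_pyth_at_infinity inverse_ereal_less_iff ray_dist_nonneg not_less
      del: inverse_ereal.simps)
qed

lemma lagrange_number_le:
  assumes "finite {p \<in> pyth_pairs. ray_dist P p \<le> 1 / l}" "l > 0"
  shows "lagrange_number P \<le> ereal l"
  unfolding lagrange_number_def
proof (rule Limsup_bounded)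
  have "eventually (\<lambda>p. inverse (ereal (ray_dist P p)) < ereal l) pyth_at_infinity"
    using assms by (simp add: eventually_pyth_at_infinity inverse_ereal_less_iff ray_dist_nonneg not_less
      del: inverse_ereal.simps)
  then show "eventually (\<lambda>p. inverse (ereal (ray_dist P p)) \<le> ereal l) pyth_at_infinity"
    by (rule eventually_mono) simp
qed

lemma lagrange_number_nonneg: "lagrange_number P \<ge> 0"
proof -
  have "pyth_at_infinity \<noteq> bot"
    using infinite_pyth_pairs eventually_pyth_at_infinity[of "\<lambda>_. False"]
    by (simp add: trivial_limit_def)
  moreover have "eventually (\<lambda>p. 0 \<le> inverse (ereal (ray_dist P p))) pyth_at_infinity"
    by (simp add: ray_dist_nonneg)
  ultimately have "0 \<le> Liminf pyth_at_infinity (\<lambda>p. inverse (ereal (ray_dist P p)))"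
    by (intro Liminf_bounded)
  also have "\<dots> \<le> lagrange_number P"
    unfolding lagrange_number_def using \<open>pyth_at_infinity \<noteq> bot\<close> by (rule Liminf_le_Limsup)
  finally show ?thesis .
qed

text \<open>A limit superior is an infimum of thresholds, so a transfer of finiteness that loses an
  arbitrarily small amount is enough.\<close>

lemma lagrange_number_mono:
  assumes "\<And>\<tau> \<tau>'. 0 < \<tau>' \<Longrightarrow> \<tau>' < \<tau> \<Longrightarrow> finite {p \<in> pyth_pairs. ray_dist P p \<le> \<tau>} \<Longrightarrow>
             finite {p \<in> pyth_pairs. ray_dist Q p \<le> \<tau>'}"
  shows "lagrange_number Q \<le> lagrange_number P"
proof (rule dense_ge)
  fix c assume c: "lagrange_number P < c"
  show "lagrange_number Q \<le> c"
  proof (cases c)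
    case (real l)
    with c obtain l1 where l1: "lagrange_number P < ereal l1" "l1 < l"
      using ereal_dense2 by force
    then have "l1 > 0"
      using lagrange_number_nonneg[of P] by (metis ereal_less(2) order_le_less_trans)
    with l1 have "finite {p \<in> pyth_pairs. ray_dist P p \<le> 1 / l1}"
      by (intro lagrange_number_less_imp_finite)
    then have "finite {p \<in> pyth_pairs. ray_dist Q p \<le> 1 / l}"
      using assms[of "1 / l" "1 / l1"] l1 \<open>l1 > 0\<close> by (simp add: frac_less2)
    then show ?thesis using l1 \<open>l1 > 0\<close> real by (simp add: lagrange_number_le)
  qed (use c lagrange_number_nonneg[of P] in auto)
qed

lemma lagrange_number_eq_0:
  assumes "\<And>\<tau>. finite {p \<in> pyth_pairs. ray_dist P p \<le> \<tau>}"
  shows "lagrange_number P = 0"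
proof -
  have "lagrange_number P \<le> ereal l" if "l > 0" for l using that assms by (intro lagrange_number_le)
  then have "lagrange_number P \<le> 0"
    by (metis ereal_le_epsilon2 add_0 zero_ereal_def)
  with lagrange_number_nonneg show ?thesis by (rule antisym[rotated])
qed

section \<open>The associated quadratic form\<close>

definition wt :: "nat \<Rightarrow> real" where
  "wt Y = (if even Y then 1 else 2)"

text \<open>The roots of the form are x and -y, the future and past endpoints of a geodesic;
  division by x + y normalises the discriminant.\<close>

definition qnorm :: "real \<Rightarrow> real \<Rightarrow> nat \<times> nat \<Rightarrow> real" where
  "qnorm x y = (\<lambda>(X, Y). wt Y * \<bar>(real X - x * real Y) * (real X + y * real Y)\<bar> / (x + y))"

text \<open>The direction of \<open>pyth_param (X, Y)\<close> in the limit X / Y = x. The point (0,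
  1) corresponds to x = \<infinity> and is treated separately.\<close>

definition circle_pt :: "real \<Rightarrow> real \<times> real" where
  "circle_pt x = ((2 * x + 1) / (2 * x\<^sup>2 + 2 * x + 1), (2 * x\<^sup>2 + 2 * x) / (2 * x\<^sup>2 + 2 * x + 1))"

text \<open>The parameters x and -\<open>past0 x\<close> give the same slope: they are the two
  antipodal points where a line through the origin meets the circle.\<close>

definition past0 :: "real \<Rightarrow> real" where
  "past0 x = (x + 1) / (2 * x + 1)"

lemma wt_bounds: "1 \<le> wt Y" "wt Y \<le> 2"
  by (simp_all add: wt_def)

lemma past0_pos: "x \<ge> 0 \<Longrightarrow> past0 x > 0"
  by (simp add: past0_def)

lemma circle_pt_mem:
  assumes "x \<ge> 0" shows "circle_pt x \<in> quarter_circle"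
proof -
  define D where "D = 2 * x\<^sup>2 + 2 * x + 1"
  have "D > 0" using assms by (simp add: D_def add_nonneg_pos)
  have "(2 * x + 1)\<^sup>2 + (2 * x\<^sup>2 + 2 * x)\<^sup>2 = D\<^sup>2"
    by (simp add: D_def power2_eq_square algebra_simps)
  then have "((2 * x + 1) / D)\<^sup>2 + ((2 * x\<^sup>2 + 2 * x) / D)\<^sup>2 = 1"
    using \<open>D > 0\<close> by (simp add: power_divide flip: add_divide_distrib)
  then show ?thesis using assms \<open>D > 0\<close> by (simp add: circle_pt_def quarter_circle_def flip: D_def)
qed

lemma quarter_circle_cases:
  assumes "P \<in> quarter_circle"
  obtains "P = (0, 1)" | x where "x \<ge> 0" "P = circle_pt x"
proof -
  obtain u v where P: "P = (u, v)" and uv: "u\<^sup>2 + v\<^sup>2 = 1" "u \<ge> 0" "v \<ge> 0"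
    using assms by (cases P) (auto simp: quarter_circle_def)
  have "v \<le> 1" using uv by (metis abs_le_square_iff abs_of_nonneg le_add_same_cancel2 one_power2 zero_le_power2 abs_one)
  show thesis
  proof (cases "u = 0")
    case True
    then have "v = 1" using uv by (simp add: power2_eq_1_iff)
    then show thesis using True P that(1) by simp
  next
    case False
    \<comment> \<open>By the half-angle formula the Euclid parameters satisfy m : n = (1 + u) : v;
      since X = n and Y = m - n, this gives x = v / (1 + u - v).\<close>
    define s where "s = 1 + u - v"
    have "s > 0" using False uv \<open>v \<le> 1\<close> by (simp add: s_def)
    have "1 + u > 0" using uv by simp
    define x where "x = v / s"
    have eqs: "s * (2 * x + 1) = 1 + u + v" "s\<^sup>2 * (2 * x\<^sup>2 + 2 * x) = 2 * v * (1 + u)"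
    proof -
      have sx: "s * x = v" using \<open>s > 0\<close> by (simp add: x_def)
      have "s * (2 * x + 1) = 2 * (s * x) + s" by (simp add: algebra_simps)
      then show "s * (2 * x + 1) = 1 + u + v" unfolding sx by (simp add: s_def)
      have "s\<^sup>2 * (2 * x\<^sup>2 + 2 * x) = 2 * (s * x) * (s * x + s)"
        by (simp add: algebra_simps power2_eq_square)
      then show "s\<^sup>2 * (2 * x\<^sup>2 + 2 * x) = 2 * v * (1 + u)"
        unfolding sx by (simp add: s_def)
    qed
    have "s\<^sup>2 * (2 * x\<^sup>2 + 2 * x + 1) = 2 * v * (1 + u) + s\<^sup>2" using eqs by (simp add: algebra_simps)
    also have "\<dots> = 2 + 2 * u"
      using uv(1) by (simp add: s_def power2_eq_square algebra_simps)
    finally have D: "s\<^sup>2 * (2 * x\<^sup>2 + 2 * x + 1) = 2 * (1 + u)" by simp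
    have "(2 * x\<^sup>2 + 2 * x) / (2 * x\<^sup>2 + 2 * x + 1) = (s\<^sup>2 * (2 * x\<^sup>2 + 2 * x)) / (s\<^sup>2 * (2 * x\<^sup>2 + 2 * x + 1))"
      using \<open>s > 0\<close> by simp
    also have "\<dots> = v" unfolding D eqs using \<open>1 + u > 0\<close> by (simp add: field_simps)
    finally have 1: "(2 * x\<^sup>2 + 2 * x) / (2 * x\<^sup>2 + 2 * x + 1) = v" .
    have "(2 * x + 1) / (2 * x\<^sup>2 + 2 * x + 1) = (s * (s * (2 * x + 1))) / (s\<^sup>2 * (2 * x\<^sup>2 + 2 * x + 1))"
      using \<open>s > 0\<close> by (simp add: power2_eq_square)
    also have "\<dots> = (s * (1 + u + v)) / (2 * (1 + u))" unfolding D eqs by simp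
    also have "s * (1 + u + v) = u * (2 * (1 + u))"
      using uv(1) by (simp add: s_def power2_eq_square algebra_simps)
    finally have 2: "(2 * x + 1) / (2 * x\<^sup>2 + 2 * x + 1) = u" using \<open>1 + u > 0\<close> by simp
    have "x \<ge> 0" using \<open>s > 0\<close> uv by (simp add: x_def)
    moreover have "P = circle_pt x" using 1 2 by (simp add: P circle_pt_def)
    ultimately show thesis by (rule that(2))
  qed
qed

text \<open>The determinant of pair and direction factors into X - x Y and (2 x + 1) X + (x + 1) Y;
  the second factor is the origin of \<open>past0\<close>, and the factor 2 kept for odd Y is the
  weight.\<close>

lemma ray_dist_circle_pt:
  assumes "x \<ge> 0"
  shows "ray_dist (circle_pt x) (pyth_param v) = qnorm x (past0 x) v"
proof -
  obtain X Y where v: "v = (X, Y)" by (cases v)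
  define D where "D = 2 * x\<^sup>2 + 2 * x + 1"
  define e where "e = real X - x * real Y"
  define f where "f = (2 * x + 1) * real X + (x + 1) * real Y"
  have "D > 0" using assms by (simp add: D_def add_nonneg_pos)
  have s: "x + past0 x = D / (2 * x + 1)"
    using assms by (simp add: past0_def D_def field_simps power2_eq_square)
  have t: "real X + past0 x * real Y = f / (2 * x + 1)"
    using assms by (simp add: past0_def f_def field_simps)
  have q: "qnorm x (past0 x) v = wt Y * \<bar>e * f\<bar> / D"
  proof -
    have "2 * x + 1 > 0" using assms by simp
    then show ?thesis
      by (simp add: qnorm_def v s t abs_mult flip: e_def)
  qed
  obtain a b where ab: "pyth_param (X, Y) = (a, b)" by fastforce
  have w: "real a = wt Y / 2 * (real Y * (2 * real X + real Y))" "real b = wt Y * (real X * (real X + real Y))"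
    using ab by (auto simp: pyth_param_def wt_def real_of_nat_div split: if_splits)
  have "real a * (2 * x\<^sup>2 + 2 * x) - real b * (2 * x + 1) = - (wt Y * (e * f))"
    unfolding w e_def f_def by (simp add: power2_eq_square algebra_simps)
  then have "real a * ((2 * x\<^sup>2 + 2 * x) / D) - real b * ((2 * x + 1) / D) = - (wt Y * (e * f)) / D"
    by (simp add: diff_divide_distrib[symmetric] del: mult_minus_right minus_mult_right)
  then have "ray_dist (circle_pt x) (a, b) = \<bar>- (wt Y * (e * f)) / D\<bar>"
    using circle_pt_mem[OF assms] unfolding circle_pt_def D_def[symmetric] by (simp add: ray_dist_eq)
  also have "\<dots> = wt Y * \<bar>e * f\<bar> / D"
    using \<open>D > 0\<close> wt_bounds[of Y] by (simp add: abs_mult)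
  finally show ?thesis using q v ab by simp
qed

definition few :: "real \<Rightarrow> real \<Rightarrow> real \<Rightarrow> bool" where
  "few x y \<tau> \<longleftrightarrow> finite {v \<in> coprime_pairs. qnorm x y v \<le> \<tau>}"

lemma few_iff_ray_dist:
  assumes "x \<ge> 0"
  shows "few x (past0 x) \<tau> \<longleftrightarrow> finite {p \<in> pyth_pairs. ray_dist (circle_pt x) p \<le> \<tau>}"
proof
  assume "few x (past0 x) \<tau>"
  then have "finite (pyth_param ` {v \<in> coprime_pairs. qnorm x (past0 x) v \<le> \<tau>})"
    by (simp add: few_def)
  moreover have "{p \<in> pyth_pairs. ray_dist (circle_pt x) p \<le> \<tau>} \<subseteq>
      pyth_param ` {v \<in> coprime_pairs. qnorm x (past0 x) v \<le> \<tau>}"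
    using pyth_pairs_subset_param by (auto simp flip: ray_dist_circle_pt[OF assms])
  ultimately show "finite {p \<in> pyth_pairs. ray_dist (circle_pt x) p \<le> \<tau>}"
    by (rule finite_subset[rotated])
next
  assume "finite {p \<in> pyth_pairs. ray_dist (circle_pt x) p \<le> \<tau>}"
  from finite_pyth_param_vimage[OF this] show "few x (past0 x) \<tau>"
    unfolding few_def
    by (rule finite_subset[rotated])
      (use pyth_param_in_pyth_pairs in \<open>auto simp flip: ray_dist_circle_pt[OF assms]\<close>)
qed

text \<open>Since \<open>x + y\<close> normalises the form, \<open>qnorm x y\<close> and \<open>qnorm x y'\<close> differ by \<open>O(e\<^sup>2)\<close> where
  \<open>e = X - x Y\<close>, and \<open>e \<rightarrow> 0\<close> along pairs on which either stays bounded.\<close>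

lemma few_change_past:
  assumes few: "few x y \<tau>" and "\<tau>' < \<tau>" and pos: "x \<ge> 0" "y > 0" "y' > 0"
  shows "few x y' \<tau>'"
proof (cases "\<tau>' < 0")
  case True
  have "qnorm x y' v \<ge> 0" for v
    using pos wt_bounds[of "snd v"] by (simp add: qnorm_def split_beta)
  then have "{v \<in> coprime_pairs. qnorm x y' v \<le> \<tau>'} = {}" using True by (smt (verit) empty_Collect_eq)
  then show ?thesis unfolding few_def by (metis finite.emptyI)
next
  case False
  define m where "m = min 1 y'"
  define c where "c = 2 * \<bar>1 / (x + y) - 1 / (x + y')\<bar>"
  define K where "K = \<tau>' * (x + y') / m"
  have "m > 0" "c \<ge> 0" "K \<ge> 0" using pos False by (simp_all add: m_def c_def K_def)
  \<comment> \<open>Outside X + Y <= R a small value forces |e| <= K / R, and then the error c e^2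
    fits into the gap between the two thresholds.\<close>
  obtain R :: nat where R: "R > 0" "c * (K / R)\<^sup>2 \<le> \<tau> - \<tau>'"
  proof -
    obtain R0 :: nat where R0: "c * K\<^sup>2 / (\<tau> - \<tau>') < R0" using reals_Archimedean2 by blast
    define R where "R = Suc R0"
    have "c * K\<^sup>2 < (\<tau> - \<tau>') * R0" using R0 \<open>\<tau>' < \<tau>\<close> by (simp add: field_simps)
    also have "\<dots> \<le> (\<tau> - \<tau>') * (real R)\<^sup>2"
      using \<open>\<tau>' < \<tau>\<close> by (intro mult_left_mono) (auto simp: R_def power2_eq_square algebra_simps)
    finally have "c * K\<^sup>2 / (real R)\<^sup>2 \<le> \<tau> - \<tau>'"
      by (simp add: R_def pos_divide_le_eq)
    then have "c * (K / R)\<^sup>2 \<le> \<tau> - \<tau>'" by (simp add: power_divide)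
    then show thesis using that[of R] by (simp add: R_def)
  qed
  have "{v \<in> coprime_pairs. qnorm x y' v \<le> \<tau>'} \<subseteq>
      {v \<in> coprime_pairs. qnorm x y v \<le> \<tau>} \<union> {(X, Y). X + Y \<le> R}"
  proof
    fix v assume v: "v \<in> {v \<in> coprime_pairs. qnorm x y' v \<le> \<tau>'}"
    obtain X Y where XY: "v = (X, Y)" by (cases v)
    define e where "e = real X - x * real Y"
    show "v \<in> {v \<in> coprime_pairs. qnorm x y v \<le> \<tau>} \<union> {(X, Y). X + Y \<le> R}"
    proof (cases "X + Y \<le> R")
      case False
      then have big: "real R < real X + real Y" by linarith
      have lin: "real X + y' * real Y \<ge> m * (real X + real Y)"
      proof -
        have "m * real X \<le> 1 * real X" "m * real Y \<le> y' * real Y"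
          by (intro mult_right_mono; simp add: m_def)+
        then show ?thesis by (simp add: algebra_simps)
      qed
      have q': "wt Y * (\<bar>e\<bar> * (real X + y' * real Y)) \<le> \<tau>' * (x + y')"
      proof -
        have "qnorm x y' v = wt Y * (\<bar>e\<bar> * (real X + y' * real Y)) / (x + y')"
          using pos by (simp add: qnorm_def XY abs_mult e_def)
        then show ?thesis using v pos by (simp add: pos_divide_le_eq)
      qed
      have "\<bar>e\<bar> * (m * R) \<le> \<bar>e\<bar> * (real X + y' * real Y)"
      proof (rule mult_left_mono)
        have "m * R \<le> m * (real X + real Y)" using big \<open>m > 0\<close> by (intro mult_left_mono) auto
        then show "m * R \<le> real X + y' * real Y" using lin by linarith
      qed simp
      also have "\<dots> \<le> wt Y * (\<bar>e\<bar> * (real X + y' * real Y))"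
        using mult_right_mono[OF wt_bounds(1)[of Y], of "\<bar>e\<bar> * (real X + y' * real Y)"] pos by simp
      finally have "\<bar>e\<bar> * (m * R) \<le> \<tau>' * (x + y')" using q' by simp
      then have "\<bar>e\<bar> \<le> K / R" using \<open>m > 0\<close> R(1) by (simp add: K_def field_simps)
      then have "e\<^sup>2 \<le> (K / R)\<^sup>2" by (metis abs_ge_zero power2_abs power_mono)
      then have e2: "c * e\<^sup>2 \<le> \<tau> - \<tau>'"
        using R(2) \<open>c \<ge> 0\<close> by (meson mult_left_mono order_trans)
      \<comment> \<open>Dividing the second factor by x + z leaves z only in the term e / (x + z),
        so a change of z costs a multiple of e^2.\<close>
      have form: "qnorm x z v = wt Y * \<bar>e\<bar> * \<bar>real Y + e / (x + z)\<bar>" if "z > 0" for z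
      proof -
        have "(real X + z * real Y) / (x + z) = real Y + e / (x + z)"
          using that pos by (simp add: e_def field_simps)
        moreover have "qnorm x z v = wt Y * \<bar>e\<bar> * \<bar>(real X + z * real Y) / (x + z)\<bar>"
          using that pos by (simp add: qnorm_def XY e_def abs_mult)
        ultimately show ?thesis by simp
      qed
      have "\<bar>real Y + e / (x + y)\<bar> \<le> \<bar>real Y + e / (x + y')\<bar> + \<bar>e / (x + y) - e / (x + y')\<bar>"
        by linarith
      also have "e / (x + y) - e / (x + y') = e * (1 / (x + y) - 1 / (x + y'))"
        by (simp add: algebra_simps)
      finally have "\<bar>real Y + e / (x + y)\<bar> \<le> \<bar>real Y + e / (x + y')\<bar> + \<bar>e\<bar> * (c / 2)"
        by (simp add: c_def abs_mult)
      then have "qnorm x y v \<le> wt Y * \<bar>e\<bar> * (\<bar>real Y + e / (x + y')\<bar> + \<bar>e\<bar> * (c / 2))"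
        unfolding form[OF pos(2)] using wt_bounds[of Y] by (intro mult_left_mono) auto
      also have "\<dots> = qnorm x y' v + wt Y / 2 * (c * e\<^sup>2)"
        by (simp add: form[OF pos(3)] algebra_simps power2_eq_square)
      also have "\<dots> \<le> qnorm x y' v + 1 * (c * e\<^sup>2)"
        using wt_bounds[of Y] \<open>c \<ge> 0\<close> by (intro add_left_mono mult_right_mono) auto
      also have "\<dots> \<le> \<tau>" using e2 v by simp
      finally show ?thesis using v by simp
    qed (simp add: XY)
  qed
  moreover have "finite ({v \<in> coprime_pairs. qnorm x y v \<le> \<tau>} \<union> {(X, Y). X + Y \<le> R})"
    using few finite_sum_le by (simp add: few_def)
  ultimately show ?thesis unfolding few_def by (rule finite_subset)
qed

section \<open>Digits and their action on coprime pairs\<close>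

datatype digit = DL | DS | DR

text \<open>Increasing Moebius maps of the positive half-line onto (1, \<infinity>), (1/2, 1) and
  (0, 1/2), the intervals cut off by the three exit sides of the base square.\<close>

fun dig :: "digit \<Rightarrow> real \<Rightarrow> real" where
  "dig DL x = x + 1"
| "dig DS x = (2 * x + 1) / (2 * x + 2)"
| "dig DR x = x / (2 * x + 1)"

text \<open>The same Moebius maps on numerator and denominator. \<open>S\<close> has determinant 2;
  its image is halved when Y is even, and on coprime pairs it exchanges the two parities of
  Y.\<close>

fun act :: "digit \<Rightarrow> nat \<times> nat \<Rightarrow> nat \<times> nat" where
  "act DL (X, Y) = (X + Y, Y)"
| "act DS (X, Y) = (if even Y then (X + Y div 2, X + Y) else (2 * X + Y, 2 * (X + Y)))"
| "act DR (X, Y) = (X, 2 * X + Y)"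

lemma dig_pos: "x > 0 \<Longrightarrow> dig d x > 0"
  by (cases d) simp_all

text \<open>The inverse of \<open>dig d\<close> sends -y to -\<open>dig d y\<close>, so moving a
  digit from the future to the past is a change of basis for the form.\<close>

lemma qnorm_act:
  assumes "x > 0" "y > 0" and vmem: "v \<in> coprime_pairs"
  shows "qnorm (dig d x) y (act d v) = qnorm x (dig d y) v"
proof -
  obtain X Y where v: "v = (X, Y)" by (cases v)
  show ?thesis
  proof (cases d)
    case DL
    then show ?thesis by (simp add: v qnorm_def algebra_simps)
  next
    case DR
    define a b where "a = 2 * x + 1" and "b = 2 * y + 1"
    have "a > 0" "b > 0" using assms by (simp_all add: a_def b_def)
    have 1: "real X - x / a * (2 * real X + real Y) = (real X - x * real Y) / a"
      using \<open>a > 0\<close> by (simp add: divide_simps) (simp add: a_def algebra_simps)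
    have 2: "real X + y * (2 * real X + real Y) = b * (real X + y / b * real Y)"
      using \<open>b > 0\<close> by (simp add: field_simps b_def)
    have 3: "x / a + y = b * (x + y / b) / a"
      using \<open>a > 0\<close> \<open>b > 0\<close> by (simp add: divide_simps) (simp add: a_def b_def algebra_simps)
    have "x + y / b > 0" using assms \<open>b > 0\<close> by (simp add: add_pos_pos)
    then have "wt Y * \<bar>(real X - x * real Y) / a * (b * (real X + y / b * real Y))\<bar> / (b * (x + y / b) / a)
        = wt Y * \<bar>(real X - x * real Y) * (real X + y / b * real Y)\<bar> / (x + y / b)"
      using \<open>a > 0\<close> \<open>b > 0\<close> by (simp add: abs_mult)
    moreover have "wt (2 * X + Y) = wt Y" by (simp add: wt_def)
    then have "qnorm (dig d x) y (act d v) = wt Y * \<bar>(real X - x / a * (2 * real X + real Y)) *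
        (real X + y * (2 * real X + real Y))\<bar> / (x / a + y)"
      by (simp add: v DR qnorm_def a_def)
    moreover have "qnorm x (dig d y) v = wt Y * \<bar>(real X - x * real Y) * (real X + y / b * real Y)\<bar> / (x + y / b)"
      by (simp add: v DR qnorm_def b_def)
    ultimately show ?thesis unfolding 1 2 3 by simp
  next
    case DS
    define a b where "a = 2 * x + 2" and "b = 2 * y + 2"
    have "a > 0" "b > 0" using assms by (simp_all add: a_def b_def)
    define x' y' where "x' = (2 * x + 1) / a" and "y' = (2 * y + 1) / b"
    define X1 Y1 where "X1 = real X + real Y / 2" and "Y1 = real X + real Y"
    have 1: "X1 - x' * Y1 = (real X - x * real Y) / a"
      using \<open>a > 0\<close> unfolding x'_def X1_def Y1_def by (simp add: divide_simps) (simp add: a_def algebra_simps)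
    have 2: "X1 + y * Y1 = b / 2 * (real X + y' * real Y)"
      using \<open>b > 0\<close> unfolding y'_def X1_def Y1_def by (simp add: divide_simps) (simp add: b_def algebra_simps)
    have 3: "x' + y = b * (x + y') / a"
      using \<open>a > 0\<close> \<open>b > 0\<close> unfolding x'_def y'_def by (simp add: divide_simps) (simp add: a_def b_def algebra_simps)
    have "x + y' > 0" using assms \<open>b > 0\<close> by (simp add: y'_def add_pos_pos)
    \<comment> \<open>In the coordinates X1, Y1 the map \<open>S\<close> has determinant 1/2. For
      even Y the weight rises from 1 to 2; for odd Y it drops from 2 to 1, but doubling both
      coordinates gives a factor 4.\<close>
    then have half: "\<bar>(X1 - x' * Y1) * (X1 + y * Y1)\<bar> / (x' + y)
        = \<bar>(real X - x * real Y) * (real X + y' * real Y)\<bar> / (x + y') / 2"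
      using \<open>a > 0\<close> \<open>b > 0\<close> unfolding 1 2 3 by (simp add: abs_mult)
    have 4: "2 * (\<bar>(X1 - x' * Y1) * (X1 + y * Y1)\<bar> / (x' + y))
        = \<bar>(real X - x * real Y) * (real X + y' * real Y)\<bar> / (x + y')"
    proof -
      have "2 * A = Q" if "A = Q / 2" for A Q :: real using that by simp
      from this[OF half] show ?thesis .
    qed
    have 5: "qnorm x (dig d y) v = wt Y * (2 * (\<bar>(X1 - x' * Y1) * (X1 + y * Y1)\<bar> / (x' + y)))"
    proof -
      have "dig d y = y'" by (simp add: DS y'_def b_def)
      then show ?thesis unfolding 4 by (simp add: v qnorm_def)
    qed
    show ?thesis
    proof (cases "even Y")
      case True
      then have "qnorm (dig d x) y (act d v) = wt (X + Y) * (\<bar>(X1 - x' * Y1) * (X1 + y * Y1)\<bar> / (x' + y))"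
        by (simp add: v DS qnorm_def x'_def a_def X1_def Y1_def real_of_nat_div)
      moreover have "odd X" using True vmem by (auto simp: v coprime_pairs_def dest: coprime_common_divisor)
      ultimately show ?thesis using True unfolding 5 by (simp add: wt_def)
    next
      case False
      have "qnorm (dig d x) y (act d v) =
          wt (2 * (X + Y)) * \<bar>(2 * X1 - x' * (2 * Y1)) * (2 * X1 + y * (2 * Y1))\<bar> / (x' + y)"
        using False by (simp add: v DS qnorm_def x'_def a_def X1_def Y1_def)
      also have "(2 * X1 - x' * (2 * Y1)) * (2 * X1 + y * (2 * Y1)) = 4 * ((X1 - x' * Y1) * (X1 + y * Y1))"
        by (simp add: algebra_simps)
      finally show ?thesis using False unfolding 5 by (simp add: abs_mult wt_def)
    qed
  qed
qed

lemma act_mem: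
  assumes "v \<in> coprime_pairs" shows "act d v \<in> coprime_pairs"
proof -
  obtain X Y where v: "v = (X, Y)" by (cases v)
  have co: "coprime X Y" using assms by (simp add: v coprime_pairs_def)
  have co2: "coprime (X + Y) Y" "coprime X (X + Y)"
    using co by (simp_all add: coprime_add_nat_simps)
  have "coprime (X + Y div 2) (X + Y)" if "even Y"
  proof -
    from that obtain Z where Z: "Y = 2 * Z" by blast
    have "coprime (X + Z) Z" using co by (simp add: Z coprime_add_nat_simps)
    then have "coprime (X + Z) (X + Z + Z)" by (simp add: coprime_add_nat_simps)
    then show ?thesis by (simp add: Z mult_2 add.assoc)
  qed
  moreover have "coprime (2 * X + Y) (2 * (X + Y))" if "odd Y"
  proof -
    have "coprime (X + (X + Y)) (X + Y)" using co2(2) by (simp add: coprime_add_nat_simps)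
    then have "coprime (2 * X + Y) (X + Y)" by (simp add: mult_2 add.assoc)
    then show ?thesis using that by (simp del: distrib_left_numeral)
  qed
  moreover have "coprime X (X + (X + Y))" using co2(2) by (simp add: coprime_add_nat_simps)
  then have "coprime X (2 * X + Y)" by (simp add: mult_2 add.assoc)
  ultimately show ?thesis using co2 by (cases d) (simp_all add: v coprime_pairs_def)
qed

lemma coprime_pairs_odd: "(X, Y) \<in> coprime_pairs \<Longrightarrow> even Y \<Longrightarrow> odd X"
  by (auto simp: coprime_pairs_def dest: coprime_common_divisor)

lemma inj_act: "inj_on (act d) coprime_pairs"
proof (rule inj_onI)
  fix v v' assume mem: "v \<in> coprime_pairs" "v' \<in> coprime_pairs" and eq: "act d v = act d v'"
  obtain X Y X' Y' where v: "v = (X, Y)" "v' = (X', Y')" by (cases v, cases v')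
  have "even Y \<Longrightarrow> odd X" "even Y' \<Longrightarrow> odd X'" using mem coprime_pairs_odd by (auto simp: v)
  then show "v = v'"
  proof (cases d)
    case DS
    \<comment> \<open>The two branches of \<open>S\<close> produce second coordinates of opposite
      parity, so the branch can be recovered from the image.\<close>
    have parity: "even (snd (act DS (X, Y))) \<longleftrightarrow> odd Y" "even (snd (act DS (X', Y'))) \<longleftrightarrow> odd Y'"
      using \<open>even Y \<Longrightarrow> odd X\<close> \<open>even Y' \<Longrightarrow> odd X'\<close> by auto
    have "act DS (X, Y) = act DS (X', Y')" using eq by (simp only: v DS)
    then have "even Y \<longleftrightarrow> even Y'" using parity by metis
    show ?thesis
    proof (cases "even Y")
      case True
      then have "even Y'" using \<open>even Y \<longleftrightarrow> even Y'\<close> by blast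
      with True show ?thesis using eq by (auto simp: v DS elim!: evenE)
    next
      case False
      then have "odd Y'" using \<open>even Y \<longleftrightarrow> even Y'\<close> by blast
      with False show ?thesis using eq by (simp add: v DS)
    qed
  qed (use eq in \<open>auto simp: v\<close>)
qed

lemma act_L_surj:
  assumes "(X, Y) \<in> coprime_pairs" "Y \<le> X"
  shows "(X, Y) \<in> act DL ` coprime_pairs"
proof -
  have "(X - Y, Y) \<in> coprime_pairs"
    using assms by (auto simp: coprime_pairs_def le_iff_add coprime_add_nat_simps)
  then show ?thesis using assms(2) by (intro image_eqI[of _ _ "(X - Y, Y)"]) auto
qed

lemma act_R_surj:
  assumes "(X, Y) \<in> coprime_pairs" "2 * X \<le> Y"
  shows "(X, Y) \<in> act DR ` coprime_pairs"
proof -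
  obtain k where k: "Y = 2 * X + k" using assms(2) le_Suc_ex by blast
  have "coprime X (X + (X + k))" using assms(1) by (simp add: k coprime_pairs_def mult_2 add.assoc)
  then have "(X, k) \<in> coprime_pairs" by (simp add: coprime_pairs_def coprime_add_nat_simps)
  then show ?thesis by (intro image_eqI[of _ _ "(X, k)"]) (auto simp: k)
qed

lemma act_S_surj:
  assumes "(X, Y) \<in> coprime_pairs" "X \<le> Y" "Y \<le> 2 * X"
  shows "(X, Y) \<in> act DS ` coprime_pairs"
proof (cases "even Y")
  case True
  then obtain Z where Z: "Y = 2 * Z" by blast
  define a b where "a = X - Z" and "b = 2 * Z - X"
  have ab: "Z = a + b" "X = 2 * a + b" using assms by (simp_all add: Z a_def b_def)
  have "odd X" using assms(1) True by (rule coprime_pairs_odd)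
  have "coprime a b"
  proof (rule coprimeI)
    fix d assume "d dvd a" "d dvd b"
    then have "d dvd X" "d dvd Y" by (simp_all add: ab Z)
    then show "is_unit d" using assms(1) by (auto simp: coprime_pairs_def dest: coprime_common_divisor)
  qed
  then show ?thesis using \<open>odd X\<close>
    by (intro image_eqI[of _ _ "(a, b)"]) (auto simp: ab Z coprime_pairs_def)
next
  case False
  define a b where "a = 2 * X - Y" and "b = Y - X"
  have ab: "X = a + b" "Y = a + 2 * b" using assms by (simp_all add: a_def b_def)
  have "coprime a b"
  proof (rule coprimeI)
    fix d assume "d dvd a" "d dvd b"
    then have "d dvd X" "d dvd Y" by (simp_all add: ab)
    then show "is_unit d" using assms(1) by (auto simp: coprime_pairs_def dest: coprime_common_divisor)
  qed
  moreover have "odd a" using False ab by simp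
  ultimately show ?thesis
    by (intro image_eqI[of _ _ "(a, 2 * b)"]) (auto simp: ab coprime_pairs_def)
qed

lemma coprime_pairs_unit: "(1, 0) \<in> coprime_pairs" "(0, 1) \<in> coprime_pairs"
  by (simp_all add: coprime_pairs_def)

lemma few_step:
  assumes "x > 0" "y > 0" "few (dig d x) y \<tau>"
  shows "few x (dig d y) \<tau>"
proof -
  let ?A = "{v \<in> coprime_pairs. qnorm x (dig d y) v \<le> \<tau>}"
  have "act d ` ?A \<subseteq> {v \<in> coprime_pairs. qnorm (dig d x) y v \<le> \<tau>}"
    using act_mem by (auto simp: qnorm_act assms)
  then have "finite (act d ` ?A)" using assms(3) finite_subset unfolding few_def by blast
  then show ?thesis
    unfolding few_def using inj_act by (rule finite_imageD[OF _ inj_on_subset]) auto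
qed

text \<open>\<open>dig d x\<close> is interior to the interval belonging to \<open>d\<close>, so
  slopes outside that interval keep a positive distance from it; c depends on x.\<close>

lemma outside_cone_bound:
  assumes "x > 0"
  obtains c where "c > 0" and
    "\<And>X Y. (X, Y) \<in> coprime_pairs \<Longrightarrow> (X, Y) \<notin> act d ` coprime_pairs \<Longrightarrow>
      c * (real X + real Y) \<le> \<bar>real X - dig d x * real Y\<bar>"
proof (cases d)
  case DL
  show thesis
  proof (rule that[of "x / 2"])
    fix X Y assume "(X, Y) \<in> coprime_pairs" "(X, Y) \<notin> act d ` coprime_pairs"
    then have "real X < real Y" using act_L_surj[of X Y] DL by force
    then have "x / 2 * (real X + real Y) \<le> x / 2 * (2 * real Y)"
      using assms by (intro mult_left_mono) auto
    also have "\<dots> \<le> (x + 1) * real Y - real X"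
      using \<open>real X < real Y\<close> by (simp add: algebra_simps)
    finally show "x / 2 * (real X + real Y) \<le> \<bar>real X - dig d x * real Y\<bar>"
      unfolding DL dig.simps by linarith
  qed (use assms in simp)
next
  case DR
  define z where "z = x / (2 * x + 1)"
  have z: "z > 0" "z < 1 / 2" using assms by (simp_all add: z_def field_simps)
  show thesis
  proof (rule that[of "(1 - 2 * z) / 3"])
    fix X Y assume "(X, Y) \<in> coprime_pairs" "(X, Y) \<notin> act d ` coprime_pairs"
    then have *: "real Y < 2 * real X" using act_R_surj[of X Y] DR by force
    then have "(1 - 2 * z) / 3 * (real X + real Y) \<le> (1 - 2 * z) / 3 * (3 * real X)"
      using z by (intro mult_left_mono) auto
    also have "\<dots> = real X - z * (2 * real X)" by (simp add: field_simps)
    also have "\<dots> \<le> real X - z * real Y" using * z by (intro diff_left_mono mult_left_mono) auto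
    finally show "(1 - 2 * z) / 3 * (real X + real Y) \<le> \<bar>real X - dig d x * real Y\<bar>"
      unfolding DR dig.simps z_def[symmetric] by linarith
  qed (use z in simp)
next
  case DS
  define z where "z = (2 * x + 1) / (2 * x + 2)"
  have z: "z > 1 / 2" "z < 1" using assms by (simp_all add: z_def field_simps)
  define c where "c = min ((1 - z) / 2) ((z - 1 / 2) / 2)"
  have c: "c \<le> (1 - z) / 2" "c \<le> (z - 1 / 2) / 2" "c > 0"
    unfolding c_def by (rule min.cobounded1, rule min.cobounded2) (use z in simp)
  show thesis
  proof (rule that[of c])
    fix X Y assume a: "(X, Y) \<in> coprime_pairs" "(X, Y) \<notin> act d ` coprime_pairs"
    then consider "real Y < real X" | "2 * real X < real Y" using act_S_surj[of X Y] DS by force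
    then have "c * (real X + real Y) \<le> \<bar>real X - z * real Y\<bar>"
    proof cases
      case 1
      have "c * (real X + real Y) \<le> (1 - z) / 2 * (2 * real X)"
        using 1 z c by (intro mult_mono) auto
      also have "\<dots> \<le> real X - z * real Y" using 1 z mult_left_mono[of "real Y" "real X" z] by (simp add: field_simps)
      finally show ?thesis by linarith
    next
      case 2
      have "c * (real X + real Y) \<le> (z - 1 / 2) / 2 * (2 * real Y)"
        using 2 z c by (intro mult_mono) auto
      also have "\<dots> \<le> z * real Y - real X" using 2 by (simp add: field_simps)
      finally show ?thesis by linarith
    qed
    then show "c * (real X + real Y) \<le> \<bar>real X - dig d x * real Y\<bar>" by (simp add: DS z_def)
  qed (rule c)
qed

text \<open>Off the cone \<open>act d\<close> both linear factors of the form are bounded away from \<open>0\<close>.\<close>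

lemma few_step_back:
  assumes x: "x > 0" and y: "y > 0" and few: "few x (dig d y) \<tau>"
  shows "few (dig d x) y \<tau>"
proof -
  define z where "z = dig d x"
  have z: "z > 0" using x dig_pos by (simp add: z_def)
  let ?A = "{v \<in> coprime_pairs. qnorm z y v \<le> \<tau>}"
  obtain c where c: "c > 0" and bound:
    "\<And>X Y. (X, Y) \<in> coprime_pairs \<Longrightarrow> (X, Y) \<notin> act d ` coprime_pairs \<Longrightarrow>
      c * (real X + real Y) \<le> \<bar>real X - z * real Y\<bar>"
    using outside_cone_bound[OF x] unfolding z_def by blast
  define m where "m = min 1 y"
  have "m > 0" using y by (simp add: m_def)
  obtain B0 :: nat where B0: "\<tau> * (z + y) / (c * m) < B0" using reals_Archimedean2 by blast
  define B where "B = Suc B0"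
  have B: "B > 0" "\<tau> * (z + y) / (c * m) < B" using B0 by (simp_all add: B_def)
  have "?A \<subseteq> act d ` {v \<in> coprime_pairs. qnorm x (dig d y) v \<le> \<tau>} \<union> {(X, Y). X + Y \<le> B}"
  proof
    fix v assume v: "v \<in> ?A"
    obtain X Y where XY: "v = (X, Y)" by (cases v)
    show "v \<in> act d ` {v \<in> coprime_pairs. qnorm x (dig d y) v \<le> \<tau>} \<union> {(X, Y). X + Y \<le> B}"
    proof (cases "v \<in> act d ` coprime_pairs")
      case True
      then obtain w where w: "w \<in> coprime_pairs" "v = act d w" by blast
      then have "qnorm x (dig d y) w \<le> \<tau>" using v x y by (simp add: z_def qnorm_act)
      then show ?thesis using w by blast
    next
      case False
      then have 1: "c * (real X + real Y) \<le> \<bar>real X - z * real Y\<bar>" using v bound by (simp add: XY)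
      have "m * real X \<le> 1 * real X" "m * real Y \<le> y * real Y"
        by (intro mult_right_mono; simp add: m_def)+
      then have 2: "m * (real X + real Y) \<le> \<bar>real X + y * real Y\<bar>" using y by (simp add: algebra_simps)
      have "c * (real X + real Y) * (m * (real X + real Y)) \<le> \<bar>real X - z * real Y\<bar> * \<bar>real X + y * real Y\<bar>"
        using 1 2 c \<open>m > 0\<close> by (intro mult_mono) auto
      also have "\<dots> \<le> wt Y * (\<bar>real X - z * real Y\<bar> * \<bar>real X + y * real Y\<bar>)"
        using mult_right_mono[OF wt_bounds(1)[of Y], of "\<bar>real X - z * real Y\<bar> * \<bar>real X + y * real Y\<bar>"] by simp
      also have "\<dots> = qnorm z y v * (z + y)" using z y by (simp add: qnorm_def XY abs_mult)
      also have "\<dots> \<le> \<tau> * (z + y)" using v z y by (intro mult_right_mono) auto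
      finally have "(real X + real Y)\<^sup>2 \<le> \<tau> * (z + y) / (c * m)"
        using c \<open>m > 0\<close> by (simp add: field_simps power2_eq_square)
      then have "(real X + real Y)\<^sup>2 < B" using B by linarith
      moreover have "real B \<le> (real B)\<^sup>2" using B(1) by (simp add: power2_eq_square)
      ultimately have "(real X + real Y)\<^sup>2 \<le> (real B)\<^sup>2" by linarith
      then have "real X + real Y \<le> real B" by (rule power2_le_imp_le) simp
      then show ?thesis by (simp add: XY)
    qed
  qed
  moreover have "finite (act d ` {v \<in> coprime_pairs. qnorm x (dig d y) v \<le> \<tau>} \<union> {(X, Y). X + Y \<le> B})"
    using few finite_sum_le by (simp add: few_def)
  ultimately show ?thesis unfolding few_def z_def by (rule finite_subset)
qed

text \<open>Digit \<open>s k\<close> is taken off the front of the future \<open>x k\<close> and put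
  in front of the past \<open>y k\<close>.\<close>

definition orbit :: "(nat \<Rightarrow> digit) \<Rightarrow> (nat \<Rightarrow> real) \<Rightarrow> (nat \<Rightarrow> real) \<Rightarrow> bool" where
  "orbit s x y \<longleftrightarrow> (\<forall>k. x k > 0 \<and> y k > 0 \<and> x k = dig (s k) (x (Suc k)) \<and> y (Suc k) = dig (s k) (y k))"

lemma orbitD:
  assumes "orbit s x y"
  shows "x k > 0" "y k > 0" "x k = dig (s k) (x (Suc k))" "y (Suc k) = dig (s k) (y k)"
  using assms unfolding orbit_def by blast+

lemma orbit_shift: "orbit s x y \<Longrightarrow> orbit (\<lambda>k. s (k + m)) (\<lambda>k. x (k + m)) (\<lambda>k. y (k + m))"
  unfolding orbit_def add_Suc by blast

text \<open>The cone complementary to a digit is spanned by corners of the current cone and of the next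
  one, and the form has nonnegative coefficients in such a basis.\<close>

lemma qnorm_ge_corners:
  assumes x: "x > 0" and y: "y > 0" and mem: "(X, Y) \<in> coprime_pairs"
    and out: "(X, Y) \<notin> act d ` coprime_pairs"
    and m: "\<And>v. v \<in> {(1, 0), (0, 1)} \<Longrightarrow> m \<le> qnorm (dig d x) y v"
           "\<And>v. v \<in> {(1, 0), (0, 1)} \<Longrightarrow> m \<le> qnorm x (dig d y) v"
  shows "m \<le> qnorm (dig d x) y (X, Y)"
proof -
  define z where "z = dig d x"
  define M where "M = m * (z + y)"
  define F where "F = \<bar>(real X - z * real Y) * (real X + y * real Y)\<bar>"
  have z: "z > 0" using x dig_pos by (simp add: z_def)
  have q: "m \<le> qnorm z y (A, B) \<longleftrightarrow> M \<le> wt B * \<bar>(real A - z * real B) * (real A + y * real B)\<bar>" for A B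
    using z y by (simp add: qnorm_def M_def pos_le_divide_eq)
  have c0: "m \<le> qnorm z y (1, 0)" "m \<le> qnorm z y (0, 1)"
    and c1: "m \<le> qnorm z y (act d (1, 0))" "m \<le> qnorm z y (act d (0, 1))"
    using m x y coprime_pairs_unit by (simp_all add: z_def qnorm_act)
  have M: "M \<le> 1" "M \<le> 2 * (z * y)" using c0 z y by (simp_all add: q wt_def)
  \<comment> \<open>The mixed terms are nonnegative; dropping them leaves the values of the form at
    the two basis corners as coefficients.\<close>
  have bilinear: "(p * r) * a\<^sup>2 + (u * t) * b\<^sup>2 \<le> (p * a + u * b) * (r * a + t * b)"
    if "p \<ge> 0" "u \<ge> 0" "r \<ge> 0" "t \<ge> 0" "a \<ge> 0" "b \<ge> 0" for p u r t a b :: real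
  proof -
    have "p * t * (a * b) + u * r * (a * b) \<ge> 0" using that by simp
    then show ?thesis by (simp add: algebra_simps power2_eq_square)
  qed
  \<comment> \<open>Here (X, Y) = X (1, 1) + (Y - X) (0, 1), and both corners have weight 2. For
    even Y each of the two terms contributes M / 2, which needs X >= 1.\<close>
  have above_1: "M \<le> wt Y * F" if "X < Y" "z > 1" "M \<le> 2 * ((z - 1) * (1 + y))"
  proof -
    define b where "b = real Y - real X"
    have "b \<ge> 1" using that(1) by (simp add: b_def)
    then have "b\<^sup>2 \<ge> 1" by simp
    then have zb: "z * y \<le> z * y * b\<^sup>2" using z y by simp
    have F: "F = ((z - 1) * real X + z * b) * ((1 + y) * real X + y * b)"
    proof -
      have "1 * real Y \<le> z * real Y" using that by (intro mult_right_mono) auto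
      then have "z * real Y - real X \<ge> 0" using that by linarith
      then have "F = (z * real Y - real X) * (real X + y * real Y)"
        using y by (simp add: F_def abs_mult)
      then show ?thesis by (simp add: b_def algebra_simps)
    qed
    have F2: "(z - 1) * (1 + y) * (real X)\<^sup>2 + z * y * b\<^sup>2 \<le> F"
      unfolding F using that y z \<open>b \<ge> 1\<close> by (intro bilinear) auto
    show ?thesis
    proof (cases "even Y")
      case True
      then have "X \<ge> 1" using coprime_pairs_odd[OF mem] by (cases X) auto
      then have "(z - 1) * (1 + y) \<le> (z - 1) * (1 + y) * (real X)\<^sup>2" using that y by simp
      then show ?thesis using that(3) M(2) F2 zb True by (simp add: wt_def)
    next
      case False
      have "0 \<le> (z - 1) * (1 + y) * (real X)\<^sup>2" using that y by simp
      then show ?thesis using M(2) F2 zb False by (simp add: wt_def)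
    qed
  qed
  have above_half: "M \<le> wt Y * F" if "2 * X < Y" "z > 1 / 2" "M \<le> (2 * z - 1) * (1 + 2 * y)"
  proof -
    define b where "b = real Y - 2 * real X"
    have "b \<ge> 1" using that(1) by (simp add: b_def)
    then have "b\<^sup>2 \<ge> 1" by simp
    then have zb: "z * y \<le> z * y * b\<^sup>2" using z y by simp
    have F: "F = ((2 * z - 1) * real X + z * b) * ((1 + 2 * y) * real X + y * b)"
    proof -
      have "1 / 2 * real Y \<le> z * real Y" using that by (intro mult_right_mono) auto
      then have "z * real Y - real X \<ge> 0" using that by linarith
      then have "F = (z * real Y - real X) * (real X + y * real Y)"
        using y by (simp add: F_def abs_mult)
      then show ?thesis by (simp add: b_def algebra_simps)
    qed
    have F2: "(2 * z - 1) * (1 + 2 * y) * (real X)\<^sup>2 + z * y * b\<^sup>2 \<le> F"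
      unfolding F using that y z \<open>b \<ge> 1\<close> by (intro bilinear) auto
    show ?thesis
    proof (cases "even Y")
      case True
      then have "X \<ge> 1" using coprime_pairs_odd[OF mem] by (cases X) auto
      then have "(2 * z - 1) * (1 + 2 * y) \<le> (2 * z - 1) * (1 + 2 * y) * (real X)\<^sup>2" using that y by simp
      moreover have "0 \<le> z * y * b\<^sup>2" using z y by simp
      ultimately show ?thesis using that(3) F2 True by (simp add: wt_def)
    next
      case False
      have "0 \<le> (2 * z - 1) * (1 + 2 * y) * (real X)\<^sup>2" using that y by simp
      then show ?thesis using M(2) F2 zb False by (simp add: wt_def)
    qed
  qed
  \<comment> \<open>Coordinates in the basis (1, 2), (1, 0), both of weight 1. For odd Y they can be
    half-integers: each term then gives M / 4 at least, and the weight doubles the sum.\<close>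
  have below_half: "M \<le> wt Y * F" if "Y < 2 * X" "z < 1 / 2" "M \<le> (1 - 2 * z) * (1 + 2 * y)"
  proof -
    define a b where "a = real Y / 2" and "b = real X - real Y / 2"
    have ab: "a \<ge> 0" "b \<ge> 1 / 2" using that(1) by (simp_all add: a_def b_def)
    have F: "F = ((1 - 2 * z) * a + 1 * b) * ((1 + 2 * y) * a + 1 * b)"
    proof -
      have "real X - z * real Y \<ge> 0" using that mult_right_mono[of z "1/2" "real Y"] by simp
      then have "F = (real X - z * real Y) * (real X + y * real Y)"
        using y by (simp add: F_def abs_mult)
      then show ?thesis by (simp add: a_def b_def algebra_simps)
    qed
    have F2: "(1 - 2 * z) * (1 + 2 * y) * a\<^sup>2 + (1 * 1) * b\<^sup>2 \<le> F"
      unfolding F using that y z ab by (intro bilinear) auto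
    show ?thesis
    proof (cases "even Y")
      case True
      then obtain k where "Y = 2 * k" by blast
      then have "b \<ge> 1" using that(1) by (simp add: b_def)
      then have "b\<^sup>2 \<ge> 1" by simp
      moreover have "0 \<le> (1 - 2 * z) * (1 + 2 * y) * a\<^sup>2" using that y by simp
      ultimately show ?thesis using M(1) F2 True by (simp add: wt_def)
    next
      case False
      then have "Y \<ge> 1" by (cases Y) auto
      then have "a \<ge> 1 / 2" by (simp add: a_def)
      then have "a\<^sup>2 \<ge> (1 / 2)\<^sup>2" "b\<^sup>2 \<ge> (1 / 2)\<^sup>2" using ab by (intro power_mono; simp)+
      then have "a\<^sup>2 \<ge> 1 / 4" "b\<^sup>2 \<ge> 1 / 4" by (simp_all add: power2_eq_square)
      then have "(1 - 2 * z) * (1 + 2 * y) * (1 / 4) \<le> (1 - 2 * z) * (1 + 2 * y) * a\<^sup>2"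
        using that y by (intro mult_left_mono) auto
      then show ?thesis using M(1) that(3) F2 \<open>b\<^sup>2 \<ge> 1 / 4\<close> False by (simp add: wt_def)
    qed
  qed
  have below_1: "M \<le> wt Y * F" if "Y < X" "z < 1"
  proof -
    define b where "b = real X - real Y"
    have "b \<ge> 1" using that(1) by (simp add: b_def)
    then have "b\<^sup>2 \<ge> 1" by simp
    have F: "F = ((1 - z) * real Y + 1 * b) * ((1 + y) * real Y + 1 * b)"
    proof -
      have "real X - z * real Y \<ge> 0" using that mult_right_mono[of z 1 "real Y"] by simp
      then have "F = (real X - z * real Y) * (real X + y * real Y)"
        using y by (simp add: F_def abs_mult)
      then show ?thesis by (simp add: b_def algebra_simps)
    qed
    have "(1 - z) * (1 + y) * (real Y)\<^sup>2 + (1 * 1) * b\<^sup>2 \<le> F"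
      unfolding F using that y z \<open>b \<ge> 1\<close> by (intro bilinear) auto
    moreover have "0 \<le> (1 - z) * (1 + y) * (real Y)\<^sup>2" using that y by simp
    ultimately have "1 \<le> F" using \<open>b\<^sup>2 \<ge> 1\<close> by linarith
    moreover have "1 * F \<le> wt Y * F" using wt_bounds \<open>1 \<le> F\<close> by (intro mult_right_mono) auto
    ultimately show ?thesis using M(1) by linarith
  qed
  have "M \<le> wt Y * F"
  proof (cases d)
    case DL
    have "z > 1" using x by (simp add: z_def DL)
    moreover have "X < Y" using act_L_surj[OF mem] out DL by force
    moreover have "M \<le> 2 * ((z - 1) * (1 + y))" using c1(2) \<open>z > 1\<close> y by (simp add: DL q wt_def abs_mult)
    ultimately show ?thesis by (intro above_1)
  next
    case DR
    have "z < 1 / 2" using x by (simp add: z_def DR field_simps)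
    moreover have "Y < 2 * X" using act_R_surj[OF mem] out DR by force
    moreover have "M \<le> (1 - 2 * z) * (1 + 2 * y)"
      using c1(1) \<open>z < 1 / 2\<close> y by (simp add: DR q wt_def abs_mult mult.commute)
    ultimately show ?thesis by (intro below_half)
  next
    case DS
    have zz: "z < 1" "z > 1 / 2" using x by (simp_all add: z_def DS field_simps)
    have "M \<le> (2 * z - 1) * (1 + 2 * y)"
      using c1(2) zz y by (simp add: DS q wt_def abs_mult mult.commute)
    moreover have "Y < X \<or> 2 * X < Y" using act_S_surj[OF mem] out DS by force
    ultimately show ?thesis using below_1 above_half zz by blast
  qed
  then show ?thesis by (simp add: q F_def flip: z_def)
qed

lemma act_sum_less:
  assumes "w \<in> coprime_pairs" "act d w \<noteq> w"
  shows "fst w + snd w < fst (act d w) + snd (act d w)"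
proof -
  obtain X Y where w: "w = (X, Y)" by (cases w)
  have "X + Y > 0" using assms(1) by (auto simp: w coprime_pairs_def)
  then show ?thesis using assms(2) by (cases d) (auto simp: w)
qed

lemma act_fixed:
  assumes "w \<in> coprime_pairs" "act d w = w"
  shows "d = DL \<and> w = (1, 0) \<or> d = DR \<and> w = (0, 1)"
proof -
  obtain X Y where w: "w = (X, Y)" by (cases w)
  have "coprime X Y" using assms(1) by (auto simp: w coprime_pairs_def)
  then show ?thesis using assms(2) by (cases d) (auto simp: w split: if_splits)
qed

text \<open>Descent on X + Y: a vector in the cone of the first digit is pulled back to a smaller
  one, any other is controlled by \<open>qnorm_ge_corners\<close>. Thus a closed set
  \<open>Q\<close> of states has to be tested at two corners only.\<close>

lemma qnorm_ge_invariant: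
  assumes step: "\<And>x y. (x, y) \<in> Q \<Longrightarrow> \<exists>d x'. x = dig d x' \<and> x' > 0 \<and> y > 0 \<and> (x', dig d y) \<in> Q"
    and corner: "\<And>x y v. (x, y) \<in> Q \<Longrightarrow> v \<in> {(1, 0), (0, 1)} \<Longrightarrow> m \<le> qnorm x y v"
  shows "(x, y) \<in> Q \<Longrightarrow> v \<in> coprime_pairs \<Longrightarrow> m \<le> qnorm x y v"
proof (induction "fst v + snd v" arbitrary: v x y rule: less_induct)
  case (less v x y)
  obtain X Y where v: "v = (X, Y)" by (cases v)
  obtain d x' where x': "x = dig d x'" "x' > 0" "y > 0" "(x', dig d y) \<in> Q"
    using step[OF less.prems(1)] by blast
  show ?case
  proof (cases "v \<in> act d ` coprime_pairs")
    case False
    then show ?thesis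
      using qnorm_ge_corners[OF x'(2,3), of X Y d m] corner[OF less.prems(1)] corner[OF x'(4)] less.prems(2)
      by (simp add: v x'(1))
  next
    case True
    then obtain w where w: "w \<in> coprime_pairs" "v = act d w" by blast
    have eq: "qnorm x y v = qnorm x' (dig d y) w"
      using w x' by (simp add: qnorm_act)
    show ?thesis
    proof (cases "v = (1, 0) \<or> v = (0, 1)")
      case True
      then show ?thesis using corner[OF less.prems(1), of v] by auto
    next
      case False
      have "fst w + snd w < fst v + snd v"
        using act_sum_less[OF w(1), of d] act_fixed[OF w(1), of d] w(2) False by metis
      then show ?thesis unfolding eq using x'(4) w(1) by (rule less.hyps)
    qed
  qed
qed

text \<open>The last digit acts first, so the ranges shrink as k grows: they are the cones of
  vectors whose slope begins with the first k digits.\<close>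

primrec acts :: "(nat \<Rightarrow> digit) \<Rightarrow> nat \<Rightarrow> nat \<times> nat \<Rightarrow> nat \<times> nat" where
  "acts s 0 v = v"
| "acts s (Suc k) v = acts s k (act (s k) v)"

lemma acts_mem: "v \<in> coprime_pairs \<Longrightarrow> acts s k v \<in> coprime_pairs"
  by (induction k arbitrary: v) (simp_all add: act_mem)

lemma acts_add: "acts s (m + k) v = acts s m (acts (\<lambda>j. s (j + m)) k v)"
  by (induction k arbitrary: v) (simp_all add: add.commute)

lemma inj_acts: "inj_on (acts s k) coprime_pairs"
proof (induction k)
  case (Suc k)
  have "inj_on (acts s k \<circ> act (s k)) coprime_pairs"
    using Suc inj_act act_mem by (intro comp_inj_on) (auto intro: inj_on_subset)
  then show ?case by (simp add: comp_def)
qed simp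

lemma qnorm_acts:
  assumes "orbit s x y" "v \<in> coprime_pairs"
  shows "qnorm (x 0) (y 0) (acts s k v) = qnorm (x k) (y k) v"
  using assms(2)
proof (induction k arbitrary: v)
  case (Suc k)
  have "qnorm (x 0) (y 0) (acts s (Suc k) v) = qnorm (x k) (y k) (act (s k) v)"
    using Suc act_mem by simp
  also have "\<dots> = qnorm (dig (s k) (x (Suc k))) (y k) (act (s k) v)"
    using orbitD(3)[OF assms(1)] by metis
  also have "\<dots> = qnorm (x (Suc k)) (dig (s k) (y k)) v"
    using orbitD(1,2)[OF assms(1)] Suc.prems by (intro qnorm_act) auto
  also have "\<dots> = qnorm (x (Suc k)) (y (Suc k)) v" using orbitD(4)[OF assms(1)] by metis
  finally show ?case .
qed simp

text \<open>Repeating \<open>L\<close> lowers x by 1 at each step and repeating \<open>R\<close>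
  lowers 1 / x by 2, while both stay positive.\<close>

lemma orbit_not_const:
  assumes "orbit s x y" "d \<noteq> DS"
  shows "\<exists>k. s k \<noteq> d"
proof (rule ccontr)
  assume a: "\<nexists>k. s k \<noteq> d"
  have pos: "x k > 0" for k using assms(1) by (rule orbitD)
  have rec: "x k = dig d (x (Suc k))" for k using orbitD(3)[OF assms(1)] a by metis
  show False
  proof (cases d)
    case DL
    have eq: "x 0 = x k + real k" for k
    proof (induction k)
      case (Suc k)
      then show ?case using rec[of k] DL by simp
    qed simp
    obtain k :: nat where "x 0 < k" using reals_Archimedean2 by blast
    then show False using pos[of k] eq[of k] by linarith
  next
    case DR
    have rec': "1 / x k = 2 + 1 / x (Suc k)" for k
    proof -
      have "x k = x (Suc k) / (2 * x (Suc k) + 1)" using rec[of k] DR by simp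
      then show ?thesis using pos[of "Suc k"] by (simp add: add_divide_distrib)
    qed
    have eq: "1 / x 0 = 1 / x k + 2 * real k" for k
    proof (induction k)
      case (Suc k)
      then show ?case using rec'[of k] by simp
    qed simp
    obtain k :: nat where "1 / x 0 < k" using reals_Archimedean2 by blast
    moreover have "1 / x k > 0" using pos by simp
    ultimately show False using eq[of k] by linarith
  qed (use assms in simp)
qed

text \<open>Suppose v lay in all cones. A preimage smaller than v would escape by induction along
  the shifted orbit, so every digit fixes v; by \<open>act_fixed\<close> the digits are then all
  \<open>L\<close> or all \<open>R\<close>.\<close>

lemma acts_range_escape:
  assumes "orbit s x y" "v \<in> coprime_pairs"
  shows "\<exists>k. v \<notin> acts s k ` coprime_pairs"
  using assms
proof (induction "fst v + snd v" arbitrary: v s x y rule: less_induct)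
  case (less v s x y)
  note less_hyps = less.hyps and \<open>orbit s x y\<close> \<open>v \<in> coprime_pairs\<close>
  show ?case
  proof (rule ccontr)
    assume contra: "\<nexists>k. v \<notin> acts s k ` coprime_pairs"
    have fixed: "act (s k) v = v" for k
    proof (induction k rule: less_induct)
      case (less k)
      then have "acts s k v = v"
        by (induction k) (simp_all add: less_Suc_eq)
      obtain u where u: "u \<in> coprime_pairs" "v = acts s (Suc k) u" using contra by blast
      then have uv: "act (s k) u = v"
        using inj_onD[OF inj_acts, of s k "act (s k) u" v] \<open>acts s k v = v\<close> \<open>v \<in> coprime_pairs\<close> act_mem by simp
      have "act (s k) u = u"
      proof (rule ccontr)
        assume "act (s k) u \<noteq> u"
        then have "fst u + snd u < fst v + snd v" using act_sum_less[OF u(1)] uv by metis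
        from less_hyps[OF this orbit_shift[OF \<open>orbit s x y\<close>, of "Suc k"] u(1)]
        obtain j where j: "u \<notin> acts (\<lambda>i. s (i + Suc k)) j ` coprime_pairs" by blast
        obtain w where w: "w \<in> coprime_pairs" "v = acts s (Suc k + j) w" using contra by blast
        have "acts s (Suc k) u = acts s (Suc k) (acts (\<lambda>i. s (i + Suc k)) j w)"
          using u(2) w(2) unfolding acts_add by simp
        then have "u = acts (\<lambda>i. s (i + Suc k)) j w"
          using u(1) acts_mem[OF w(1)] by (rule inj_onD[OF inj_acts])
        then show False using j w by blast
      qed
      then show ?case using uv by simp
    qed
    then have "s k = DL \<and> v = (1, 0) \<or> s k = DR \<and> v = (0, 1)" for k
      using act_fixed \<open>v \<in> coprime_pairs\<close> by blast
    then have "s 0 \<noteq> DS" "\<forall>k. s k = s 0"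
      by (metis digit.distinct(1,5), metis prod.inject zero_neq_one)
    then show False using orbit_not_const[OF \<open>orbit s x y\<close>] by blast
  qed
qed

section \<open>Orbits of the digit map\<close>

lemma acts_range_antimono: "acts s (k + j) ` coprime_pairs \<subseteq> acts s k ` coprime_pairs"
  using acts_mem by (auto simp: acts_add)

text \<open>The finitely many small vectors leave the shrinking cones after some K steps, while a
  small value at a later state would be carried by \<open>acts\<close> to a small vector inside the
  cone.\<close>

lemma few_imp_eventually_large:
  assumes orb: "orbit s x y" and few: "few (x 0) (y 0) \<tau>"
  shows "\<exists>K. \<forall>k\<ge>K. \<forall>v\<in>coprime_pairs. \<tau> < qnorm (x k) (y k) v"
proof -
  define W where "W = {v \<in> coprime_pairs. qnorm (x 0) (y 0) v \<le> \<tau>}"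
  have "finite W" using few by (simp add: few_def W_def)
  have "\<forall>v\<in>W. \<exists>k. v \<notin> acts s k ` coprime_pairs"
    using acts_range_escape[OF orb] by (auto simp: W_def)
  then obtain f where f: "\<And>v. v \<in> W \<Longrightarrow> v \<notin> acts s (f v) ` coprime_pairs" by metis
  obtain K where K: "\<And>v. v \<in> W \<Longrightarrow> f v \<le> K"
    using \<open>finite W\<close> finite_nat_set_iff_bounded_le[of "f ` W"] by auto
  have "\<tau> < qnorm (x k) (y k) v" if "k \<ge> K" "v \<in> coprime_pairs" for k v
  proof (rule ccontr)
    assume "\<not> ?thesis"
    then have "acts s k v \<in> W" using acts_mem[OF that(2)] qnorm_acts[OF orb that(2)] by (simp add: W_def)
    moreover have "acts s k v \<in> acts s (f (acts s k v)) ` coprime_pairs"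
    proof -
      have "f (acts s k v) \<le> k" using K[OF \<open>acts s k v \<in> W\<close>] that(1) by simp
      then obtain j where "k = f (acts s k v) + j" using le_Suc_ex by blast
      then show ?thesis using acts_range_antimono[of s "f (acts s k v)" j] that(2) by auto
    qed
    ultimately show False using f by blast
  qed
  then show ?thesis by blast
qed

text \<open>Shifting the digit gives x the past \<open>dig d (past0 z)\<close> in place of
  \<open>past0 x\<close>; \<open>few_change_past\<close> exchanges the two at a loss that the limit
  superior does not see.\<close>

lemma lagrange_number_dig:
  assumes "x > 0"
  shows "lagrange_number (circle_pt (dig d x)) = lagrange_number (circle_pt x)"
proof (rule antisym)
  define z where "z = dig d x"
  define y where "y = dig d (past0 z)"
  have pos: "z > 0" "past0 z > 0" "past0 x > 0" "y > 0"
  proof -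
    show "z > 0" unfolding z_def using assms by (rule dig_pos)
    then show "past0 z > 0" by (intro past0_pos) simp
    then show "y > 0" unfolding y_def by (rule dig_pos)
    show "past0 x > 0" using assms by (intro past0_pos) simp
  qed
  have "x \<ge> 0" using assms by simp
  show "lagrange_number (circle_pt z) \<le> lagrange_number (circle_pt x)"
  proof (rule lagrange_number_mono)
    fix \<tau> \<tau>' :: real assume "\<tau>' < \<tau>" "finite {p \<in> pyth_pairs. ray_dist (circle_pt x) p \<le> \<tau>}"
    then have "few x (past0 x) \<tau>" using assms few_iff_ray_dist by simp
    from few_change_past[OF this \<open>\<tau>' < \<tau>\<close> \<open>x \<ge> 0\<close> pos(3,4)] have "few x y \<tau>'" .
    then have "few z (past0 z) \<tau>'" 
      using few_step_back[OF assms pos(2), of d \<tau>'] by (simp add: y_def flip: z_def)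
    then show "finite {p \<in> pyth_pairs. ray_dist (circle_pt z) p \<le> \<tau>'}"
      using pos few_iff_ray_dist by simp
  qed
  show "lagrange_number (circle_pt x) \<le> lagrange_number (circle_pt z)"
  proof (rule lagrange_number_mono)
    fix \<tau> \<tau>' :: real assume "\<tau>' < \<tau>" "finite {p \<in> pyth_pairs. ray_dist (circle_pt z) p \<le> \<tau>}"
    then have "few z (past0 z) \<tau>" using pos few_iff_ray_dist by simp
    then have "few x y \<tau>" 
      using few_step[OF assms pos(2), of d \<tau>] by (simp add: y_def flip: z_def)
    from few_change_past[OF this \<open>\<tau>' < \<tau>\<close> \<open>x \<ge> 0\<close> pos(4,3)] have "few x (past0 x) \<tau>'" .
    then show "finite {p \<in> pyth_pairs. ray_dist (circle_pt x) p \<le> \<tau>'}"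
      using assms few_iff_ray_dist by simp
  qed
qed

lemma lagrange_number_orbit:
  assumes "orbit s x y"
  shows "lagrange_number (circle_pt (x k)) = lagrange_number (circle_pt (x 0))"
proof (induction k)
  case (Suc k)
  have "lagrange_number (circle_pt (x k)) = lagrange_number (circle_pt (x (Suc k)))"
    using lagrange_number_dig[OF orbitD(1)[OF assms], of "s k" "Suc k"] orbitD(3)[OF assms, of k] by simp
  then show ?case using Suc by simp
qed simp

section \<open>Digit expansions of irrational numbers\<close>

definition next_digit :: "real \<Rightarrow> digit" where
  "next_digit x = (if x > 1 then DL else if x > 1 / 2 then DS else DR)"

definition next_pt :: "real \<Rightarrow> real" where
  "next_pt x = (if x > 1 then x - 1 else if x > 1 / 2 then (2 * x - 1) / (2 - 2 * x) else x / (1 - 2 * x))"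

lemma next_pt:
  assumes "x > 0" "x \<notin> \<rat>"
  shows "next_pt x > 0" "next_pt x \<notin> \<rat>" "dig (next_digit x) (next_pt x) = x"
proof -
  have "1 \<in> (\<rat> :: real set)" "1 / 2 \<in> (\<rat> :: real set)" by simp_all
  then have ne: "x \<noteq> 1" "x \<noteq> 1 / 2" using assms by metis+
  show 1: "dig (next_digit x) (next_pt x) = x"
    using assms ne by (auto simp: next_digit_def next_pt_def field_simps)
  show "next_pt x > 0" using assms ne by (auto simp: next_pt_def)
  have "dig d q \<in> \<rat>" if "q \<in> \<rat>" for d q using that by (cases d) auto
  then show "next_pt x \<notin> \<rat>" using 1 assms(2) by metis
qed

lemma irrational_orbit:
  assumes "x0 > 0" "x0 \<notin> \<rat>" "y0 > 0"
  obtains s x y where "orbit s x y" "x 0 = x0" "y 0 = y0"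
proof -
  define x where "x k = (next_pt ^^ k) x0" for k
  define y where "y = rec_nat y0 (\<lambda>k. dig (next_digit (x k)))"
  have x: "x k > 0 \<and> x k \<notin> \<rat>" for k
    by (induction k) (use assms next_pt in \<open>auto simp: x_def\<close>)
  have "y k > 0" for k by (induction k) (use assms dig_pos in \<open>auto simp: y_def\<close>)
  moreover have "x k = dig (next_digit (x k)) (x (Suc k))" for k
    using next_pt(3)[of "x k"] x[of k] by (simp add: x_def)
  ultimately have "orbit (\<lambda>k. next_digit (x k)) x y"
    using x by (simp add: orbit_def y_def)
  then show thesis by (rule that) (simp_all add: x_def y_def)
qed

text \<open>For x = r / q the factor |X - x Y| is at least 1 / q unless X / Y = x, so the values
  grow with X + Y. Rational parameters, whose digit expansion breaks off, are settled by
  this.\<close>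

lemma few_rational:
  assumes "x \<in> \<rat>" "x \<ge> 0" "y > 0"
  shows "few x y \<tau>"
proof -
  obtain r q :: int where rq: "q > 0" "coprime r q" "x = r / q"
    using assms(1) by (elim Rats_cases') auto
  define r' q' where "r' = nat r" and "q' = nat q"
  have "r \<ge> 0" using assms(2) rq by (simp add: zero_le_divide_iff)
  then have r'q': "r = int r'" "q = int q'" using rq by (simp_all add: r'_def q'_def)
  then have x: "x = r' / q'" "q' > 0" "coprime r' q'" using rq by auto
  define m where "m = min 1 y"
  have "m > 0" using assms by (simp add: m_def)
  obtain B :: nat where B: "\<tau> * (x + y) * q' / m < B" using reals_Archimedean2 by blast
  have "{v \<in> coprime_pairs. qnorm x y v \<le> \<tau>} \<subseteq> insert (r', q') {(X, Y). X + Y \<le> B}"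
  proof
    fix v assume v: "v \<in> {v \<in> coprime_pairs. qnorm x y v \<le> \<tau>}"
    obtain X Y where XY: "v = (X, Y)" by (cases v)
    have co: "coprime X Y" using v by (simp add: XY coprime_pairs_def)
    show "v \<in> insert (r', q') {(X, Y). X + Y \<le> B}"
    proof (cases "X * q' = r' * Y")
      case True
      then have "X = r' \<and> q' = Y" using coprime_crossproduct_nat[of X Y r' q'] co x(3) by simp
      then show ?thesis by (simp add: XY)
    next
      case False
      then have "\<bar>int (X * q') - int (r' * Y)\<bar> \<ge> 1" by linarith
      then have "real_of_int \<bar>int (X * q') - int (r' * Y)\<bar> \<ge> real_of_int 1" by (simp only: of_int_le_iff)
      then have "1 \<le> \<bar>real X * q' - r' * real Y\<bar>" by simp
      then have "1 \<le> \<bar>(real X - x * real Y) * q'\<bar>" using x(2) by (simp add: x(1) left_diff_distrib)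
      then have 1: "1 \<le> \<bar>real X - x * real Y\<bar> * q'" by (simp add: abs_mult)
      have "m * real X \<le> 1 * real X" "m * real Y \<le> y * real Y"
        by (intro mult_right_mono; simp add: m_def)+
      then have 2: "m * (real X + real Y) \<le> \<bar>real X + y * real Y\<bar>" using assms by (simp add: algebra_simps)
      have "1 * (m * (real X + real Y)) \<le> (\<bar>real X - x * real Y\<bar> * q') * \<bar>real X + y * real Y\<bar>"
        using 1 2 \<open>m > 0\<close> by (intro mult_mono) auto
      also have "\<dots> \<le> wt Y * ((\<bar>real X - x * real Y\<bar> * q') * \<bar>real X + y * real Y\<bar>)"
        using mult_right_mono[OF wt_bounds(1)[of Y], of "(\<bar>real X - x * real Y\<bar> * q') * \<bar>real X + y * real Y\<bar>"] by simp
      also have "\<dots> = qnorm x y v * (x + y) * q'" using assms by (simp add: qnorm_def XY abs_mult)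
      also have "\<dots> \<le> \<tau> * (x + y) * q'" using v assms by (intro mult_right_mono) auto
      finally have "real X + real Y \<le> \<tau> * (x + y) * q' / m"
        using \<open>m > 0\<close> by (simp add: pos_le_divide_eq mult.commute)
      then have "real X + real Y \<le> real B" using B by linarith
      then show ?thesis by (simp add: XY)
    qed
  qed
  moreover have "finite (insert (r', q') {(X, Y). X + Y \<le> B})" using finite_sum_le by simp
  ultimately show ?thesis unfolding few_def by (rule finite_subset)
qed

lemma lagrange_number_rational:
  assumes "x \<in> \<rat>" "x \<ge> 0"
  shows "lagrange_number (circle_pt x) = 0"
  using lagrange_number_eq_0 few_iff_ray_dist[OF assms(2)] few_rational[OF assms past0_pos[OF assms(2)]] by blast

text \<open>The parameter x = \<infinity>: the distance is the first leg a, and X + Y <= 2 a unless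
  Y = 0, which gives only the pair (0, 1).\<close>

lemma lagrange_number_vertical: "lagrange_number (0, 1) = 0"
proof (rule lagrange_number_eq_0)
  fix \<tau> :: real
  have mem: "(0, 1) \<in> quarter_circle" by (simp add: quarter_circle_def)
  have "{p \<in> pyth_pairs. ray_dist (0, 1) p \<le> \<tau>} \<subseteq> insert (0, 1) (pyth_param ` {(X, Y). X + Y \<le> nat \<lceil>2 * \<tau>\<rceil>})"
  proof
    fix p assume p: "p \<in> {p \<in> pyth_pairs. ray_dist (0, 1) p \<le> \<tau>}"
    then obtain X Y where XY: "(X, Y) \<in> coprime_pairs" "p = pyth_param (X, Y)"
      using pyth_pairs_subset_param by auto
    obtain a b where ab: "p = (a, b)" by (cases p)
    show "p \<in> insert (0, 1) (pyth_param ` {(X, Y). X + Y \<le> nat \<lceil>2 * \<tau>\<rceil>})"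
    proof (cases "Y = 0")
      case True
      then have "X = 1" using XY by (simp add: coprime_pairs_def)
      then show ?thesis using True XY by (simp add: pyth_param_def)
    next
      case False
      then have "2 * X + Y \<le> Y * (2 * X + Y)" by (cases Y) auto
      moreover have "Y * (2 * X + Y) \<le> 2 * a"
        using XY(2) by (auto simp: ab pyth_param_def split: if_splits)
      ultimately have "2 * X + Y \<le> 2 * a" by (rule order_trans)
      then have "X + Y \<le> 2 * a" by simp
      moreover have "real a \<le> \<tau>" using p mem by (simp add: ab ray_dist_eq)
      ultimately have "X + Y \<le> nat \<lceil>2 * \<tau>\<rceil>" by linarith
      then show ?thesis using XY by blast
    qed
  qed
  moreover have "finite (insert (0, 1) (pyth_param ` {(X, Y). X + Y \<le> nat \<lceil>2 * \<tau>\<rceil>}))"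
    using finite_sum_le by simp
  ultimately show "finite {p \<in> pyth_pairs. ray_dist (0, 1) p \<le> \<tau>}"
    by (rule finite_subset)
qed

section \<open>Digit sequences of narrow orbits\<close>

text \<open>The two widths are the reciprocals of \<open>qnorm\<close> at the corners (1, 0) and (0,
  1).\<close>

definition narrow :: "real \<Rightarrow> (nat \<Rightarrow> digit) \<Rightarrow> (nat \<Rightarrow> real) \<Rightarrow> (nat \<Rightarrow> real) \<Rightarrow> bool" where
  "narrow l s x y \<longleftrightarrow> orbit s x y \<and> (\<forall>k. x k + y k < l \<and> 1 / (2 * x k) + 1 / (2 * y k) < l)"

lemma narrowD:
  assumes "narrow l s x y"
  shows "x k > 0" "y k > 0" "x k = dig (s k) (x (Suc k))" "y (Suc k) = dig (s k) (y k)"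
    "x k + y k < l" "1 / (2 * x k) + 1 / (2 * y k) < l"
  using assms orbitD unfolding narrow_def by blast+

text \<open>The reflection x -> 1 / (2 x) exchanges \<infinity> with 0 and 1/2 with 1, hence
  \<open>L\<close> with \<open>R\<close>; it also exchanges the two widths.\<close>

fun dual :: "digit \<Rightarrow> digit" where
  "dual DL = DR" | "dual DS = DS" | "dual DR = DL"

lemma dual_dual [simp]: "dual (dual d) = d"
  by (cases d) simp_all

lemma dual_eq_iff [simp]: "dual d = DL \<longleftrightarrow> d = DR" "dual d = DS \<longleftrightarrow> d = DS" "dual d = DR \<longleftrightarrow> d = DL"
  by (cases d; simp)+

lemma dig_dual: "x > 0 \<Longrightarrow> dig (dual d) (1 / (2 * x)) = 1 / (2 * dig d x)"
  by (cases d) (auto simp: divide_simps, auto simp: algebra_simps)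

lemma narrow_dual:
  assumes "narrow l s x y"
  shows "narrow l (\<lambda>k. dual (s k)) (\<lambda>k. 1 / (2 * x k)) (\<lambda>k. 1 / (2 * y k))"
proof -
  note D = narrowD[OF assms]
  have a: "1 / (2 * x k) = dig (dual (s k)) (1 / (2 * x (Suc k)))" for k
    using dig_dual[OF D(1)[of "Suc k"], of "s k"] D(3)[of k] by simp
  have b: "1 / (2 * y (Suc k)) = dig (dual (s k)) (1 / (2 * y k))" for k
    using dig_dual[OF D(2)[of k], of "s k"] D(4)[of k] by simp
  show ?thesis unfolding narrow_def orbit_def
    by (intro conjI allI) (rule a b | simp add: D(1,2,5,6))+
qed

lemma dig_mono: "a > 0 \<Longrightarrow> b > 0 \<Longrightarrow> dig d a < dig d b \<longleftrightarrow> a < b"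
  by (cases d) (auto simp: divide_simps, auto simp: algebra_simps)

lemma dig_range:
  assumes "a > 0"
  shows "dig DL a > 1" "dig DS a > 1 / 2" "dig DS a < 1" "dig DR a < 1 / 2"
  using assms by (auto simp: field_simps)

declare dig.simps [simp del]

lemma gap_identity:
  fixes z w :: real
  assumes "z > 0" "w > 0"
  shows "2 - (z / (2 * z + 1) + 1 + (2 * w + 1) / (2 * w + 2)) = (1 - 2 * z * w) / ((2 * w + 2) * (2 * z + 1))"
proof -
  have nz: "2 * z + 1 \<noteq> 0" "2 * w + 2 \<noteq> 0" using assms by auto
  have "2 - (z / (2 * z + 1) + 1 + (2 * w + 1) / (2 * w + 2)) =
      ((2 * w + 2) * (2 * z + 1) - z * (2 * w + 2) - (2 * w + 1) * (2 * z + 1)) / ((2 * w + 2) * (2 * z + 1))"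
    using nz by (simp add: diff_divide_distrib add_divide_distrib)
  also have "(2 * w + 2) * (2 * z + 1) - z * (2 * w + 2) - (2 * w + 1) * (2 * z + 1) = 1 - 2 * z * w"
    by (simp add: algebra_simps)
  finally show ?thesis .
qed

text \<open>The denominator in \<open>gap_identity\<close> is at least 2, so the margin 2 - l is
  doubled; this is the origin of the constant 1 - 2 (2 - l).\<close>

lemma gap_bound:
  fixes z w l :: real
  assumes pos: "z > 0" "w > 0" and "l \<le> 2" and sum: "z / (2 * z + 1) + 1 + (2 * w + 1) / (2 * w + 2) < l"
  shows "2 * z * w < 1 - 2 * (2 - l)"
proof -
  define den where "den = (2 * w + 2) * (2 * z + 1)"
  have "2 * 1 \<le> den" unfolding den_def using pos by (intro mult_mono) auto
  then have "den \<ge> 2" by simp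
  have "2 - l < (1 - 2 * z * w) / den" using sum gap_identity[OF pos] unfolding den_def by linarith
  then have "(2 - l) * den < 1 - 2 * z * w" using \<open>den \<ge> 2\<close> by (simp add: pos_less_divide_eq)
  moreover have "(2 - l) * 2 \<le> (2 - l) * den" using \<open>den \<ge> 2\<close> \<open>l \<le> 2\<close> by (intro mult_left_mono) auto
  ultimately show ?thesis by linarith
qed

text \<open>\<open>1 / (2 * y k)\<close> reflects the past into the half-line of the future, so that both can be compared.\<close>

lemma turn_L:
  assumes nar: "narrow l s x y" and "l \<le> 2" and s: "s (Suc k) = DL"
    "s k = DS \<and> s (Suc (Suc k)) = DR \<or> s k = DR \<and> s (Suc (Suc k)) = DS"
  shows "x (Suc (Suc (Suc k))) < (1 - 2 * (2 - l)) * (1 / (2 * y k))"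
proof -
  note D = narrowD[OF nar]
  define z w where "z = x (Suc (Suc (Suc k)))" and "w = y k"
  have pos: "z > 0" "w > 0" unfolding z_def w_def by (rule D)+
  have "x (Suc k) = x (Suc (Suc k)) + 1" using D(3)[of "Suc k"] s(1) by (simp only: dig.simps)
  moreover have "x (Suc (Suc k)) = dig (s (Suc (Suc k))) z" unfolding z_def by (rule D(3))
  moreover have "y (Suc k) = dig (s k) w" unfolding w_def by (rule D(4))
  ultimately have sum: "dig (s (Suc (Suc k))) z + 1 + dig (s k) w < l"
    using D(5)[of "Suc k"] by linarith
  have "2 * z * w < 1 - 2 * (2 - l)"
    using s(2)
  proof
    assume "s k = DS \<and> s (Suc (Suc k)) = DR"
    then have "z / (2 * z + 1) + 1 + (2 * w + 1) / (2 * w + 2) < l" using sum by (simp add: dig.simps)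
    then show ?thesis by (rule gap_bound[OF pos \<open>l \<le> 2\<close>])
  next
    assume "s k = DR \<and> s (Suc (Suc k)) = DS"
    then have "w / (2 * w + 1) + 1 + (2 * z + 1) / (2 * z + 2) < l" using sum by (simp add: dig.simps)
    from gap_bound[OF pos(2,1) \<open>l \<le> 2\<close> this] show ?thesis by (simp only: mult.assoc mult.commute[of w z])
  qed
  moreover have "2 * z * w = z * (2 * w)" by simp
  ultimately have "z < (1 - 2 * (2 - l)) / (2 * w)" using pos by (simp only: pos_less_divide_eq)
  then show ?thesis unfolding z_def w_def by (simp only: times_divide_eq_right mult_1_right)
qed

text \<open>This is \<open>turn_L\<close> for the reflected orbit; x -> 1 / (2 x) reverses the
  order, so future and past change sides.\<close>

lemma turn_R:
  assumes nar: "narrow l s x y" and "l \<le> 2" and s: "s (Suc k) = DR"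
    "s k = DS \<and> s (Suc (Suc k)) = DL \<or> s k = DL \<and> s (Suc (Suc k)) = DS"
  shows "1 / (2 * y k) < (1 - 2 * (2 - l)) * x (Suc (Suc (Suc k)))"
proof -
  define c X where "c = 1 - 2 * (2 - l)" and "X = x (Suc (Suc (Suc k)))"
  have pos: "X > 0" "y k > 0" using narrowD(1,2)[OF nar] by (auto simp: X_def)
  have "1 / (2 * X) < c * (1 / (2 * (1 / (2 * y k))))"
    unfolding X_def c_def using s by (intro turn_L[OF narrow_dual[OF nar] \<open>l \<le> 2\<close>]) auto
  then have "1 / (2 * X) < c * y k" by simp
  then have "1 < c * y k * (2 * X)" using pos by (simp add: pos_divide_less_eq)
  then have "1 < c * X * (2 * y k)" by (simp add: ac_simps)
  then have "1 / (2 * y k) < c * X" using pos by (simp add: pos_divide_less_eq)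
  then show ?thesis by (simp add: c_def X_def)
qed

section \<open>Forbidden digit words\<close>

lemma narrow_digit:
  assumes "narrow l s x y"
  shows "s k = DL \<Longrightarrow> x k > 1" "s k = DS \<Longrightarrow> x k > 1 / 2" "s k = DS \<Longrightarrow> x k < 1" "s k = DR \<Longrightarrow> x k < 1 / 2"
  using dig_range[OF narrowD(1)[OF assms, of "Suc k"]] narrowD(3)[OF assms, of k] by simp_all

lemma no_double_L:
  assumes nar: "narrow 2 s x y" and "s k = DL"
  shows "s (Suc k) \<noteq> DL"
proof
  assume "s (Suc k) = DL"
  then have "x (Suc k) > 1" by (rule narrow_digit[OF nar])
  then have "x k > 2" using narrowD(3)[OF nar, of k] \<open>s k = DL\<close> by (simp add: dig.simps)
  then show False using narrowD(2,5)[OF nar, of k] by simp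
qed

lemma no_double_R:
  assumes nar: "narrow 2 s x y" and "s k = DR"
  shows "s (Suc k) \<noteq> DR"
  using no_double_L[OF narrow_dual[OF nar], of k] assms(2) by simp

lemma no_SLS:
  assumes nar: "narrow 2 s x y" and "s k = DS" "s (Suc k) = DL"
  shows "s (Suc (Suc k)) \<noteq> DS"
proof
  assume "s (Suc (Suc k)) = DS"
  then have "x (Suc (Suc k)) > 1 / 2" by (rule narrow_digit[OF nar])
  then have "x (Suc k) > 3 / 2" using narrowD(3)[OF nar, of "Suc k"] assms(3) by (simp add: dig.simps)
  moreover have "y (Suc k) > 1 / 2"
    using narrowD(4)[OF nar, of k] assms(2) dig_range(2)[OF narrowD(2)[OF nar, of k]] by simp
  ultimately show False using narrowD(5)[OF nar, of "Suc k"] by simp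
qed

text \<open>The digit maps are increasing and their ranges are ordered \<open>R\<close> <
  \<open>S\<close> < \<open>L\<close>, so numbers compare like their expansions: a bound starting
  with S^m R leaves no room for an \<open>L\<close>, nor for more than m letters
  \<open>S\<close>.\<close>

lemma digits_below_SR:
  assumes nar: "narrow l s x y" and "h > 0" "x q < (dig DS ^^ m) (dig DR h)"
  shows "\<exists>b\<le>m. (\<forall>i<b. s (q + i) = DS) \<and> s (q + b) = DR"
  using assms(3)
proof (induction m arbitrary: q)
  case 0
  then have "x q < 1 / 2" using dig_range(4)[OF \<open>h > 0\<close>] by simp
  then have "s q = DR" using narrow_digit[OF nar, of q] by (cases "s q") auto
  then show ?case by simp
next
  case (Suc m)
  define u where "u = (dig DS ^^ m) (dig DR h)"
  have "u > 0" unfolding u_def by (induction m) (use dig_pos[OF \<open>h > 0\<close>] dig_pos in \<open>auto\<close>)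
  have "x q < dig DS u" using Suc.prems by (simp add: u_def)
  moreover have "dig DS u < 1" using \<open>u > 0\<close> by (rule dig_range)
  ultimately have "s q \<noteq> DL" using narrow_digit(1)[OF nar, of q] by auto
  show ?case
  proof (cases "s q")
    case DS
    then have "x (Suc q) < u"
      using \<open>x q < dig DS u\<close> narrowD(3)[OF nar, of q] dig_mono[OF narrowD(1)[OF nar] \<open>u > 0\<close>] by metis
    then obtain b where b: "b \<le> m" "\<forall>i<b. s (Suc q + i) = DS" "s (Suc q + b) = DR"
      using Suc.IH[of "Suc q"] by (auto simp: u_def)
    have "s (q + i) = DS" if "i < Suc b" for i using that b(2) DS by (cases i) auto
    then show ?thesis using b by (intro exI[of _ "Suc b"]) auto
  qed (use \<open>s q \<noteq> DL\<close> in \<open>auto intro: exI[of _ 0]\<close>)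
qed

text \<open>In a word L S^a L with a > 0 the last \<open>L\<close> is followed by \<open>R\<close>,
  and \<open>turn_L\<close> puts the digits after that below the reflected past S^(a-1) R. So they
  start with S^b R for some b < a, and R S^b R is a shorter forbidden word of the reflected
  orbit.\<close>

lemma no_flip_L:
  assumes "narrow 2 s x y" "s p = DL" "\<forall>i<a. s (Suc p + i) = DS"
  shows "s (Suc p + a) \<noteq> DL"
  using assms
proof (induction a arbitrary: s x y p rule: less_induct)
  case (less a)
  note nar = less.prems(1)
  show ?case
  proof (cases a)
    case 0
    then show ?thesis using no_double_L[OF nar less.prems(2)] by simp
  next
    case (Suc a')
    show ?thesis
    proof
      assume L: "s (Suc p + a) = DL"
      define k where "k = p + a"
      have sk: "s k = DS" "s (Suc k) = DL" using less.prems(3) L Suc by (auto simp: k_def)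
      have "s (Suc (Suc k)) = DR"
        using no_double_L[OF nar sk(2)] no_SLS[OF nar sk] by (cases "s (Suc (Suc k))") auto
      then have "x (Suc (Suc (Suc k))) < 1 / (2 * y k)"
        using turn_L[OF nar, of k] sk by simp
      moreover have "1 / (2 * y (Suc p + i)) = (dig DS ^^ i) (dig DR (1 / (2 * y p)))" if "i \<le> a" for i
        using that
      proof (induction i)
        case 0
        then show ?case
          using narrowD(3,4)[OF narrow_dual[OF nar], of p] less.prems(2) by simp
      next
        case (Suc i)
        then show ?case
          using narrowD(4)[OF narrow_dual[OF nar], of "Suc p + i"] less.prems(3) by simp
      qed
      from this[of a'] have "1 / (2 * y k) = (dig DS ^^ a') (dig DR (1 / (2 * y p)))"
        by (simp add: k_def Suc)
      ultimately obtain b where b: "b \<le> a'" "\<forall>i<b. s (Suc (Suc (Suc k)) + i) = DS" "s (Suc (Suc (Suc k)) + b) = DR"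
        using digits_below_SR[OF nar, of "1 / (2 * y p)" "Suc (Suc (Suc k))" a'] narrowD(2)[OF nar, of p] by auto
      then show False
        using less.IH[of b, OF _ narrow_dual[OF nar], of "Suc (Suc k)"] \<open>s (Suc (Suc k)) = DR\<close> Suc by simp
    qed
  qed
qed

lemma no_flip_R:
  assumes nar: "narrow 2 s x y" and "s p = DR" "\<forall>i<a. s (Suc p + i) = DS"
  shows "s (Suc p + a) \<noteq> DR"
  using no_flip_L[OF narrow_dual[OF nar], of p a] assms(2,3) by simp

definition RL_step :: "real \<Rightarrow> real" where
  "RL_step a = dig DR (dig DL a)"

text \<open>The same lexicographic comparison with a bound starting (RL)^m R S: since
  \<open>RR\<close> is excluded, the alternation can end only in an \<open>S\<close> after some
  \<open>R\<close>, and no later than in the bound.\<close>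

lemma digits_below_RL:
  assumes nar: "narrow 2 s x y" and "h > 0" "x q < (RL_step ^^ m) (dig DR (dig DS h))"
  shows "\<exists>n\<le>m. (\<forall>i<2*n+1. s (q + i) = (if even i then DR else DL)) \<and> s (q + (2*n+1)) = DS"
  using assms(3)
proof (induction m arbitrary: q)
  case 0
  have "x q < dig DR (dig DS h)" using 0 by simp
  moreover have "dig DR (dig DS h) < 1 / 2" using \<open>h > 0\<close> by (intro dig_range dig_pos)
  ultimately have "s q = DR" using narrow_digit[OF nar, of q] by (cases "s q") auto
  then have "x (Suc q) < dig DS h"
    using \<open>x q < dig DR (dig DS h)\<close> narrowD(3)[OF nar, of q] dig_mono[OF narrowD(1)[OF nar] dig_pos[OF \<open>h > 0\<close>]] by metis
  also have "\<dots> < 1" using \<open>h > 0\<close> by (rule dig_range)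
  finally have "s (Suc q) \<noteq> DL" using narrow_digit(1)[OF nar, of "Suc q"] by auto
  then have "s (Suc q) = DS" using no_double_R[OF nar \<open>s q = DR\<close>] by (cases "s (Suc q)") auto
  then show ?case using \<open>s q = DR\<close> by simp
next
  case (Suc m)
  define u where "u = (RL_step ^^ m) (dig DR (dig DS h))"
  then have u: "x q < RL_step u" using Suc.prems by simp
  have "u > 0" unfolding u_def
    by (induction m) (simp_all add: dig_pos \<open>h > 0\<close> RL_step_def)
  have "x q < dig DR (dig DL u)" using u by (simp add: RL_step_def)
  moreover have "dig DR (dig DL u) < 1 / 2" using \<open>u > 0\<close> by (intro dig_range dig_pos)
  ultimately have "s q = DR" using narrow_digit[OF nar, of q] by (cases "s q") auto
  then have *: "x (Suc q) < dig DL u"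
    using \<open>x q < dig DR (dig DL u)\<close> narrowD(3)[OF nar, of q] dig_mono[OF narrowD(1)[OF nar] dig_pos[OF \<open>u > 0\<close>]] by metis
  show ?case
  proof (cases "s (Suc q)")
    case DS
    then show ?thesis using \<open>s q = DR\<close> by (intro exI[of _ 0]) simp
  next
    case DR
    then show ?thesis using no_double_R[OF nar \<open>s q = DR\<close>] by simp
  next
    case DL
    then have "x (Suc (Suc q)) < u"
      using * narrowD(3)[OF nar, of "Suc q"] dig_mono[OF narrowD(1)[OF nar] \<open>u > 0\<close>] by metis
    then obtain n where n: "n \<le> m" "\<forall>i<2*n+1. s (Suc (Suc q) + i) = (if even i then DR else DL)"
        "s (Suc (Suc q) + (2*n+1)) = DS"
      using Suc.IH[of "Suc (Suc q)"] by (auto simp: u_def)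
    have "s (q + i) = (if even i then DR else DL)" if i: "i < 2 * Suc n + 1" for i
    proof -
      consider "i = 0" | "i = 1" | j where "i = Suc (Suc j)" "j < 2*n+1"
      proof -
        have "i = 0 \<or> i = 1 \<or> i = Suc (Suc (i - 2))" by linarith
        then show thesis using that i by fastforce
      qed
      then show ?thesis using \<open>s q = DR\<close> DL n(2) by cases auto
    qed
    then show ?thesis using n by (intro exI[of _ "Suc n"]) auto
  qed
qed

text \<open>Descent on S L (RL)^n S: at the last \<open>L\<close>, \<open>turn_L\<close> puts the
  digits behind the final \<open>S\<close> below the reflected past (RL)^(n-1) R S. Together with
  that \<open>S\<close> they form S R (LR)^n' S with n' < n, a shorter instance for the reflected
  orbit.\<close>

lemma no_odd_run_L:
  assumes "narrow 2 s x y" "s p = DS" "\<forall>i<2*n+1. s (Suc p + i) = (if even i then DL else DR)"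
  shows "s (Suc p + (2*n+1)) \<noteq> DS"
  using assms
proof (induction n arbitrary: s x y p rule: less_induct)
  case (less n)
  note nar = less.prems(1)
  show ?case
  proof (cases n)
    case 0
    then show ?thesis using no_SLS[OF nar less.prems(2)] less.prems(3) by simp
  next
    case (Suc m)
    show ?thesis
    proof
      assume S: "s (Suc p + (2*n+1)) = DS"
      define k where "k = p + 2 * n"
      have sk: "s (Suc k) = DL" "s k = DR" "s (Suc (Suc k)) = DS"
        using less.prems(3)[rule_format, of "2*n"] less.prems(3)[rule_format, of "2*n-1"] S Suc
        by (auto simp: k_def)
      then have "x (Suc (Suc (Suc k))) < 1 / (2 * y k)" using turn_L[OF nar, of k] by simp
      moreover have "1 / (2 * y (p + 2 * Suc i)) = (RL_step ^^ i) (dig DR (dig DS (1 / (2 * y p))))"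
        if "i \<le> m" for i
        using that
      proof (induction i)
        case 0
        then show ?case
          using narrowD(4)[OF narrow_dual[OF nar], of p] narrowD(4)[OF narrow_dual[OF nar], of "Suc p"]
            less.prems(2) less.prems(3)[rule_format, of 0] by simp
      next
        case (Suc i)
        have "s (Suc p + (2*i+1)) = DR" "s (Suc p + (2*i+2)) = DL"
          using less.prems(3)[rule_format, of "2*i+1"] less.prems(3)[rule_format, of "2*i+2"] Suc.prems \<open>n = Suc m\<close> by auto
        then show ?case
          using Suc narrowD(4)[OF narrow_dual[OF nar], of "p + 2 * Suc i"]
            narrowD(4)[OF narrow_dual[OF nar], of "Suc (p + 2 * Suc i)"] by (simp add: RL_step_def)
      qed
      from this[of m] have "1 / (2 * y k) = (RL_step ^^ m) (dig DR (dig DS (1 / (2 * y p))))"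
        by (simp add: k_def Suc)
      ultimately obtain n' where n': "n' \<le> m"
        "\<forall>i<2*n'+1. s (Suc (Suc (Suc k)) + i) = (if even i then DR else DL)"
        "s (Suc (Suc (Suc k)) + (2*n'+1)) = DS"
        using digits_below_RL[OF nar, of "1 / (2 * y p)" "Suc (Suc (Suc k))" m] narrowD(2)[OF nar, of p] by auto
      then have "\<forall>i<2*n'+1. dual (s (Suc (Suc (Suc k)) + i)) = (if even i then DL else DR)" by auto
      then show False
        using less.IH[of n', OF _ narrow_dual[OF nar], of "Suc (Suc k)"] sk(3) Suc n' by simp
    qed
  qed
qed

section \<open>Block sequences\<close>

fun blk :: "bool \<Rightarrow> real \<Rightarrow> real" where
  "blk False x = dig DS x"
| "blk True x = dig DL (dig DR x)"

text \<open>\<open>True\<close> stands for \<open>LR\<close>, and g is the reflected past 1 / (2 y).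
  Reversing a block and reflecting its digits gives the block back, so g grows by the same maps as z
  unfolds. The last two clauses are \<open>turn_L\<close> and \<open>turn_R\<close> at a change of
  block.\<close>

definition blocks :: "real \<Rightarrow> (nat \<Rightarrow> bool) \<Rightarrow> (nat \<Rightarrow> real) \<Rightarrow> (nat \<Rightarrow> real) \<Rightarrow> bool" where
  "blocks c t z g \<longleftrightarrow>
     (\<forall>i. z i > 0 \<and> g i > 0 \<and> z i = blk (t i) (z (Suc i)) \<and> g (Suc i) = blk (t i) (g i)) \<and>
     (\<forall>i. \<not> t i \<longrightarrow> t (Suc i) \<longrightarrow> z (Suc (Suc i)) < c * g i) \<and>
     (\<forall>i. t i \<longrightarrow> \<not> t (Suc i) \<longrightarrow> g i < c * z (Suc (Suc i)))"

lemma narrow_mono: "narrow l s x y \<Longrightarrow> l \<le> l' \<Longrightarrow> narrow l' s x y"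
  unfolding narrow_def by (meson less_le_trans)

text \<open>What must be remembered of the past: the last digit other than \<open>S\<close> was
  \<open>R\<close>, which excludes \<open>R\<close> next, and the digits since the last
  \<open>S\<close> are (LR)^m, which excludes \<open>LS\<close> next.\<close>

definition block_start :: "(nat \<Rightarrow> digit) \<Rightarrow> nat \<Rightarrow> bool" where
  "block_start s P \<longleftrightarrow>
     (\<exists>q a. P = Suc q + a \<and> s q = DR \<and> (\<forall>i<a. s (Suc q + i) = DS)) \<and>
     (\<exists>r m. P = Suc r + 2 * m \<and> s r = DS \<and> (\<forall>i<2*m. s (Suc r + i) = (if even i then DL else DR)))"

lemma block_start_step:
  assumes nar: "narrow 2 s x y" and st: "block_start s P"
  shows "s P = DS \<and> block_start s (Suc P) \<or> s P = DL \<and> s (Suc P) = DR \<and> block_start s (Suc (Suc P))"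
proof -
  obtain q a where qa: "P = Suc q + a" "s q = DR" "\<forall>i<a. s (Suc q + i) = DS"
    using st unfolding block_start_def by blast
  obtain r m where rm: "P = Suc r + 2 * m" "s r = DS" "\<forall>i<2*m. s (Suc r + i) = (if even i then DL else DR)"
    using st unfolding block_start_def by blast
  have "s P \<noteq> DR" using no_flip_R[OF nar qa(2,3)] qa(1) by simp
  then consider "s P = DS" | "s P = DL" by (cases "s P") auto
  then show ?thesis
  proof cases
    case 1
    have "\<forall>i<Suc a. s (Suc q + i) = DS" using qa 1 by (auto simp: less_Suc_eq)
    then have "\<exists>q a. Suc P = Suc q + a \<and> s q = DR \<and> (\<forall>i<a. s (Suc q + i) = DS)"
      using qa by (intro exI[of _ q] exI[of _ "Suc a"]) simp
    moreover have "\<exists>r m. Suc P = Suc r + 2 * m \<and> s r = DS \<and> (\<forall>i<2*m. s (Suc r + i) = (if even i then DL else DR))"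
      using 1 by (intro exI[of _ P] exI[of _ 0]) simp
    ultimately show ?thesis using 1 unfolding block_start_def by blast
  next
    case 2
    have run: "\<forall>i<2*m+1. s (Suc r + i) = (if even i then DL else DR)"
      using rm 2 by (auto simp: less_Suc_eq)
    have "s (Suc P) \<noteq> DS" using no_odd_run_L[OF nar rm(2) run] rm(1) by simp
    moreover have "s (Suc P) \<noteq> DL" using no_double_L[OF nar 2] .
    ultimately have R: "s (Suc P) = DR" by (cases "s (Suc P)") auto
    have "\<exists>q a. Suc (Suc P) = Suc q + a \<and> s q = DR \<and> (\<forall>i<a. s (Suc q + i) = DS)"
      using R by (intro exI[of _ "Suc P"] exI[of _ 0]) simp
    moreover have "\<forall>i<2 * Suc m. s (Suc r + i) = (if even i then DL else DR)"
      using run R rm(1) by (auto simp: less_Suc_eq)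
    then have "\<exists>r m. Suc (Suc P) = Suc r + 2 * m \<and> s r = DS \<and> (\<forall>i<2*m. s (Suc r + i) = (if even i then DL else DR))"
      using rm by (intro exI[of _ r] exI[of _ "Suc m"]) simp
    ultimately show ?thesis using 2 R unfolding block_start_def by blast
  qed
qed

text \<open>\<open>J\<close> is an arbitrary invariant of the positions where a block begins, so
  that words containing only one of the two blocks are covered by the same construction.\<close>

lemma narrow_blocks_from:
  assumes nar: "narrow l s x y" and l: "l \<le> 2"
    and st: "s P = DS \<or> s P = DL \<and> s (Suc P) = DR" "J P"
    and step: "\<And>p. J p \<Longrightarrow> s p = DS \<and> J (Suc p) \<or> s p = DL \<and> s (Suc p) = DR \<and> J (Suc (Suc p))"
  shows "\<exists>t z g. blocks (1 - 2 * (2 - l)) t z g \<and> (\<forall>i. \<exists>k. z i = x k)"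
proof -
  define p where "p = rec_nat P (\<lambda>i q. if s q = DS then Suc q else Suc (Suc q))"
  have p_Suc: "p (Suc i) = (if s (p i) = DS then Suc (p i) else Suc (Suc (p i)))" for i
    by (simp add: p_def)
  have J: "J (p i)" for i
  proof (induction i)
    case (Suc i)
    show ?case using step[OF Suc] by (auto simp: p_Suc)
  qed (simp add: p_def st)
  have dig_at: "s (p i) = DS \<or> s (p i) = DL \<and> s (Suc (p i)) = DR" for i using step[OF J] by blast
  define t where "t i = (s (p i) = DL)" for i
  define z where "z i = x (p i)" for i
  define g where "g i = 1 / (2 * y (p i))" for i
  note D = narrowD[OF nar] and D' = narrowD[OF narrow_dual[OF nar]]
  have "z i = blk (t i) (z (Suc i))" for i
    using dig_at[of i] D(3)[of "p i"] D(3)[of "Suc (p i)"] by (auto simp: z_def t_def p_Suc)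
  moreover have "g (Suc i) = blk (t i) (g i)" for i
    using dig_at[of i] D'(4)[of "p i"] D'(4)[of "Suc (p i)"] by (auto simp: g_def t_def p_Suc)
  moreover have "z i > 0" "g i > 0" for i using D(1,2) by (simp_all add: z_def g_def)
  moreover have "z (Suc (Suc i)) < (1 - 2 * (2 - l)) * g i" if "\<not> t i" "t (Suc i)" for i
  proof -
    have "s (p i) = DS" using dig_at[of i] that by (auto simp: t_def)
    then have "p (Suc i) = Suc (p i)" by (simp add: p_Suc)
    moreover have "s (Suc (p i)) = DL" "s (Suc (Suc (p i))) = DR"
      using dig_at[of "Suc i"] that(2) \<open>p (Suc i) = Suc (p i)\<close> by (auto simp: t_def)
    ultimately show ?thesis using turn_L[OF nar l, of "p i"] \<open>s (p i) = DS\<close> by (simp add: z_def g_def p_Suc)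
  qed
  moreover have "g i < (1 - 2 * (2 - l)) * z (Suc (Suc i))" if "t i" "\<not> t (Suc i)" for i
  proof -
    have s: "s (p i) = DL" "s (Suc (p i)) = DR" using dig_at[of i] that by (auto simp: t_def)
    then have p: "p (Suc i) = Suc (Suc (p i))" by (simp add: p_Suc)
    then have "s (Suc (Suc (p i))) = DS" using dig_at[of "Suc i"] that(2) by (auto simp: t_def)
    then show ?thesis using turn_R[OF nar l, of "p i"] s p by (simp add: z_def g_def p_Suc)
  qed
  ultimately have "blocks (1 - 2 * (2 - l)) t z g" unfolding blocks_def by blast
  moreover have "\<forall>i. \<exists>k. z i = x k" by (auto simp: z_def)
  ultimately show ?thesis by blast
qed

lemma narrow_blocks_L:
  assumes nar: "narrow l s x y" and l: "l \<le> 2" and q: "s q = DR" "s (Suc q) = DS"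
  shows "\<exists>t z g. blocks (1 - 2 * (2 - l)) t z g \<and> (\<forall>i. \<exists>k. z i = x k)"
proof -
  note nar2 = narrow_mono[OF nar l]
  have "\<exists>q' a. Suc (Suc q) = Suc q' + a \<and> s q' = DR \<and> (\<forall>i<a. s (Suc q' + i) = DS)"
    using q by (intro exI[of _ q] exI[of _ 1]) simp
  moreover have "\<exists>r m. Suc (Suc q) = Suc r + 2 * m \<and> s r = DS \<and> (\<forall>i<2*m. s (Suc r + i) = (if even i then DL else DR))"
    using q by (intro exI[of _ "Suc q"] exI[of _ 0]) simp
  ultimately have st: "block_start s (Suc (Suc q))" unfolding block_start_def by blast
  show ?thesis
    using block_start_step[OF nar2] block_start_step[OF nar2 st] st
    by (intro narrow_blocks_from[OF nar l, of "Suc (Suc q)" "block_start s"]) auto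
qed

text \<open>Blocks can be cut after an occurrence of \<open>RS\<close>, or of \<open>LS\<close> once
  the orbit is reflected. Otherwise \<open>S\<close> is never entered from another digit, and the
  word is constantly \<open>S\<close> or alternates from some point on.\<close>

lemma narrow_blocks:
  assumes nar: "narrow l s x y" and l: "l \<le> 2"
  shows "\<exists>t z g. blocks (1 - 2 * (2 - l)) t z g \<and> (\<forall>i. \<exists>k. z i = x k \<or> z i = 1 / (2 * x k))"
proof -
  note nar2 = narrow_mono[OF nar l]
  consider q where "s q = DR" "s (Suc q) = DS" | q where "s q = DL" "s (Suc q) = DS"
    | "\<forall>q. s q \<noteq> DS \<longrightarrow> s (Suc q) \<noteq> DS"
    by (metis digit.exhaust)
  then show ?thesis
  proof cases
    case 1
    then show ?thesis using narrow_blocks_L[OF nar l] by metis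
  next
    case 2
    then have "\<exists>t z g. blocks (1 - 2 * (2 - l)) t z g \<and> (\<forall>i. \<exists>k. z i = 1 / (2 * x k))"
      using narrow_blocks_L[OF narrow_dual[OF nar] l, of q] by simp
    then show ?thesis by metis
  next
    case 3
    show ?thesis
    proof (cases "\<forall>q. s q = DS")
      case True
      then have "\<exists>t z g. blocks (1 - 2 * (2 - l)) t z g \<and> (\<forall>i. \<exists>k. z i = x k)"
        by (intro narrow_blocks_from[OF nar l, of 0 "\<lambda>_. True"]) auto
      then show ?thesis by metis
    next
      case False
      then obtain q where q: "s q \<noteq> DS" by blast
      have noS: "s (q + i) \<noteq> DS" for i by (induction i) (use q 3 in auto)
      have alt: "s k = DL \<Longrightarrow> s (Suc k) = DR" "s k = DR \<Longrightarrow> s (Suc k) = DL" if "k \<ge> q" for k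
      proof -
        have "s (Suc k) \<noteq> DS" using noS[of "Suc k - q"] that by simp
        then show "s k = DL \<Longrightarrow> s (Suc k) = DR" "s k = DR \<Longrightarrow> s (Suc k) = DL"
          using no_double_L[OF nar2, of k] no_double_R[OF nar2, of k] by (metis digit.exhaust)+
      qed
      obtain P where P: "P \<ge> q" "s P = DL"
      proof (cases "s q")
        case DR
        then show thesis using that[of "Suc q"] alt(2)[of q] by simp
      qed (use that q in auto)
      have "\<exists>t z g. blocks (1 - 2 * (2 - l)) t z g \<and> (\<forall>i. \<exists>k. z i = x k)"
        using P alt by (intro narrow_blocks_from[OF nar l, of P "\<lambda>p. p \<ge> q \<and> s p = DL"]) auto
      then show ?thesis by metis
    qed
  qed
qed

section \<open>Finiteness of Markov sequences\<close>

text \<open>Reading outwards from the change at i, i + 1, the first mismatched pair of letters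
  repeats the change in reverse order. N bounds its distance and is the parameter of the later
  induction; \<open>j < i\<close> keeps the subtractions genuine.\<close>

definition markov :: "nat \<Rightarrow> (nat \<Rightarrow> bool) \<Rightarrow> nat \<Rightarrow> bool" where
  "markov N t K \<longleftrightarrow> (\<forall>i\<ge>K. t i \<noteq> t (Suc i) \<longrightarrow>
     (\<exists>j<N. j < i \<and> (\<forall>l<j. t (i - 1 - l) = t (i + 2 + l)) \<and>
            t (i - 1 - j) = t (Suc i) \<and> t (i + 2 + j) = t i))"

text \<open>A doubled c and a doubled negation of c, joined by an alternating stretch.\<close>

definition alt_pattern :: "(nat \<Rightarrow> bool) \<Rightarrow> bool \<Rightarrow> nat \<Rightarrow> nat \<Rightarrow> bool" where
  "alt_pattern t c p k \<longleftrightarrow> t p = c \<and> (\<forall>i<2*k. t (Suc p + i) = (if even i then c else \<not> c)) \<and>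
     t (Suc p + 2*k) = (\<not> c)"

text \<open>Apply the condition at the last change from c inside the stretch. To the right one then
  sees a doubled negation of c followed by the mirrored stretch, which ends in a doubled c either at
  the mismatch or by mirroring the doubled c at p: the negated pattern with smaller k.\<close>

lemma no_alt_pattern:
  assumes mk: "markov N t K"
  shows "p \<ge> K \<Longrightarrow> k \<ge> 1 \<Longrightarrow> \<not> alt_pattern t c p k"
proof (induction k arbitrary: p c rule: less_induct)
  case (less k)
  show ?case
  proof
    assume pat: "alt_pattern t c p k"
    then have tp: "t p = c" and alt: "\<And>i. i < 2*k \<Longrightarrow> t (Suc p + i) = (if even i then c else \<not> c)"
      and last: "t (Suc p + 2*k) = (\<not> c)" by (auto simp: alt_pattern_def)
    obtain k1 where k1: "k = Suc k1" using less.prems(2) by (cases k) auto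
    define i where "i = p + 2*k1 + 1"
    have ti: "t i = c" "t (Suc i) = (\<not> c)" using alt[of "2*k1"] alt[of "2*k1+1"] by (auto simp: i_def k1)
    have "i \<ge> K" using less.prems(1) by (simp add: i_def)
    then obtain j where j: "j < i" "\<forall>l<j. t (i - 1 - l) = t (i + 2 + l)" "t (i - 1 - j) = (\<not> c)" "t (i + 2 + j) = c"
      using mk ti unfolding markov_def by metis
    have w: "t (i - 1 - l) = (if even l then \<not> c else c)" if "l < 2*k1" for l
    proof -
      have "i - 1 - l = Suc p + (2*k1 - 1 - l)" using that by (simp add: i_def)
      moreover have "even (2*k1 - 1 - l) \<longleftrightarrow> odd l" using that by (simp add: even_diff_nat)
      ultimately show ?thesis using alt[of "2*k1 - 1 - l"] by (simp add: k1)
    qed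
    have w2: "t (i - 1 - 2*k1) = c" using tp by (simp add: i_def)
    define p' where "p' = Suc i"
    have x: "t (Suc p' + l) = t (i + 2 + l)" for l by (simp add: p'_def)
    have x0: "t (i + 2) = (\<not> c)" using last by (simp add: i_def k1)
    have "\<exists>k'\<ge>1. k' < k \<and> alt_pattern t (\<not> c) p' k'"
    proof (cases "j < 2*k1")
      case True
      then have "even j" using w[of j] j(3) by (cases "even j") auto
      then obtain k' where k': "j = 2 * k'" by blast
      have "j \<noteq> 0" using j(4) x0 by (cases "j = 0") auto
      have "t (Suc p' + l) = (if even l then \<not> c else \<not> \<not> c)" if "l < 2 * k'" for l
      proof -
        have "t (Suc p' + l) = t (i + 2 + l)" by (rule x)
        also have "\<dots> = t (i - 1 - l)" using j(2) that k' by simp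
        finally show ?thesis using w[of l] that True k' by simp
      qed
      then have "alt_pattern t (\<not> c) p' k'"
        unfolding alt_pattern_def using ti(2) j(4) by (simp add: p'_def k')
      then show ?thesis using \<open>j \<noteq> 0\<close> True k' k1 by (intro exI[of _ k']) auto
    next
      case False
      moreover have "j \<noteq> 2*k1" using w2 j(3) by auto
      ultimately have "2*k1 < j" by simp
      then have x2: "t (i + 2 + 2*k1) = c" using j(2) w2 by simp
      then have "k1 \<noteq> 0" using x0 by (cases "k1 = 0") auto
      have "t (Suc p' + l) = (if even l then \<not> c else \<not> \<not> c)" if "l < 2 * k1" for l
      proof -
        have "t (Suc p' + l) = t (i + 2 + l)" by (rule x)
        also have "\<dots> = t (i - 1 - l)" using j(2) that \<open>2*k1 < j\<close> by simp
        finally show ?thesis using w[of l] that by simp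
      qed
      then have "alt_pattern t (\<not> c) p' k1"
        unfolding alt_pattern_def using ti(2) x2 by (simp add: p'_def)
      then show ?thesis using \<open>k1 \<noteq> 0\<close> k1 by (intro exI[of _ k1]) auto
    qed
    then show False using less.IH less.prems(1) by (metis \<open>i \<ge> K\<close> le_Suc_eq p'_def)
  qed
qed

text \<open>After a doubled c the letters alternate until the next doubled letter; if that were the
  negation of c, an \<open>alt_pattern\<close> would be complete. Without any doubled letter the
  word alternates and both choices of c are possible.\<close>

lemma markov_no_double:
  assumes mk: "markov N t K"
  shows "\<exists>c K'. K' \<ge> K \<and> (\<forall>q\<ge>K'. t q = c \<or> t (Suc q) = c)"
proof (cases "\<exists>p\<ge>K. t p = t (Suc p)")
  case True
  then obtain p where p: "p \<ge> K" "t p = t (Suc p)" by blast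
  define c where "c = t p"
  have inv: "\<exists>p'\<ge>K. \<exists>m. q = Suc p' + m \<and> t p' = c \<and> (\<forall>l\<le>m. t (Suc p' + l) = (if even l then c else \<not> c))"
    if "q \<ge> Suc p" for q
    using that
  proof (induction q rule: dec_induct)
    case base
    show ?case using p by (intro exI[of _ p] conjI exI[of _ 0]) (simp_all add: c_def)
  next
    case (step q)
    then obtain p' m where p': "p' \<ge> K" "q = Suc p' + m" "t p' = c"
      "\<forall>l\<le>m. t (Suc p' + l) = (if even l then c else \<not> c)" by blast
    show ?case
    proof (cases "t (Suc q) = (if even (Suc m) then c else \<not> c)")
      case True
      then show ?thesis using p' by (intro exI[of _ p'] conjI exI[of _ "Suc m"]) (simp_all add: le_Suc_eq)
    next
      case False
      show ?thesis
      proof (cases "even m")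
        case True
        then have "t q = c" using p'(4)[rule_format, of m] p'(2) by simp
        moreover have "t (Suc q) = c" using False True by auto
        ultimately show ?thesis using p'(1,2) by (intro exI[of _ q] conjI exI[of _ 0]) simp_all
      next
        case odd: False
        then obtain k where k: "m = 2 * k + 1" by (rule oddE)
        have "t (Suc q) = (\<not> c)" using False odd by auto
        moreover have "Suc q = Suc p' + 2 * Suc k" using p'(2) k by simp
        ultimately have "t (Suc p' + 2 * Suc k) = (\<not> c)" by metis
        then have "alt_pattern t c p' (Suc k)"
          unfolding alt_pattern_def using p'(3,4) k by simp
        then show ?thesis using no_alt_pattern[OF mk \<open>p' \<ge> K\<close>, of "Suc k"] by simp
      qed
    qed
  qed
  have "t q = c \<or> t (Suc q) = c" if q: "q \<ge> Suc p" for q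
  proof -
    obtain p' m where p': "p' \<ge> K" "q = Suc p' + m" "t p' = c"
      "\<forall>l\<le>m. t (Suc p' + l) = (if even l then c else \<not> c)" using inv[OF q] by blast
    show ?thesis
    proof (cases "even m")
      case True
      then show ?thesis using p'(4)[rule_format, of m] p'(2) by simp
    next
      case odd: False
      then obtain k where k: "m = 2 * k + 1" by (rule oddE)
      show ?thesis
      proof (rule ccontr)
        assume "\<not> ?thesis"
        then have "t (Suc q) = (\<not> c)" by blast
        moreover have "Suc q = Suc p' + 2 * Suc k" using p'(2) k by simp
        ultimately have "t (Suc p' + 2 * Suc k) = (\<not> c)" by metis
        then have "alt_pattern t c p' (Suc k)"
          unfolding alt_pattern_def using p'(3,4) k by simp
        then show False using no_alt_pattern[OF mk \<open>p' \<ge> K\<close>, of "Suc k"] by simp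
      qed
    qed
  qed
  then show ?thesis using p(1) by (intro exI[of _ c] exI[of _ "Suc p"] conjI allI impI) simp_all
next
  case False
  then have "t q = True \<or> t (Suc q) = True" if "q \<ge> K" for q using that by blast
  then show ?thesis by blast
qed

section \<open>Grouping a word around its isolated letter\<close>

locale coarsening =
  fixes t :: "nat \<Rightarrow> bool" and c :: bool and p :: "nat \<Rightarrow> nat"
  assumes start: "t (p 0) = c"
    and no_double: "\<And>q. q \<ge> p 0 \<Longrightarrow> t q = c \<or> t (Suc q) = c"
    and p_Suc: "\<And>i. p (Suc i) = (if t (Suc (p i)) = c then Suc (p i) else Suc (Suc (p i)))"
begin

text \<open>Each group starts with c at \<open>p i\<close> and is c alone or c with its negation.
  The next letter tells which, and as the name of the group it is also the last letter of the
  group.\<close>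

definition t' :: "nat \<Rightarrow> bool" where "t' i = t (Suc (p i))"

lemma p_ge: "p i \<ge> p 0 + i"
  by (induction i) (auto simp: p_Suc)

lemma t_p: "t (p i) = c"
proof (induction i)
  case (Suc i)
  have "t (Suc (p i)) = c \<or> t (Suc (Suc (p i))) = c" using no_double[of "Suc (p i)"] p_ge[of i] by simp
  then show ?case by (auto simp: p_Suc)
qed (rule start)

lemma t_before_p: "t (p (Suc i) - 1) = t' i"
  using t_p[of i] by (auto simp: p_Suc t'_def)

text \<open>The letter before a group names the group to its left, the letter after a group's c
  names that group itself. Hence matching groups match letter by letter over equal lengths, once the
  c at \<open>p i\<close> is paired with the c at \<open>p (i + 2)\<close>.\<close>

lemma aligned:
  assumes "j \<le> i" "\<forall>l<j. t' (i - 1 - l) = t' (i + 2 + l)"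
  shows "\<exists>d\<ge>j. p i = p (i - j) + d \<and> p (i + 2 + j) = p (i + 2) + d \<and> (\<forall>l\<le>d. t (p i - l) = t (p (i + 2) + l))"
  using assms
proof (induction j)
  case 0
  then show ?case by (auto simp: t_p)
next
  case (Suc j)
  then obtain d where d: "d \<ge> j" "p i = p (i - j) + d" "p (i + 2 + j) = p (i + 2) + d"
    "\<forall>l\<le>d. t (p i - l) = t (p (i + 2) + l)" by auto
  define m where "m = i - Suc j"
  have m: "i - j = Suc m" "i - 1 - j = m" using Suc.prems by (auto simp: m_def)
  have eq: "t' m = t' (i + 2 + j)" using Suc.prems(2) m by auto
  have d1: "t (p i - Suc d) = t (p (i + 2) + Suc d)"
    using t_before_p[of m] d m eq by (simp add: t'_def)
  show ?case
  proof (cases "t' m = c")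
    case True
    then have "p (Suc m) = Suc (p m)" "p (Suc (i + 2 + j)) = Suc (p (i + 2 + j))"
      using eq by (simp_all add: p_Suc t'_def)
    then show ?thesis using d m d1
      by (intro exI[of _ "Suc d"]) (auto simp: le_Suc_eq m_def)
  next
    case False
    then have p: "p (Suc m) = Suc (Suc (p m))" "p (Suc (i + 2 + j)) = Suc (Suc (p (i + 2 + j)))"
      using eq by (simp_all add: p_Suc t'_def)
    then have "t (p i - Suc (Suc d)) = t (p (i + 2) + Suc (Suc d))"
      using t_p[of m] t_p[of "Suc (i + 2 + j)"] d m by simp
    then show ?thesis using d m d1 p
      by (intro exI[of _ "Suc (Suc d)"]) (auto simp: le_Suc_eq m_def)
  qed
qed

text \<open>A change of \<open>t'\<close> at i is a change of t at \<open>Suc (p i)\<close>. The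
  pair of letters c at \<open>p i\<close> and \<open>p (i + 2)\<close> matches without costing a
  group, so the letter mismatch is at J = d + 1 with d >= j, and j < N.\<close>

lemma markov_coarser:
  assumes mk: "markov (Suc N) t K" and "K \<le> p 0"
  shows "markov N t' (Suc N)"
  unfolding markov_def
proof (intro allI impI)
  fix i assume i: "Suc N \<le> i" and ne: "t' i \<noteq> t' (Suc i)"
  define I where "I = Suc (p i)"
  have tI: "t I = t' i" by (simp add: I_def t'_def)
  have tSI: "t (Suc I) = t' (Suc i)" 
    using ne t_p[of "Suc i"] by (cases "t' i = c") (auto simp: I_def t'_def p_Suc)
  have p2: "p (i + 2) = I + 2" using ne by (auto simp: I_def t'_def p_Suc)
  have "I \<ge> K" using p_ge[of i] \<open>K \<le> p 0\<close> by (simp add: I_def)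
  moreover have "t I \<noteq> t (Suc I)" using ne tI tSI by simp
  ultimately obtain J where J: "J < Suc N" "\<forall>l<J. t (I - 1 - l) = t (I + 2 + l)" "t (I - 1 - J) = t (Suc I)" "t (I + 2 + J) = t I"
    using mk[unfolded markov_def, rule_format, of I] by blast
  have J': "\<forall>l<J. t (p i - l) = t (p (i + 2) + l)" "t (p i - J) = t' (Suc i)" "t (p (i + 2) + J) = t' i"
    using J p2 tI tSI by (simp_all add: I_def)
  have "\<exists>j<N. t' (i - 1 - j) \<noteq> t' (i + 2 + j)"
  proof (rule ccontr)
    assume "\<not> ?thesis"
    then obtain d where "d \<ge> N" "\<forall>l\<le>d. t (p i - l) = t (p (i + 2) + l)" using aligned[of N i] i by auto
    then have "t (p i - J) = t (p (i + 2) + J)" using J(1) by auto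
    then show False using J' ne by simp
  qed
  then obtain j0 where j0: "j0 < N" "t' (i - 1 - j0) \<noteq> t' (i + 2 + j0)" by blast
  define j where "j = (LEAST j. t' (i - 1 - j) \<noteq> t' (i + 2 + j))"
  have "t' (i - 1 - j) \<noteq> t' (i + 2 + j)"
    unfolding j_def using j0(2) by (rule LeastI)
  moreover have "j \<le> j0" unfolding j_def using j0(2) by (rule Least_le)
  moreover have "\<forall>l<j. t' (i - 1 - l) = t' (i + 2 + l)"
    unfolding j_def using not_less_Least by blast
  ultimately have j: "j < N" "t' (i - 1 - j) \<noteq> t' (i + 2 + j)" "\<forall>l<j. t' (i - 1 - l) = t' (i + 2 + l)"
    using j0(1) by auto
  obtain d where d: "p i = p (i - j) + d" "p (i + 2 + j) = p (i + 2) + d" "\<forall>l\<le>d. t (p i - l) = t (p (i + 2) + l)"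
    using aligned[of j i] j(1,3) i by auto
  have "i - j = Suc (i - 1 - j)" using j(1) i by simp
  then have w: "t (p i - Suc d) = t' (i - 1 - j)" using t_before_p[of "i - 1 - j"] d by simp
  have x: "t (p (i + 2) + Suc d) = t' (i + 2 + j)" using d by (simp add: t'_def)
  have "J = Suc d"
  proof (rule antisym)
    show "J \<le> Suc d"
    proof (rule ccontr)
      assume "\<not> ?thesis"
      then have "t (p i - Suc d) = t (p (i + 2) + Suc d)" using J'(1) not_le by blast
      then show False using w x j(2) by metis
    qed
    show "Suc d \<le> J"
    proof (rule ccontr)
      assume "\<not> ?thesis"
      then have "J \<le> d" by simp
      then have "t (p i - J) = t (p (i + 2) + J)" using d(3) by blast
      then show False using J'(2,3) ne by metis
    qed
  qed
  then show "\<exists>j<N. j < i \<and> (\<forall>l<j. t' (i - 1 - l) = t' (i + 2 + l)) \<and> t' (i - 1 - j) = t' (Suc i) \<and> t' (i + 2 + j) = t' i"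
    using j(1,3) i w x J'(2,3) by (intro exI[of _ j] conjI) auto
qed

end

section \<open>Contractions and backward orbits\<close>

definition contr_on :: "real set \<Rightarrow> (real \<Rightarrow> real) \<Rightarrow> bool" where
  "contr_on I f \<longleftrightarrow> (\<forall>a\<in>I. f a \<in> I) \<and> (\<forall>a\<in>I. \<forall>b\<in>I. \<bar>f a - f b\<bar> \<le> \<bar>a - b\<bar> / 2)"

lemma contr_on_comp: "contr_on I f \<Longrightarrow> contr_on I g \<Longrightarrow> contr_on I (f \<circ> g)"
  unfolding contr_on_def comp_def
proof (intro conjI ballI; elim conjE)
  fix a b
  assume f: "\<forall>a\<in>I. \<forall>b\<in>I. \<bar>f a - f b\<bar> \<le> \<bar>a - b\<bar> / 2"
    and g: "\<forall>a\<in>I. g a \<in> I" "\<forall>a\<in>I. \<forall>b\<in>I. \<bar>g a - g b\<bar> \<le> \<bar>a - b\<bar> / 2"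
    and ab: "a \<in> I" "b \<in> I"
  have "\<bar>f (g a) - f (g b)\<bar> \<le> \<bar>g a - g b\<bar> / 2" "\<bar>g a - g b\<bar> \<le> \<bar>a - b\<bar> / 2"
    using f g ab by blast+
  moreover have "u \<le> w / 2" if "u \<le> v / 2" "v \<le> w / 2" "0 \<le> w" for u v w :: real
    using that by linarith
  ultimately show "\<bar>f (g a) - f (g b)\<bar> \<le> \<bar>a - b\<bar> / 2" using abs_ge_zero by blast
qed blast

lemma finite_fixed_points:
  assumes "contr_on I f"
  shows "finite {u\<in>I. f u = u}"
proof -
  have "u = v" if "u \<in> I" "v \<in> I" "f u = u" "f v = v" for u v
  proof -
    have "\<bar>f u - f v\<bar> \<le> \<bar>u - v\<bar> / 2" using assms that(1,2) unfolding contr_on_def by blast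
    then show ?thesis using that by simp
  qed
  then have "{u\<in>I. f u = u} \<subseteq> {THE u. u \<in> I \<and> f u = u}"
    by (smt (verit, best) mem_Collect_eq singletonI subsetI the_equality)
  then show ?thesis by (rule finite_subset) simp
qed

text \<open>\<open>z K\<close> results from applying f arbitrarily often inside the interval, so
  \<open>z K\<close> and \<open>z (Suc K)\<close> differ by at most (b - a) / 2^n for every
  n.\<close>

lemma backward_orbit_fixed:
  assumes f: "contr_on {a..b} f" and z: "\<And>i. i \<ge> K \<Longrightarrow> z i = f (z (Suc i))" "\<And>i. z i \<in> {a..b}"
  shows "f (z K) = z K"
proof -
  have "\<bar>z i - z (Suc i)\<bar> \<le> (b - a) / 2 ^ n" if "i \<ge> K" for i n
    using that
  proof (induction n arbitrary: i)
    case 0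
    show ?case using z(2)[of i] z(2)[of "Suc i"] by auto
  next
    case (Suc n)
    have zi: "z i = f (z (Suc i))" using Suc.prems by (rule z(1))
    have zSi: "z (Suc i) = f (z (Suc (Suc i)))" using Suc.prems by (intro z(1)) simp
    have "\<bar>f (z (Suc i)) - f (z (Suc (Suc i)))\<bar> \<le> \<bar>z (Suc i) - z (Suc (Suc i))\<bar> / 2"
      using f z(2)[of "Suc i"] z(2)[of "Suc (Suc i)"] unfolding contr_on_def by blast
    then have "\<bar>z i - z (Suc i)\<bar> \<le> \<bar>z (Suc i) - z (Suc (Suc i))\<bar> / 2"
      by (subst zi, subst zSi)
    moreover have "\<bar>z (Suc i) - z (Suc (Suc i))\<bar> / 2 \<le> (b - a) / 2 ^ n / 2"
      using Suc.IH[of "Suc i"] Suc.prems by (intro divide_right_mono) simp_all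
    ultimately have "\<bar>z i - z (Suc i)\<bar> \<le> (b - a) / 2 ^ n / 2" by (rule order_trans)
    then show ?case by (simp add: mult.commute)
  qed
  then have "\<bar>z K - z (Suc K)\<bar> \<le> (b - a) / 2 ^ n" for n by simp
  then have le: "\<bar>z K - z (Suc K)\<bar> \<le> (b - a) * (1 / 2) ^ n" for n
    by (simp only: power_one_over times_divide_eq_right mult_1_right)
  have "(\<lambda>n. (b - a) * (1 / 2) ^ n) \<longlonglongrightarrow> (b - a) * 0"
    by (intro tendsto_mult_left LIMSEQ_power_zero) simp
  then have "\<bar>z K - z (Suc K)\<bar> \<le> (b - a) * 0"
    by (rule LIMSEQ_le_const) (intro exI[of _ 0] allI impI le)
  then have "z K = z (Suc K)" by simp
  then show ?thesis using z(1)[of K] by simp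
qed

text \<open>Z serves all words at once. Meeting it at a single index is enough, because the Lagrange
  number is constant along an orbit.\<close>

definition captures :: "nat \<Rightarrow> real set \<Rightarrow> (bool \<Rightarrow> real \<Rightarrow> real) \<Rightarrow> real set \<Rightarrow> bool" where
  "captures N I P Z \<longleftrightarrow> finite Z \<and> (\<forall>t z K. markov N t K \<longrightarrow> (\<forall>i. z i = P (t i) (z (Suc i))) \<longrightarrow>
     (\<forall>i. z i \<in> I) \<longrightarrow> (\<exists>i. z i \<in> Z))"

lemma capturesD:
  assumes "captures N I P Z" "markov N t K" "\<And>i. z i = P (t i) (z (Suc i))" "\<And>i. z i \<in> I"
  shows "\<exists>i. z i \<in> Z"
  using assms(1)[unfolded captures_def] assms(2-4) by blast

lemma captures_const:
  assumes contr: "\<And>b. contr_on {a1..a2} (P b)"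
  shows "captures 0 {a1..a2} P (\<Union>b. {u\<in>{a1..a2}. P b u = u})"
proof -
  have "finite (\<Union>b. {u\<in>{a1..a2}. P b u = u})"
    using finite_fixed_points[OF contr] by (intro finite_UN_I) simp_all
  moreover have "\<exists>i. z i \<in> (\<Union>b. {u\<in>{a1..a2}. P b u = u})"
    if mk: "markov 0 t K" and z: "\<forall>i. z i = P (t i) (z (Suc i))" "\<forall>i. z i \<in> {a1..a2}" for t z K
  proof -
    have const: "t i = t K" if "i \<ge> K" for i
      using that
    proof (induction i rule: dec_induct)
      case (step n)
      then show ?case using mk[unfolded markov_def, rule_format, of n] by blast
    qed simp
    have "z i = P (t K) (z (Suc i))" if "i \<ge> K" for i using z(1)[rule_format, of i] const[OF that] by simp
    then have "P (t K) (z K) = z K"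
      using z(2)[rule_format] by (rule backward_orbit_fixed[OF contr])
    then have "z K \<in> {u\<in>{a1..a2}. P (t K) u = u}" using z(2) by blast
    then show ?thesis by blast
  qed
  ultimately show ?thesis unfolding captures_def by blast
qed

text \<open>The maps P vary in the induction: after grouping, the letters act by \<open>P c\<close>
  and \<open>P c \<circ> P (\<not> c)\<close>, which are contractions again, and the bound has
  dropped by one.\<close>

lemma markov_captured:
  fixes P :: "bool \<Rightarrow> real \<Rightarrow> real"
  assumes "\<And>b. contr_on {a1..a2} (P b)"
  shows "\<exists>Z. captures N {a1..a2} P Z"
  using assms
proof (induction N arbitrary: P)
  case 0
  then show ?case using captures_const by blast
next
  case (Suc N P)
  define Q where "Q c b = (if b = c then P c else P c \<circ> P (\<not> c))" for c b
  have "contr_on {a1..a2} (Q c b)" for c b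
    unfolding Q_def using Suc.prems contr_on_comp[OF Suc.prems Suc.prems] by simp
  then have "\<forall>c. \<exists>Z. captures N {a1..a2} (Q c) Z" by (intro allI Suc.IH)
  from choice[OF this] obtain Z where Z: "\<And>c. captures N {a1..a2} (Q c) (Z c)" by blast
  have "\<exists>i. z i \<in> (\<Union>c. Z c)"
    if mk: "markov (Suc N) t K" and z: "\<forall>i. z i = P (t i) (z (Suc i))" "\<forall>i. z i \<in> {a1..a2}" for t z K
  proof -
    obtain c K' where cK: "K' \<ge> K" "\<forall>q\<ge>K'. t q = c \<or> t (Suc q) = c" using markov_no_double[OF mk] by blast
    obtain p0 where p0: "p0 \<ge> K'" "t p0 = c"
    proof (cases "t K' = c")
      case False
      then have "t (Suc K') = c" using cK(2) by blast
      then show thesis using that[of "Suc K'"] by simp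
    qed (use that[of K'] in simp)
    define p where "p = rec_nat p0 (\<lambda>i q. if t (Suc q) = c then Suc q else Suc (Suc q))"
    have p: "p 0 = p0" "p (Suc i) = (if t (Suc (p i)) = c then Suc (p i) else Suc (Suc (p i)))" for i
      by (simp_all add: p_def)
    interpret coarsening t c p
    proof
      show "t (p 0) = c" using p(1) p0 by simp
      show "t q = c \<or> t (Suc q) = c" if "q \<ge> p 0" for q using cK(2) that p(1) p0(1) by simp
      show "p (Suc i) = (if t (Suc (p i)) = c then Suc (p i) else Suc (Suc (p i)))" for i by (rule p(2))
    qed
    have "markov N t' (Suc N)" using markov_coarser[OF mk] p(1) p0(1) cK(1) by simp
    moreover have "z (p i) = Q c (t' i) (z (p (Suc i)))" for i
    proof -
      have 1: "z (p i) = P c (z (Suc (p i)))" using z(1)[rule_format, of "p i"] t_p[of i] by simp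
      show ?thesis
      proof (cases "t (Suc (p i)) = c")
        case True
        then show ?thesis using 1 by (simp add: Q_def t'_def p(2))
      next
        case False
        then have "t (Suc (p i)) = (\<not> c)" by blast
        then have "z (Suc (p i)) = P (\<not> c) (z (Suc (Suc (p i))))" using z(1)[rule_format, of "Suc (p i)"] by simp
        then show ?thesis using 1 False by (simp add: Q_def t'_def p(2))
      qed
    qed
    ultimately have "\<exists>i. z (p i) \<in> Z c" using z(2)[rule_format] by (rule capturesD[OF Z])
    then show ?thesis by blast
  qed
  note caught = this
  have "finite (Z c)" for c using Z[of c] unfolding captures_def by blast
  then have "finite (\<Union>c. Z c)" by (intro finite_UN_I) simp_all
  then have "captures (Suc N) {a1..a2} P (\<Union>c. Z c)"
    unfolding captures_def using caught by blast
  then show ?case by (rule exI)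
qed

section \<open>Finiteness of the spectrum below 2\<close>

lemma blk_pos: "a > 0 \<Longrightarrow> blk b a > 0"
  by (cases b) (simp_all add: dig_pos)

lemma blk_mono: "a > 0 \<Longrightarrow> a' > 0 \<Longrightarrow> blk b a < blk b a' \<longleftrightarrow> a < a'"
  by (cases b) (simp_all add: dig_mono dig_pos)

lemma blk_range:
  assumes "a > 0"
  shows "blk False a < 1" "blk True a > 1" "blk b a \<in> {1/2..3/2}"
proof -
  show 1: "blk False a < 1" using assms by (simp add: dig_range)
  show 2: "blk True a > 1" using assms by (simp add: dig_range dig_pos)
  have "blk True a < 3 / 2" using dig_range(4)[OF assms] by (simp add: dig.simps(1))
  then show "blk b a \<in> {1/2..3/2}" using 1 2 dig_range(2)[OF assms] by (cases b) auto
qed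

lemma contr_on_blk: "contr_on {1/2..3/2} (blk b)"
  unfolding contr_on_def
proof (intro conjI ballI)
  fix a :: real assume "a \<in> {1/2..3/2}"
  then show "blk b a \<in> {1/2..3/2}" by (intro blk_range) simp
next
  fix a a' :: real assume a: "a \<in> {1/2..3/2}" "a' \<in> {1/2..3/2}"
  define den where "den = (if b then (2 * a + 1) * (2 * a' + 1) else 2 * ((a + 1) * (a' + 1)))"
  have "1 * 1 \<le> (a + 1) * (a' + 1)" "2 * 1 \<le> (2 * a + 1) * (2 * a' + 1)"
    using a by (intro mult_mono; simp)+
  then have den: "den \<ge> 2" unfolding den_def by (cases b) auto
  have nz: "2 * a + 2 \<noteq> 0" "2 * a' + 2 \<noteq> 0" "2 * a + 1 \<noteq> 0" "2 * a' + 1 \<noteq> 0" using a by auto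
  have "blk b a - blk b a' = (a - a') / den"
  proof (cases b)
    case True
    have "a / (2 * a + 1) - a' / (2 * a' + 1) = (a * (2 * a' + 1) - a' * (2 * a + 1)) / ((2 * a + 1) * (2 * a' + 1))"
      using nz by (simp add: diff_frac_eq)
    also have "a * (2 * a' + 1) - a' * (2 * a + 1) = a - a'" by (simp add: algebra_simps)
    finally show ?thesis using True by (simp add: den_def dig.simps)
  next
    case False
    have "(2 * a + 1) / (2 * a + 2) - (2 * a' + 1) / (2 * a' + 2) =
        ((2 * a + 1) * (2 * a' + 2) - (2 * a' + 1) * (2 * a + 2)) / ((2 * a + 2) * (2 * a' + 2))"
      using nz by (simp add: diff_frac_eq)
    also have "(2 * a + 1) * (2 * a' + 2) - (2 * a' + 1) * (2 * a + 2) = 2 * (a - a')" by (simp add: algebra_simps)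
    also have "(2 * a + 2) * (2 * a' + 2) = 2 * (2 * ((a + 1) * (a' + 1)))" by (simp add: algebra_simps)
    also have "2 * (a - a') / (2 * (2 * ((a + 1) * (a' + 1)))) = (a - a') / (2 * ((a + 1) * (a' + 1)))"
      by (rule mult_divide_mult_cancel_left) simp
    finally show ?thesis using False by (simp add: den_def dig.simps)
  qed
  then have "\<bar>blk b a - blk b a'\<bar> = \<bar>a - a'\<bar> / den" using den by (simp add: abs_divide)
  also have "\<dots> \<le> \<bar>a - a'\<bar> / 2" using den by (intro divide_left_mono) auto
  finally show "\<bar>blk b a - blk b a'\<bar> \<le> \<bar>a - a'\<bar> / 2" .
qed

lemma blocksD:
  assumes "blocks c t z g"
  shows "z i > 0" "g i > 0" "z i = blk (t i) (z (Suc i))" "g (Suc i) = blk (t i) (g i)"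
    "\<not> t i \<Longrightarrow> t (Suc i) \<Longrightarrow> z (Suc (Suc i)) < c * g i"
    "t i \<Longrightarrow> \<not> t (Suc i) \<Longrightarrow> g i < c * z (Suc (Suc i))"
  using assms unfolding blocks_def by blast+

lemma blocks_range:
  assumes "blocks c t z g"
  shows "z i \<in> {1/2..3/2}" "g (Suc i) \<in> {1/2..3/2}"
  using blk_range(3)[of "z (Suc i)" "t i"] blk_range(3)[of "g i" "t i"] blocksD[OF assms] by metis+

text \<open>A letter common to both sides is one increasing map and can be stripped from the
  comparison.\<close>

lemma blocks_compare:
  assumes b: "blocks c t z g"
  shows "j \<le> m \<Longrightarrow> \<forall>l<j. t (m - 1 - l) = t (k + l) \<Longrightarrow> (z k < g m \<longleftrightarrow> z (k + j) < g (m - j))"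
proof (induction j)
  case (Suc j)
  define q where "q = m - Suc j"
  have q: "m - j = Suc q" "m - 1 - j = q" using Suc.prems(1) by (auto simp: q_def)
  have "t q = t (k + j)" using Suc.prems(2) q by auto
  then have "z (k + j) < g (Suc q) \<longleftrightarrow> blk (t q) (z (Suc (k + j))) < blk (t q) (g q)"
    using blocksD(3)[OF b, of "k + j"] blocksD(4)[OF b, of q] by simp
  also have "\<dots> \<longleftrightarrow> z (Suc (k + j)) < g q" by (intro blk_mono blocksD[OF b])
  finally have "z (k + j) < g (Suc q) \<longleftrightarrow> z (Suc (k + j)) < g q" .
  then show ?case using Suc q by (simp add: q_def)
qed simp

text \<open>Each common letter halves the distance. \<open>j < m\<close> keeps the index of g
  positive, where its values are known to lie in [1/2, 3/2].\<close>

lemma blocks_close: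
  assumes b: "blocks c t z g"
  shows "j < m \<Longrightarrow> \<forall>l<j. t (m - 1 - l) = t (k + l) \<Longrightarrow> \<bar>z k - g m\<bar> \<le> \<bar>z (k + j) - g (m - j)\<bar> / 2 ^ j"
proof (induction j)
  case (Suc j)
  define q where "q = m - Suc (Suc j)"
  have q: "m - j = Suc (Suc q)" "m - Suc j = Suc q" using Suc.prems(1) by (auto simp: q_def)
  have eq: "t (Suc q) = t (k + j)" using Suc.prems(2) q by auto
  have "\<bar>z k - g m\<bar> \<le> \<bar>z (k + j) - g (Suc (Suc q))\<bar> / 2 ^ j" using Suc q by auto
  also have "\<bar>z (k + j) - g (Suc (Suc q))\<bar> \<le> \<bar>z (Suc (k + j)) - g (Suc q)\<bar> / 2"
  proof -
    have "\<bar>blk (t (Suc q)) (z (Suc (k + j))) - blk (t (Suc q)) (g (Suc q))\<bar> \<le> \<bar>z (Suc (k + j)) - g (Suc q)\<bar> / 2"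
      using contr_on_blk blocks_range[OF b] unfolding contr_on_def by blast
    then show ?thesis
      using blocksD(3)[OF b, of "k + j"] blocksD(4)[OF b, of "Suc q"] eq by simp
  qed
  finally show ?case using q by (simp add: divide_right_mono)
qed simp

text \<open>At a change, \<open>z (i + 2)\<close> and \<open>g i\<close> are a factor c < 1 apart,
  hence more than (1 - c) / 2, and by contraction they cannot share N letters. Monotonicity decides
  the first mismatch, since \<open>LR\<close> has values above 1 and \<open>S\<close> below.\<close>

lemma blocks_markov:
  assumes b: "blocks c t z g" and "c < 1" and N: "2 / 2 ^ N < 1 - c"
  shows "markov N t (Suc N)"
  unfolding markov_def
proof (intro allI impI)
  fix i assume i: "Suc N \<le> i" and ne: "t i \<noteq> t (Suc i)"
  define k where "k = Suc (Suc i)"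
  note D = blocksD[OF b] and R = blocks_range[OF b]
  have g: "g (i - j) \<in> {1/2..3/2}" if "j \<le> N" for j
    using R(2)[of "i - j - 1"] that i by (simp add: Suc_diff_Suc)
  have far: "(1 - c) / 2 < \<bar>z k - g i\<bar>"
  proof (cases "t i")
    case False
    then have "z k < c * g i" using D(5)[of i] ne by (simp add: k_def)
    moreover have "(1 - c) * (1 / 2) \<le> (1 - c) * g i" using g[of 0] \<open>c < 1\<close> by (intro mult_left_mono) auto
    moreover have "(1 - c) * g i = g i - c * g i" by (simp add: algebra_simps)
    ultimately show ?thesis by linarith
  next
    case True
    then have "g i < c * z k" using D(6)[of i] ne by (simp add: k_def)
    moreover have "(1 - c) * (1 / 2) \<le> (1 - c) * z k" using R(1)[of k] \<open>c < 1\<close> by (intro mult_left_mono) auto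
    moreover have "(1 - c) * z k = z k - c * z k" by (simp add: algebra_simps)
    ultimately show ?thesis by linarith
  qed
  have "\<exists>j<N. t (i - 1 - j) \<noteq> t (k + j)"
  proof (rule ccontr)
    assume "\<not> ?thesis"
    then have "\<bar>z k - g i\<bar> \<le> \<bar>z (k + N) - g (i - N)\<bar> / 2 ^ N" using i by (intro blocks_close[OF b]) auto
    also have "\<dots> \<le> 1 / 2 ^ N" using R(1)[of "k + N"] g[of N] by (intro divide_right_mono) auto
    finally show False using far N by simp
  qed
  then obtain j0 where j0: "j0 < N" "t (i - 1 - j0) \<noteq> t (k + j0)" by blast
  define j where "j = (LEAST j. t (i - 1 - j) \<noteq> t (k + j))"
  have j: "t (i - 1 - j) \<noteq> t (k + j)" unfolding j_def using j0(2) by (rule LeastI)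
  have "j \<le> j0" unfolding j_def using j0(2) by (rule Least_le)
  then have "j < N" using j0(1) by simp
  have agree: "\<forall>l<j. t (i - 1 - l) = t (k + l)" unfolding j_def using not_less_Least by blast
  have cmp: "z k < g i \<longleftrightarrow> z (k + j) < g (i - j)" using agree \<open>j < N\<close> i by (intro blocks_compare[OF b]) auto
  define q where "q = i - 1 - j"
  have q: "i - j = Suc q" using \<open>j < N\<close> i by (simp add: q_def)
  have zk: "z (k + j) = blk (t (k + j)) (z (Suc (k + j)))" by (rule D)
  have gq: "g (Suc q) = blk (t q) (g q)" by (rule D)
  have "t q = t (Suc i) \<and> t (k + j) = t i"
  proof (cases "t i")
    case False
    then have "z k < c * g i" using D(5)[of i] ne by (simp add: k_def)
    also have "\<dots> < g i" using \<open>c < 1\<close> D(2)[of i] by simp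
    finally have lt: "z (k + j) < g (Suc q)" using cmp q by simp
    have "\<not> t (k + j)"
    proof
      assume "t (k + j)"
      then have "\<not> t q" using j by (simp add: q_def)
      then show False using lt zk gq \<open>t (k + j)\<close> blk_range(1)[OF D(2), of q] blk_range(2)[OF D(1), of "Suc (k + j)"] by simp
    qed
    then show ?thesis using j False ne by (auto simp: q_def)
  next
    case True
    then have "g i < c * z k" using D(6)[of i] ne by (simp add: k_def)
    also have "\<dots> < z k" using \<open>c < 1\<close> D(1)[of k] by simp
    finally have lt: "\<not> z (k + j) < g (Suc q)" using cmp q by simp
    have "t (k + j)"
    proof (rule ccontr)
      assume "\<not> t (k + j)"
      then have "t q" using j by (simp add: q_def)
      then show False using lt zk gq \<open>\<not> t (k + j)\<close> blk_range(2)[OF D(2), of q] blk_range(1)[OF D(1), of "Suc (k + j)"] by simp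
    qed
    then show ?thesis using j True ne by (auto simp: q_def)
  qed
  then show "\<exists>j<N. j < i \<and> (\<forall>l<j. t (i - 1 - l) = t (i + 2 + l)) \<and> t (i - 1 - j) = t (Suc i) \<and> t (i + 2 + j) = t i"
    using agree \<open>j < N\<close> i by (intro exI[of _ j]) (auto simp: q_def k_def)
qed

text \<open>With c = 1 - 2 e the mismatch bound N depends on e alone. The points 1 / (2 z) are added
  because \<open>narrow_blocks\<close> may have reflected the orbit.\<close>

lemma narrow_imp_catalogue:
  assumes "0 < e" "e \<le> 1"
  shows "\<exists>Z. finite Z \<and> (\<forall>s x y. narrow (2 - e) s x y \<longrightarrow> (\<exists>k. x k \<in> Z))"
proof -
  obtain N where N: "(1 / 2 :: real) ^ N < e" using real_arch_pow_inv[of e "1/2"] assms by auto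
  obtain Z where Z: "captures N {1/2..3/2} blk Z" using markov_captured[of "1/2" "3/2" blk N, OF contr_on_blk] by blast
  have "\<exists>k. x k \<in> Z \<union> (\<lambda>z. 1 / (2 * z)) ` Z" if nar: "narrow (2 - e) s x y" for s x y
  proof -
    obtain t z g where b: "blocks (1 - 2 * e) t z g" and zx: "\<forall>i. \<exists>k. z i = x k \<or> z i = 1 / (2 * x k)"
      using narrow_blocks[OF nar] assms by auto
    have "2 / 2 ^ N < 2 * e" using N by (simp add: power_one_over)
    then have "markov N t (Suc N)" using assms by (intro blocks_markov[OF b]) auto
    then obtain i where "z i \<in> Z"
      using capturesD[OF Z, of t "Suc N" z] blocksD(3)[OF b] blocks_range(1)[OF b] by blast
    moreover obtain k where "z i = x k \<or> z i = 1 / (2 * x k)" using zx by blast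
    then have "x k = z i \<or> x k = 1 / (2 * z i)" by auto
    ultimately have "x k \<in> Z \<union> (\<lambda>z. 1 / (2 * z)) ` Z" by (elim disjE) simp_all
    then show ?thesis by blast
  qed
  moreover have "finite (Z \<union> (\<lambda>z. 1 / (2 * z)) ` Z)" 
  proof -
    have "finite Z" using Z unfolding captures_def by blast
    then show ?thesis by simp
  qed
  ultimately show ?thesis by blast
qed

lemma finite_spectrum_below:
  assumes "0 < e" "e \<le> 1"
  shows "finite {l \<in> lagrange_spectrum. l < 2 - e}"
proof -
  obtain Z where Z: "finite Z" "\<And>s x y. narrow (2 - e) s x y \<Longrightarrow> \<exists>k. x k \<in> Z"
    using narrow_imp_catalogue[OF assms] by blast
  have "{l \<in> lagrange_spectrum. l < 2 - e} \<subseteq> insert 0 ((\<lambda>x. real_of_ereal (lagrange_number (circle_pt x))) ` Z)"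
  proof
    fix l assume l: "l \<in> {l \<in> lagrange_spectrum. l < 2 - e}"
    then obtain P where P: "P \<in> quarter_circle" "lagrange_number P = ereal l"
      by (auto simp: lagrange_spectrum_def)
    from P(1) show "l \<in> insert 0 ((\<lambda>x. real_of_ereal (lagrange_number (circle_pt x))) ` Z)"
    proof (cases rule: quarter_circle_cases)
      case 1
      then show ?thesis using P lagrange_number_vertical by (simp add: zero_ereal_def)
    next
      case (2 x0)
      show ?thesis
      proof (cases "x0 \<in> \<rat>")
        case True
        then show ?thesis using P 2 lagrange_number_rational by (simp add: zero_ereal_def)
      next
        case False
        then have "x0 \<noteq> 0" by auto
        then have "x0 > 0" using 2 by simp
        obtain s x y where o: "orbit s x y" "x 0 = x0" "y 0 = past0 x0"
          using irrational_orbit[OF \<open>x0 > 0\<close> False past0_pos] 2 by metis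
        have "finite {p \<in> pyth_pairs. ray_dist P p \<le> 1 / (2 - e)}"
          using l P assms by (intro lagrange_number_less_imp_finite) auto
        then have "few (x 0) (y 0) (1 / (2 - e))" using few_iff_ray_dist 2 o by simp
        then obtain K where K: "\<And>k v. k \<ge> K \<Longrightarrow> v \<in> coprime_pairs \<Longrightarrow> 1 / (2 - e) < qnorm (x k) (y k) v"
          using few_imp_eventually_large[OF o(1)] by blast
        \<comment> \<open>From K on, the values at both corners exceed 1 / (2 - e), which is the
          bound on the two widths.\<close>
        have nar: "narrow (2 - e) (\<lambda>k. s (k + K)) (\<lambda>k. x (k + K)) (\<lambda>k. y (k + K))"
          unfolding narrow_def
        proof (intro conjI allI)
          show "orbit (\<lambda>k. s (k + K)) (\<lambda>k. x (k + K)) (\<lambda>k. y (k + K))" using o(1) by (rule orbit_shift)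
          fix k
          define u w where "u = x (k + K)" and "w = y (k + K)"
          have "u > 0" "w > 0" unfolding u_def w_def by (rule orbitD[OF o(1)])+
          have "1 / (2 - e) < qnorm u w (1, 0)" "1 / (2 - e) < qnorm u w (0, 1)"
            unfolding u_def w_def by (intro K coprime_pairs_unit; simp)+
          then have 1: "1 / (2 - e) < 1 / (u + w)" and 2: "1 / (2 - e) < 2 * (u * w) / (u + w)"
            using \<open>u > 0\<close> \<open>w > 0\<close> by (simp_all add: qnorm_def wt_def abs_mult)
          have "u + w < 2 - e" using 1 \<open>u > 0\<close> \<open>w > 0\<close> assms by (simp add: field_simps)
          then show "x (k + K) + y (k + K) < 2 - e" by (simp only: u_def w_def)
          have "1 / (2 * u) + 1 / (2 * w) = (u + w) / (2 * (u * w))"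
            using \<open>u > 0\<close> \<open>w > 0\<close> by (simp add: field_simps)
          also have "\<dots> < 2 - e" using 2 \<open>u > 0\<close> \<open>w > 0\<close> assms by (simp add: field_simps)
          finally show "1 / (2 * x (k + K)) + 1 / (2 * y (k + K)) < 2 - e" by (simp add: u_def w_def)
        qed
        obtain k where "x (k + K) \<in> Z" using Z(2)[OF nar] by blast
        moreover have "lagrange_number (circle_pt (x (k + K))) = ereal l"
          using lagrange_number_orbit[OF o(1), of "k + K"] o(2) P 2 by simp
        then have "l = real_of_ereal (lagrange_number (circle_pt (x (k + K))))" by simp
        ultimately show ?thesis by blast
      qed
    qed
  qed
  then show ?thesis by (rule finite_subset) (simp add: Z)
qed

section \<open>Lagrange numbers approaching 2\<close>

declare blk.simps [simp del]

abbreviation U :: "real \<Rightarrow> real" where "U \<equiv> blk True"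

lemma U_eq: "U a = 1 + dig DR a"
  by (simp add: dig.simps(1) blk.simps)

lemma inverse_double_dig_S: "a > 0 \<Longrightarrow> 1 / (2 * dig DS a) = 1 - dig DR a"
  by (simp add: dig.simps divide_simps) (simp add: algebra_simps)

lemma funpow_U_pos: "a > 0 \<Longrightarrow> (U ^^ n) a > 0"
  by (induction n) (simp_all add: blk_pos)

lemma funpow_U_less:
  assumes "a > 0" "b > 0" "a < b"
  shows "(U ^^ n) a < (U ^^ n) b"
  using assms(3) by (induction n) (simp_all add: blk_mono funpow_U_pos assms)

lemma contr_on_S_U: "contr_on {1/2..3/2} (blk False \<circ> U ^^ n)"
proof (induction n)
  case (Suc n)
  have "blk False \<circ> U ^^ Suc n = (blk False \<circ> U ^^ n) \<circ> U"
    by (simp only: funpow_Suc_right comp_assoc)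
  then show ?case using contr_on_comp[OF Suc contr_on_blk] by metis
qed (use contr_on_blk[of False] in simp)

lemma funpow_U_close:
  assumes "a \<in> {1/2..3/2}" "b \<in> {1/2..3/2}"
  shows "(U ^^ n) a \<in> {1/2..3/2} \<and> (U ^^ n) b \<in> {1/2..3/2} \<and> \<bar>(U ^^ n) a - (U ^^ n) b\<bar> \<le> \<bar>a - b\<bar> / 2 ^ n"
proof (induction n)
  case (Suc n)
  then have 1: "U ((U ^^ n) a) \<in> {1/2..3/2}" "U ((U ^^ n) b) \<in> {1/2..3/2}"
    "\<bar>U ((U ^^ n) a) - U ((U ^^ n) b)\<bar> \<le> \<bar>(U ^^ n) a - (U ^^ n) b\<bar> / 2"
    using contr_on_blk[of True] unfolding contr_on_def by blast+
  have "\<bar>(U ^^ n) a - (U ^^ n) b\<bar> / 2 \<le> \<bar>a - b\<bar> / 2 ^ n / 2"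
    using Suc by (intro divide_right_mono) simp_all
  with 1(3) have "\<bar>U ((U ^^ n) a) - U ((U ^^ n) b)\<bar> \<le> \<bar>a - b\<bar> / 2 ^ n / 2" by (rule order_trans)
  then have "\<bar>U ((U ^^ n) a) - U ((U ^^ n) b)\<bar> \<le> \<bar>a - b\<bar> / 2 ^ Suc n" by (simp add: mult.commute)
  then show ?case using 1(1,2) by (simp del: power_Suc)
qed (use assms in simp)

text \<open>z has the periodic expansion with period S (LR)^(n+1); q and h below are its tails that
  begin n + 1 and n blocks \<open>LR\<close> before the next period.\<close>

locale periodic_word =
  fixes n :: nat and z :: real
  assumes z_range: "z \<in> {1/2..3/2}" and z_fixed: "z = dig DS ((U ^^ Suc n) z)"
begin

definition q :: real where "q = (U ^^ Suc n) z"
definition h :: real where "h = (U ^^ n) z"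
text \<open>The past of z in the two-sided periodic word: reflected, it reads (LR)^(n+1) S and so
  on, which is q by the symmetry of the blocks.\<close>

definition y :: real where "y = 1 / (2 * q)"

lemma pos: "z > 0" "q > 0" "h > 0" "y > 0"
proof -
  show "z > 0" using z_range by simp
  then show "q > 0" "h > 0" unfolding q_def h_def by (rule funpow_U_pos)+
  then show "y > 0" by (simp add: y_def)
qed

lemma past0_z: "past0 z > 0"
  using pos(1) by (intro past0_pos) simp

lemma z_eq: "z = dig DS q"
  unfolding q_def by (rule z_fixed)

lemma q_eq: "q = U h"
  by (simp add: q_def h_def)

lemma h_less_q: "h < q"
proof -
  have "z < 1" using dig_range(3)[OF pos(2)] z_eq by simp
  also have "1 < U z" using pos(1) by (rule blk_range)
  finally have "(U ^^ n) z < (U ^^ n) (U z)" using pos(1) blk_pos by (intro funpow_U_less)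
  then show ?thesis by (simp only: q_def h_def funpow_Suc_right comp_def)
qed

lemma q_minus_h: "q - h \<le> 1 / 2 ^ n"
proof -
  have Uz: "U z \<in> {1/2..3/2}" using pos(1) by (rule blk_range)
  have "\<bar>(U ^^ n) (U z) - (U ^^ n) z\<bar> \<le> \<bar>U z - z\<bar> / 2 ^ n"
    using funpow_U_close[OF Uz z_range] by blast
  also have "\<dots> \<le> 1 / 2 ^ n" using Uz z_range by (intro divide_right_mono) auto
  finally show ?thesis by (simp only: q_def h_def funpow_Suc_right comp_def)
qed

text \<open>The width 1 / (2 z) + 1 / (2 y) at the corner (0, 1), rewritten so that its distance
  from 2 is governed by q - h.\<close>

definition height :: real where "height = 2 - (dig DR q - dig DR h)"

lemma height_ge: "height \<ge> 2 - 1 / 2 ^ n"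
proof -
  have "dig DR q - dig DR h = U q - U h" by (simp add: U_eq)
  also have "\<dots> \<le> q - h"
  proof -
    have "q \<in> {1/2..3/2}" "h \<in> {1/2..3/2}"
      using funpow_U_close[OF z_range z_range] unfolding q_def h_def by blast+
    then have "\<bar>U q - U h\<bar> \<le> \<bar>q - h\<bar> / 2" using contr_on_blk[of True] unfolding contr_on_def by blast
    moreover have "\<bar>q - h\<bar> = q - h" using h_less_q by simp
    ultimately have "\<bar>U q - U h\<bar> \<le> (q - h) / 2" by metis
    then have "U q - U h \<le> (q - h) / 2" using abs_ge_self order_trans by blast
    also have "\<dots> \<le> q - h" using h_less_q by simp
    finally show ?thesis .
  qed
  finally show ?thesis using q_minus_h by (simp add: height_def)
qed

text \<open>Future and reflected past after i blocks \<open>LR\<close> of a period; i = 0 comes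
  right after an \<open>S\<close> and i = n + 1 right before the next.\<close>

definition fut :: "nat \<Rightarrow> real" where "fut i = (U ^^ (Suc n - i)) z"
definition pst :: "nat \<Rightarrow> real" where "pst i = (U ^^ i) z"

lemma fut_pst_pos: "fut i > 0" "pst i > 0"
  unfolding fut_def pst_def using pos(1) by (rule funpow_U_pos)+

lemma fut_step: "i \<le> n \<Longrightarrow> fut i = U (fut (Suc i))"
  by (simp add: fut_def Suc_diff_le)

lemma pst_step: "pst (Suc i) = U (pst i)"
  by (simp add: pst_def)

text \<open>Only the states next to an \<open>S\<close> are critical: there q = 1 + R h and 1 / (2
  z) = 1 - R q add up to 2 - (R q - R h). Elsewhere all values lie in (1, 3/2), and the sums stay
  below 3/2 + 1/2.\<close>

lemma state_bound:
  assumes "i \<le> Suc n"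
  shows "fut i + 1 / (2 * pst i) < 2" "1 / (2 * fut i) + pst i < 2"
proof -
  have ends: "fut 0 = q" "pst 0 = z" "fut (Suc n) = z" "pst (Suc n) = q"
    by (simp_all add: fut_def pst_def q_def)
  have q1: "q > 1" "q = 1 + dig DR h" using q_eq blk_range(2)[OF pos(3)] U_eq by simp_all
  have z1: "z < 1" "z > 1 / 2" using dig_range(2,3)[OF pos(2)] z_eq by simp_all
  have iz: "1 / (2 * z) = 1 - dig DR q" using inverse_double_dig_S[OF pos(2)] z_eq by simp
  have RR: "dig DR h < dig DR q" using dig_mono[OF pos(3,2), of DR] h_less_q by simp
  have iq: "1 / (2 * q) < 1 / 2" using q1 by simp
  consider "i = 0" | "i = Suc n" | "0 < i" "i \<le> n" using assms by linarith
  then have "fut i + 1 / (2 * pst i) < 2 \<and> 1 / (2 * fut i) + pst i < 2"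
  proof cases
    case 3
    then obtain j where j: "i = Suc j" by (cases i) auto
    have "fut i = 1 + dig DR (fut (Suc i))" using fut_step[OF 3(2)] U_eq by simp
    then have f: "fut i < 3 / 2" "fut i > 1"
      using dig_range(4)[OF fut_pst_pos(1), of "Suc i"] dig_pos[OF fut_pst_pos(1), of DR "Suc i"] by simp_all
    have "pst i = 1 + dig DR (pst j)" using pst_step[of j] U_eq j by simp
    then have p: "pst i < 3 / 2" "pst i > 1"
      using dig_range(4)[OF fut_pst_pos(2), of j] dig_pos[OF fut_pst_pos(2), of DR j] by simp_all
    have "1 / (2 * pst i) < 1 / 2" "1 / (2 * fut i) < 1 / 2" using f p by simp_all
    then show ?thesis using f p by linarith
  next
    case 1
    show ?thesis unfolding 1 ends using q1(2) z1 iz RR iq by (intro conjI) linarith+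
  next
    case 2
    show ?thesis unfolding 2 ends using q1(2) z1 iz RR iq by (intro conjI) linarith+
  qed
  then show "fut i + 1 / (2 * pst i) < 2" "1 / (2 * fut i) + pst i < 2" by blast+
qed

text \<open>The states of one period; the second family lies between the \<open>L\<close> and the
  \<open>R\<close> of a block.\<close>

definition states :: "(real \<times> real) set" where
  "states = (\<lambda>i. (fut i, 1 / (2 * pst i))) ` {..Suc n} \<union>
     (\<lambda>i. (dig DR (fut (Suc i)), dig DL (1 / (2 * pst i)))) ` {..n}"

lemma states_bound:
  assumes "(u, w) \<in> states"
  shows "u > 0" "w > 0" "u + w < 2" "1 / (2 * u) + 1 / (2 * w) < 2"
proof -
  have "u > 0 \<and> w > 0 \<and> u + w < 2 \<and> 1 / (2 * u) + 1 / (2 * w) < 2"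
    using assms unfolding states_def
  proof (elim UnE imageE)
    fix i assume "(u, w) = (fut i, 1 / (2 * pst i))" "i \<in> {..Suc n}"
    then show ?thesis using state_bound[of i] fut_pst_pos[of i] by simp
  next
    fix i assume a: "(u, w) = (dig DR (fut (Suc i)), dig DL (1 / (2 * pst i)))" "i \<in> {..n}"
    have u: "u = dig DR (fut (Suc i))" and w: "w = 1 + 1 / (2 * pst i)" using a by (simp_all add: dig.simps(1))
    have p: "fut (Suc i) > 0" "pst i > 0" by (rule fut_pst_pos)+
    have "u > 0" unfolding u using p(1) by (rule dig_pos)
    have "w > 0" using p by (simp add: w add_pos_pos)
    have "u + w = fut i + 1 / (2 * pst i)" using fut_step[of i] a(2) U_eq by (simp add: u w)
    also have "\<dots> < 2" using a(2) by (intro state_bound) simp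
    finally have 1: "u + w < 2" .
    have "1 / (2 * u) = dig DL (1 / (2 * fut (Suc i)))" unfolding u using dig_dual[OF p(1), of DR] by simp
    moreover have "1 / (2 * w) = dig DR (pst i)"
      using dig_dual[of "1 / (2 * pst i)" DL] p(2) a(1) by simp
    ultimately have "1 / (2 * u) + 1 / (2 * w) = 1 / (2 * fut (Suc i)) + pst (Suc i)"
      using pst_step[of i] U_eq by (simp add: dig.simps(1))
    also have "\<dots> < 2" using a(2) by (intro state_bound) simp
    finally show ?thesis using 1 \<open>u > 0\<close> \<open>w > 0\<close> by simp
  qed
  then show "u > 0" "w > 0" "u + w < 2" "1 / (2 * u) + 1 / (2 * w) < 2" by blast+
qed

lemma states_step:
  assumes "(u, w) \<in> states"
  shows "\<exists>d u'. u = dig d u' \<and> u' > 0 \<and> w > 0 \<and> (u', dig d w) \<in> states"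
proof -
  have "w > 0" using states_bound[OF assms] by blast
  from assms have "\<exists>d u'. u = dig d u' \<and> u' > 0 \<and> (u', dig d w) \<in> states"
    unfolding states_def
  proof (elim UnE imageE)
    fix i assume a: "(u, w) = (fut i, 1 / (2 * pst i))" "i \<in> {..Suc n}"
    show "\<exists>d u'. u = dig d u' \<and> u' > 0 \<and> (u', dig d w) \<in>
      (\<lambda>i. (fut i, 1 / (2 * pst i))) ` {..Suc n} \<union> (\<lambda>i. (dig DR (fut (Suc i)), dig DL (1 / (2 * pst i)))) ` {..n}"
    proof (cases "i = Suc n")
      case True
      have e: "fut (Suc n) = z" "pst (Suc n) = q" "fut 0 = q" "pst 0 = z"
        by (simp_all add: fut_def pst_def q_def)
      have "dig DS (1 / (2 * q)) = 1 / (2 * z)" using dig_dual[OF pos(2), of DS] z_eq by simp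
      then have "u = dig DS (fut 0)" "dig DS w = 1 / (2 * pst 0)" using a(1) True e z_eq by auto
      then show ?thesis using fut_pst_pos(1)[of 0]
        by (intro exI[of _ DS] exI[of _ "fut 0"] conjI UnI1 image_eqI[of _ _ 0]) simp_all
    next
      case False
      then have "i \<le> n" using a(2) by simp
      then have "u = dig DL (dig DR (fut (Suc i)))" using fut_step[OF \<open>i \<le> n\<close>] a(1) by (simp add: blk.simps)
      moreover have "dig DR (fut (Suc i)) > 0" by (intro dig_pos fut_pst_pos)
      ultimately show ?thesis using a(1) \<open>i \<le> n\<close>
        by (intro exI[of _ DL] exI[of _ "dig DR (fut (Suc i))"] conjI UnI2 image_eqI[of _ _ i]) simp_all
    qed
  next
    fix i assume a: "(u, w) = (dig DR (fut (Suc i)), dig DL (1 / (2 * pst i)))" "i \<in> {..n}"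
    have "dig DR w = 1 / (2 * pst (Suc i))"
      using a(1) dig_dual[OF fut_pst_pos(2), of DR i] dig_dual[OF dig_pos[OF fut_pst_pos(2)], of DL DR i] pst_step[of i]
      by (simp add: blk.simps)
    then show "\<exists>d u'. u = dig d u' \<and> u' > 0 \<and> (u', dig d w) \<in>
      (\<lambda>i. (fut i, 1 / (2 * pst i))) ` {..Suc n} \<union> (\<lambda>i. (dig DR (fut (Suc i)), dig DL (1 / (2 * pst i)))) ` {..n}"
      using a fut_pst_pos(1)[of "Suc i"]
      by (intro exI[of _ DR] exI[of _ "fut (Suc i)"] conjI UnI1 image_eqI[of _ _ "Suc i"]) simp_all
  qed
  then show ?thesis using \<open>w > 0\<close> by blast
qed

text \<open>There are finitely many states, so the widths have a maximum l < 2, and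
  \<open>qnorm_ge_invariant\<close> extends the corner bound 1 / l to all coprime pairs.\<close>

lemma lagrange_upper: "\<exists>l<2. lagrange_number (circle_pt z) \<le> ereal l"
proof -
  define B where "B = (\<lambda>(u, w). u + w) ` states \<union> (\<lambda>(u, w). 1 / (2 * u) + 1 / (2 * w)) ` states"
  have mem: "(z, y) \<in> states"
    unfolding states_def by (intro UnI1 image_eqI[of _ _ "Suc n"]) (simp_all add: fut_def pst_def q_def y_def)
  have "finite B" "B \<noteq> {}" using mem by (auto simp: B_def states_def)
  have B_less: "b < 2" if "b \<in> B" for b
    using that states_bound(3,4) unfolding B_def by (elim UnE imageE) auto
  define l where "l = Max B"
  have "l < 2" unfolding l_def using \<open>finite B\<close> \<open>B \<noteq> {}\<close> states_bound by (subst Max_less_iff) (blast intro: B_less)+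
  have bound: "u + w \<le> l" "1 / (2 * u) + 1 / (2 * w) \<le> l" if "(u, w) \<in> states" for u w
  proof -
    have "(\<lambda>(u, w). u + w) (u, w) \<in> B" "(\<lambda>(u, w). 1 / (2 * u) + 1 / (2 * w)) (u, w) \<in> B"
      unfolding B_def using that by blast+
    then show "u + w \<le> l" "1 / (2 * u) + 1 / (2 * w) \<le> l"
      unfolding l_def using \<open>finite B\<close> by (auto intro: Max_ge)
  qed
  have "l > 0" using bound(1)[OF mem] pos by simp
  have "1 / l \<le> qnorm z y v" if "v \<in> coprime_pairs" for v
  proof (rule qnorm_ge_invariant[of states, OF states_step _ mem that])
    fix u w v assume s: "(u, w) \<in> states" and v: "v \<in> {(1, 0), (0, 1) :: nat \<times> nat}"
    note b = states_bound[OF s] bound[OF s]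
    have "1 / l \<le> 1 / (u + w)" using b by (intro divide_left_mono) auto
    moreover have "1 / (2 * u) + 1 / (2 * w) = (u + w) / (2 * (u * w))" using b by (simp add: field_simps)
    then have "(u + w) / (2 * (u * w)) \<le> l" using b by simp
    then have "1 / l \<le> 2 * (u * w) / (u + w)" using b \<open>l > 0\<close> by (simp add: field_simps)
    ultimately show "1 / l \<le> qnorm u w v" using v b by (auto simp: qnorm_def wt_def abs_mult)
  qed
  \<comment> \<open>Room below 2 for replacing the past y by \<open>past0 z\<close>.\<close>
  define l' where "l' = (l + 2) / 2"
  define \<tau> where "\<tau> = (1 / l + 1 / l') / 2"
  have l': "l < l'" "l' < 2" "0 < l'" using \<open>l < 2\<close> \<open>l > 0\<close> by (simp_all add: l'_def)
  then have "1 / l' < 1 / l" using \<open>l > 0\<close> by (simp add: frac_less2)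
  then have t: "1 / l' < \<tau>" "\<tau> < 1 / l" by (simp_all add: \<tau>_def)
  have "few z y \<tau>"
  proof -
    have "{v \<in> coprime_pairs. qnorm z y v \<le> \<tau>} = {}"
      using \<open>\<And>v. v \<in> coprime_pairs \<Longrightarrow> 1 / l \<le> qnorm z y v\<close> t(2) by force
    then show ?thesis unfolding few_def by (metis finite.emptyI)
  qed
  then have "few z (past0 z) (1 / l')"
    using t(1) by (rule few_change_past) (simp_all add: pos past0_z less_imp_le)
  then have "lagrange_number (circle_pt z) \<le> ereal l'"
    using few_iff_ray_dist[of z] pos l' by (intro lagrange_number_le) auto
  then show ?thesis using l' by blast
qed

section \<open>Lower bound for the periodic words\<close>

lemma qnorm_LR:
  assumes "a > 0" "g > 0" "v \<in> coprime_pairs"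
  shows "qnorm (U a) (1 / (2 * g)) (act DL (act DR v)) = qnorm a (1 / (2 * U g)) v"
proof -
  have p: "dig DR a > 0" "dig DR g > 0" "1 / (2 * g) > 0" "1 / (2 * dig DR g) > 0"
    using assms dig_pos[of a DR] dig_pos[of g DR] by simp_all
  have d: "dig DL (1 / (2 * g)) = 1 / (2 * dig DR g)" "dig DR (1 / (2 * dig DR g)) = 1 / (2 * U g)"
    using dig_dual[OF assms(2), of DR] dig_dual[OF p(2), of DL] by (simp_all add: blk.simps)
  have "qnorm (dig DL (dig DR a)) (1 / (2 * g)) (act DL (act DR v)) = qnorm (dig DR a) (1 / (2 * dig DR g)) (act DR v)"
    using qnorm_act[OF p(1,3) act_mem[OF assms(3)], of DL DR] d(1) by metis
  also have "\<dots> = qnorm a (1 / (2 * U g)) v"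
    using qnorm_act[OF assms(1) p(4) assms(3), of DR] d(2) by metis
  finally show ?thesis by (simp add: blk.simps)
qed

definition act_LR :: "nat \<times> nat \<Rightarrow> nat \<times> nat" where "act_LR v = act DL (act DR v)"

lemma act_LR_mem: "v \<in> coprime_pairs \<Longrightarrow> (act_LR ^^ k) v \<in> coprime_pairs"
  by (induction k) (simp_all add: act_LR_def act_mem)

lemma inj_act_LR: "inj_on (act_LR ^^ k) coprime_pairs"
proof (induction k)
  case (Suc k)
  have "inj_on act_LR coprime_pairs"
    using inj_act act_mem unfolding act_LR_def inj_on_def by metis
  then have "inj_on (act_LR \<circ> act_LR ^^ k) coprime_pairs"
    using Suc act_LR_mem by (intro comp_inj_on) (auto intro: inj_on_subset)
  then show ?case by (simp only: funpow.simps)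
qed simp

lemma qnorm_LR_power:
  assumes "a > 0" "g > 0" "v \<in> coprime_pairs"
  shows "qnorm ((U ^^ k) a) (1 / (2 * g)) ((act_LR ^^ k) v) = qnorm a (1 / (2 * (U ^^ k) g)) v"
  using assms(2)
proof (induction k arbitrary: g)
  case (Suc k)
  have "qnorm ((U ^^ Suc k) a) (1 / (2 * g)) ((act_LR ^^ Suc k) v) = qnorm ((U ^^ k) a) (1 / (2 * U g)) ((act_LR ^^ k) v)"
    using qnorm_LR[OF funpow_U_pos[OF assms(1)] Suc.prems act_LR_mem[OF assms(3)], of k k] by (simp add: act_LR_def)
  also have "\<dots> = qnorm a (1 / (2 * (U ^^ k) (U g))) v"
    using Suc.prems by (intro Suc.IH blk_pos)
  finally show ?case by (simp only: funpow_Suc_right comp_def)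
qed simp

text \<open>One period acts injectively on coprime pairs and preserves the form, so a finite W would
  be permuted. But (0, 1) lies in W, with value exactly 1 / \<open>height\<close>, and is not in the
  range of \<open>act DS\<close>.\<close>

lemma not_few: "\<not> few z y (1 / height)"
proof
  assume few: "few z y (1 / height)"
  define A where "A = act DS \<circ> act_LR ^^ Suc n"
  define W where "W = {v \<in> coprime_pairs. qnorm z y v \<le> 1 / height}"
  have A_mem: "A v \<in> coprime_pairs" if "v \<in> coprime_pairs" for v
    unfolding A_def comp_def using that by (intro act_mem act_LR_mem)
  have A_qnorm: "qnorm z y (A v) = qnorm z y v" if "v \<in> coprime_pairs" for v
  proof -
    have y: "dig DS y = 1 / (2 * z)" using dig_dual[OF pos(2), of DS] z_eq by (simp add: y_def)
    have "qnorm (dig DS q) y (A v) = qnorm q (dig DS y) ((act_LR ^^ Suc n) v)"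
      unfolding A_def comp_def using pos that by (intro qnorm_act act_LR_mem)
    also have "\<dots> = qnorm z (1 / (2 * (U ^^ Suc n) z)) v"
      unfolding y q_def using pos(1) that by (intro qnorm_LR_power)
    finally show ?thesis using z_eq by (simp only: y_def q_def)
  qed
  have "inj_on A coprime_pairs"
    unfolding A_def by (intro comp_inj_on inj_act_LR inj_on_subset[OF inj_act]) (use act_LR_mem in blast)
  then have inj: "inj_on A W" by (rule inj_on_subset) (auto simp: W_def)
  have "A ` W \<subseteq> W" using A_mem A_qnorm by (auto simp: W_def)
  then have "A ` W = W" using few inj by (intro endo_inj_surj) (simp_all add: few_def W_def)
  moreover have "(0, 1) \<in> W"
  proof -
    have "qnorm z y (0, 1) = 2 * (z * y) / (z + y)" using pos by (simp add: qnorm_def wt_def abs_mult)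
    also have "\<dots> = 1 / (1 / (2 * z) + 1 / (2 * y))" using pos by (simp add: field_simps)
    also have "1 / (2 * z) + 1 / (2 * y) = height"
      using inverse_double_dig_S[OF pos(2)] z_eq q_eq U_eq[of h] by (simp add: height_def y_def)
    finally show ?thesis using coprime_pairs_unit by (simp add: W_def)
  qed
  ultimately obtain v where v: "v \<in> W" "A v = (0, 1)" by (metis imageE)
  define u where "u = (act_LR ^^ Suc n) v"
  have "u \<in> coprime_pairs" unfolding u_def using v by (intro act_LR_mem) (simp add: W_def)
  moreover have "act DS u = (0, 1)" using v(2) by (simp add: A_def u_def)
  ultimately show False by (cases u) (auto simp: coprime_pairs_def split: if_splits)
qed

lemma lagrange_lower: "ereal height \<le> lagrange_number (circle_pt z)"
proof (rule ccontr)
  assume "\<not> ?thesis"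
  then have "lagrange_number (circle_pt z) < ereal height" by simp
  then obtain l where l: "lagrange_number (circle_pt z) < ereal l" "l < height"
    using ereal_dense2 by force
  then have "l > 0" using lagrange_number_nonneg[of "circle_pt z"] by (metis ereal_less(2) order_le_less_trans)
  then have "few z (past0 z) (1 / l)"
    using lagrange_number_less_imp_finite[OF l(1)] few_iff_ray_dist[of z] pos by simp
  moreover have "1 / height < 1 / l" using l \<open>l > 0\<close> by (simp add: frac_less2)
  ultimately have "few z y (1 / height)" by (rule few_change_past) (simp_all add: pos past0_z less_imp_le)
  then show False using not_few by blast
qed

end

lemma periodic_word_exists: "\<exists>z. periodic_word n z"
proof -
  define f where "f = blk False \<circ> U ^^ Suc n"
  have f: "contr_on {1/2..3/2} f" unfolding f_def by (rule contr_on_S_U)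
  have "\<exists>!z\<in>{1/2..3/2}. f z = z"
  proof (rule Banach_fix)
    show "complete {1/2..3/2 :: real}" by (intro compact_imp_complete) simp
    show "f ` {1/2..3/2} \<subseteq> {1/2..3/2}" using f unfolding contr_on_def by blast
    show "dist (f a) (f b) \<le> 1 / 2 * dist a b" if "a \<in> {1/2..3/2}" "b \<in> {1/2..3/2}" for a b
      using f that unfolding contr_on_def dist_real_def by simp
  qed auto
  then obtain z where "z \<in> {1/2..3/2}" "f z = z" by blast
  then have "periodic_word n z"
    by unfold_locales (simp_all add: f_def blk.simps(1))
  then show ?thesis ..
qed

theorem theorem1p2:
  "2 islimpt lagrange_spectrum \<and> (\<forall>x. x islimpt lagrange_spectrum \<longrightarrow> 2 \<le> x)"
proof (intro conjI allI impI)
  show "2 islimpt lagrange_spectrum"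
    unfolding islimpt_approachable
  proof (intro allI impI)
    fix e :: real assume "e > 0"
    obtain n :: nat where n: "(1 / 2 :: real) ^ n < e" using real_arch_pow_inv[OF \<open>e > 0\<close>, of "1/2"] by auto
    obtain z where "periodic_word n z" using periodic_word_exists by blast
    then interpret periodic_word n z .
    obtain l where l: "l < 2" "lagrange_number (circle_pt z) \<le> ereal l" using lagrange_upper by blast
    obtain r where r: "lagrange_number (circle_pt z) = ereal r"
      using l(2) lagrange_lower by (cases "lagrange_number (circle_pt z)") auto
    \<comment> \<open>The strict upper bound makes r differ from 2, as an accumulation point
      requires.\<close>
    have "r < 2" "2 - 1 / 2 ^ n \<le> r" using r l lagrange_lower height_ge by auto
    moreover have "1 / 2 ^ n < e" using n by (simp add: power_one_over)
    moreover have "r \<in> lagrange_spectrum"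
      using r circle_pt_mem pos(1) by (auto simp: lagrange_spectrum_def intro!: bexI[of _ "circle_pt z"])
    ultimately show "\<exists>x'\<in>lagrange_spectrum. x' \<noteq> 2 \<and> dist x' 2 < e"
      by (intro bexI[of _ r]) (auto simp: dist_real_def)
  qed
next
  fix x assume lim: "x islimpt lagrange_spectrum"
  show "2 \<le> x"
  proof (rule ccontr)
    assume "\<not> 2 \<le> x"
    define e where "e = min 1 ((2 - x) / 2)"
    have "e \<le> (2 - x) / 2" unfolding e_def by (rule min.cobounded2)
    then have e: "0 < e" "e \<le> 1" "x < 2 - e" using \<open>\<not> 2 \<le> x\<close> by (auto simp: e_def)
    have "x islimpt (lagrange_spectrum \<inter> {..<2 - e})"
      using e(3) by (intro islimpt_Int_eventually[OF lim] eventually_at_in_open') simp_all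
    moreover have "lagrange_spectrum \<inter> {..<2 - e} = {l \<in> lagrange_spectrum. l < 2 - e}" by auto
    ultimately show False using finite_spectrum_below[OF e(1,2)] islimpt_finite by metis
  qed
qed

end
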